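(* Let $N\ge1$, $1<p_1,\dots,p_N<\infty$, and $1\le p<\infty$. Then $\ell_p$ embeds into $\ell_{p_1}\hat\otimes\cdots\hat\otimes\ell_{p_N}$ if and only if there exists a non-empty $A\subset\{1,\dots,N\}$ such that $p=r_A$.
   Context: $\hat\otimes$ denotes the (completed) projective tensor product of Banach spaces. "Embeds" means: is isomorphic (linearly homeomorphic) to a closed subspace. For a non-empty $A\subset\{1,\dots,N\}$, $r_A\in[1,\infty)$ is defined by $\frac1{r_A}=\min\bigl\{1,\sum_{i\in A}\frac1{p_i}\bigr\}$. *)

theory Defs
  imports "HOL-Analysis.Analysis" "HOL-Library.Poly_Mapping"
begin

text \<open>
  The spaces involved depend on real parameters (the exponents), so they cannot be types of class
  \<^class>\<open>banach\<close>; they are carrier-based structures over a scalar type \<open>'k\<close>.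
\<close>

record ('k, 'v) nspace =
  elems  :: "'v set"
  vadd   :: "'v \<Rightarrow> 'v \<Rightarrow> 'v"
  vzero  :: "'v"
  vscale :: "'k \<Rightarrow> 'v \<Rightarrow> 'v"
  vnorm  :: "'v \<Rightarrow> real"

definition vdiff :: "('k::ring_1, 'v) nspace \<Rightarrow> 'v \<Rightarrow> 'v \<Rightarrow> 'v" where
  "vdiff V x y = vadd V x (vscale V (- 1) y)"

text \<open>\<^const>\<open>Metric_space\<close> requires nonnegativity and symmetry also off the carrier, hence the
  default value 0 there.\<close>

definition vdist :: "('k::ring_1, 'v) nspace \<Rightarrow> 'v \<Rightarrow> 'v \<Rightarrow> real" where
  "vdist V x y = (if x \<in> elems V \<and> y \<in> elems V then vnorm V (vdiff V x y) else 0)"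

definition norm_topology :: "('k::ring_1, 'v) nspace \<Rightarrow> 'v topology" where
  "norm_topology V = Metric_space.mtopology (elems V) (vdist V)"

definition linear_map_on ::
    "('k, 'v) nspace \<Rightarrow> ('k, 'w) nspace \<Rightarrow> ('v \<Rightarrow> 'w) \<Rightarrow> bool" where
  "linear_map_on V W T \<longleftrightarrow>
     T \<in> elems V \<rightarrow> elems W \<and>
     (\<forall>x\<in>elems V. \<forall>y\<in>elems V. T (vadd V x y) = vadd W (T x) (T y)) \<and>
     (\<forall>c. \<forall>x\<in>elems V. T (vscale V c x) = vscale W c (T x))"

definition embeds_into :: "('k::ring_1, 'v) nspace \<Rightarrow> ('k, 'w) nspace \<Rightarrow> bool" where
  "embeds_into V W \<longleftrightarrow>
     (\<exists>T. linear_map_on V W T \<and>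
          closedin (norm_topology W) (T ` elems V) \<and>
          homeomorphic_map (norm_topology V)
            (subtopology (norm_topology W) (T ` elems V)) T)"

definition ell :: "real \<Rightarrow> ('k::real_normed_field, nat \<Rightarrow> 'k) nspace" where
  "ell p = \<lparr> elems  = {x. summable (\<lambda>n. norm (x n) powr p)},
             vadd   = (\<lambda>x y n. x n + y n),
             vzero  = (\<lambda>n. 0),
             vscale = (\<lambda>c x n. c * x n),
             vnorm  = (\<lambda>x. suminf (\<lambda>n. norm (x n) powr p) powr (1 / p)) \<rparr>"

text \<open>Quotient of \<open>V\<close> by a congruence \<open>R\<close>, with a norm on the classes supplied separately.\<close>

definition quotient_nspace ::
    "('k, 'v) nspace \<Rightarrow> ('v \<times> 'v) set \<Rightarrow> ('v set \<Rightarrow> real) \<Rightarrow> ('k, 'v set) nspace" where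
  "quotient_nspace V R \<nu> =
     \<lparr> elems  = elems V // R,
       vadd   = (\<lambda>A B. \<Union>x\<in>A. \<Union>y\<in>B. R `` {vadd V x y}),
       vzero  = R `` {vzero V},
       vscale = (\<lambda>c A. \<Union>x\<in>A. R `` {vscale V c x}),
       vnorm  = \<nu> \<rparr>"

definition cauchy_in :: "('k::ring_1, 'v) nspace \<Rightarrow> (nat \<Rightarrow> 'v) \<Rightarrow> bool" where
  "cauchy_in V s \<longleftrightarrow> range s \<subseteq> elems V \<and>
     (\<forall>e>0. \<exists>M. \<forall>m\<ge>M. \<forall>n\<ge>M. vnorm V (vdiff V (s m) (s n)) < e)"

definition cauchy_nspace :: "('k::ring_1, 'v) nspace \<Rightarrow> ('k, nat \<Rightarrow> 'v) nspace" where
  "cauchy_nspace V =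
     \<lparr> elems  = {s. cauchy_in V s},
       vadd   = (\<lambda>s t n. vadd V (s n) (t n)),
       vzero  = (\<lambda>n. vzero V),
       vscale = (\<lambda>c s n. vscale V c (s n)),
       vnorm  = (\<lambda>s. lim (\<lambda>n. vnorm V (s n))) \<rparr>"

definition null_rel :: "('k::ring_1, 'v) nspace \<Rightarrow> ((nat \<Rightarrow> 'v) \<times> (nat \<Rightarrow> 'v)) set" where
  "null_rel V = {(s, t). cauchy_in V s \<and> cauchy_in V t \<and>
                         (\<lambda>n. vnorm V (vdiff V (s n) (t n))) \<longlonglongrightarrow> 0}"

text \<open>The limit norm takes the same value on all representatives of a class.\<close>

definition completion :: "('k::ring_1, 'v) nspace \<Rightarrow> ('k, (nat \<Rightarrow> 'v) set) nspace" where
  "completion V = quotient_nspace (cauchy_nspace V) (null_rel V)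
     (\<lambda>X. the_elem (vnorm (cauchy_nspace V) ` X))"

definition fscale :: "'k::field \<Rightarrow> ('t \<Rightarrow>\<^sub>0 'k) \<Rightarrow> ('t \<Rightarrow>\<^sub>0 'k)" where
  "fscale c u = Poly_Mapping.map ((*) c) u"

lemma lookup_fscale: "Poly_Mapping.lookup (fscale c u) t = c * Poly_Mapping.lookup u t"
  by (simp add: fscale_def map.rep_eq when_def)

global_interpretation free_space: vector_space fscale
  by unfold_locales
    (auto intro!: poly_mapping_eqI simp: lookup_fscale lookup_add algebra_simps)

definition tuples :: "'i set \<Rightarrow> ('i \<Rightarrow> ('k, 'v) nspace) \<Rightarrow> ('i \<Rightarrow> 'v) set" where
  "tuples I E = (\<Pi>\<^sub>E i\<in>I. elems (E i))"

abbreviation gen :: "'t \<Rightarrow> ('t \<Rightarrow>\<^sub>0 'k::field)" where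
  "gen t \<equiv> Poly_Mapping.single t 1"

text \<open>The free vector space on the tuples; its norm field is irrelevant (the tensor norm is
  defined on the quotient).\<close>

definition free_nspace ::
    "'i set \<Rightarrow> ('i \<Rightarrow> ('k::field, 'v) nspace) \<Rightarrow> ('k, ('i \<Rightarrow> 'v) \<Rightarrow>\<^sub>0 'k) nspace" where
  "free_nspace I E =
     \<lparr> elems = {u. Poly_Mapping.keys u \<subseteq> tuples I E}, vadd = (+), vzero = 0, vscale = fscale,
       vnorm = (\<lambda>u. 0) \<rparr>"

definition multilinear_relators ::
    "'i set \<Rightarrow> ('i \<Rightarrow> ('k::field, 'v) nspace) \<Rightarrow> (('i \<Rightarrow> 'v) \<Rightarrow>\<^sub>0 'k) set" where
  "multilinear_relators I E =
     {gen (t(i := vadd (E i) x y)) - (gen (t(i := x)) + gen (t(i := y))) | t i x y.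
        t \<in> tuples I E \<and> i \<in> I \<and> x \<in> elems (E i) \<and> y \<in> elems (E i)} \<union>
     {gen (t(i := vscale (E i) c x)) - fscale c (gen (t(i := x))) | t i c x.
        t \<in> tuples I E \<and> i \<in> I \<and> x \<in> elems (E i)}"

definition tensor_rel ::
    "'i set \<Rightarrow> ('i \<Rightarrow> ('k::field, 'v) nspace) \<Rightarrow>
      ((('i \<Rightarrow> 'v) \<Rightarrow>\<^sub>0 'k) \<times> (('i \<Rightarrow> 'v) \<Rightarrow>\<^sub>0 'k)) set" where
  "tensor_rel I E = {(u, v). u \<in> elems (free_nspace I E) \<and> v \<in> elems (free_nspace I E) \<and>
                             u - v \<in> free_space.span (multilinear_relators I E)}"

text \<open>The projective norm of \<open>z\<close> is the infimum of \<open>\<Sum>\<^sub>j \<Prod>\<^sub>i \<parallel>x\<^sub>j\<^sub>i\<parallel>\<close> over all finite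
  representations \<open>z = \<Sum>\<^sub>j \<Otimes>\<^sub>i x\<^sub>j\<^sub>i\<close>; scalar coefficients are absorbed into the factors, which
  needs a nonempty index set.\<close>

definition projective_norm ::
    "'i set \<Rightarrow> ('i \<Rightarrow> ('k::field, 'v) nspace) \<Rightarrow> (('i \<Rightarrow> 'v) \<Rightarrow>\<^sub>0 'k) set \<Rightarrow> real" where
  "projective_norm I E z =
     Inf {\<Sum>j<m. \<Prod>i\<in>I. vnorm (E i) (x j i) | (m::nat) x.
            (\<forall>j<m. x j \<in> tuples I E) \<and> z = tensor_rel I E `` {\<Sum>j<m. gen (x j)}}"

definition projective_tensor ::
    "'i set \<Rightarrow> ('i \<Rightarrow> ('k::field, 'v) nspace) \<Rightarrow> ('k, (('i \<Rightarrow> 'v) \<Rightarrow>\<^sub>0 'k) set) nspace" where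
  "projective_tensor I E =
     quotient_nspace (free_nspace I E) (tensor_rel I E) (projective_norm I E)"

definition completed_projective_tensor ::
    "'i set \<Rightarrow> ('i \<Rightarrow> ('k::field, 'v) nspace) \<Rightarrow>
      ('k, (nat \<Rightarrow> (('i \<Rightarrow> 'v) \<Rightarrow>\<^sub>0 'k) set) set) nspace" where
  "completed_projective_tensor I E = completion (projective_tensor I E)"

definition r_exponent :: "('i \<Rightarrow> real) \<Rightarrow> 'i set \<Rightarrow> real" where
  "r_exponent p A = 1 / min 1 (\<Sum>i\<in>A. 1 / p i)"

end

theory Submission
  imports Defs
begin

text \<open>
  An algebraic tensor is identified with the function of multi-indices that it defines, and its
  projective norm is compared with finite representations of that function. Suppose \<open>u\<^sub>n\<close> is supported
  in \<open>I\<^sub>n \<times> \<dots> \<times> I\<^sub>n\<close> for disjoint \<open>I\<^sub>n\<close>. Then the norm of \<open>\<Sum>\<^sub>n u\<^sub>n\<close> is the \<open>r\<^sub>A\<close>-norm of the sequence of norms: the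
  lower estimate is Minkowski together with Hoelder for an arbitrary representation of the sum. For the
  upper estimate, convexity reduces to elementary \<open>u\<^sub>n\<close>, and averaging over signs shows that the block
  diagonal part of an elementary tensor is no larger than the tensor. Diagonal sequences of unit vectors
  therefore span isometric copies of the spaces with exponent \<open>r\<^sub>A\<close>. Conversely, given an embedding,
  either fixing one coordinate remains an isomorphism on some block subspace, so that one factor can be
  dropped, or all slices are strictly singular and a gliding hump yields normalised blocks with almost
  block diagonal images; comparing the growth of sums of \<open>M\<close> blocks then determines the exponent.
\<close>

section \<open>Sequence spaces\<close>

text \<open>All estimates are made for algebraic tensors, because elements of the completion are
  only classes of Cauchy sequences: images of unit vectors are perturbed into algebraic tensors, and
  conversely only finite diagonal sums are measured. Coordinates separate algebraic tensors of
  sequence spaces, so nothing is lost by passing to functions, on which multipliers, slices and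
  supports are pointwise notions. The \<open>min\<close> in the exponent separates two regimes. If
  the reciprocals of the p_i sum to at least 1, the triangle inequality is already sharp for block
  sums. Otherwise a cost s can be split into powers of s with exponents r / p_i, which sum to 1, one
  for each factor; this is where r comes from. The obstacle to a direct gliding hump is a sequence
  such as e_0 tensor e_n: it never leaves a fixed slice, so it never becomes block diagonal. Its
  exponent is that of a smaller product, and this is how proper subsets A arise. For the empty
  product only scalars are left, which cannot contain l_q, so the descent stops at a non-empty
  A.\<close>

abbreviation lnorm :: "real \<Rightarrow> (nat \<Rightarrow> 'k::real_normed_field) \<Rightarrow> real" where
  "lnorm q \<equiv> vnorm (ell q)"

abbreviation lspace :: "real \<Rightarrow> (nat \<Rightarrow> 'k::real_normed_field) set" where
  "lspace q \<equiv> elems (ell q)"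

lemma lnorm_def: "lnorm q x = suminf (\<lambda>n. norm (x n) powr q) powr (1 / q)"
  by (simp add: ell_def)

lemma lspace_def: "lspace q = {x. summable (\<lambda>n. norm (x n) powr q)}"
  by (simp add: ell_def)

lemma lnorm_nonneg [simp]: "0 \<le> lnorm q x"
  by (simp add: lnorm_def)

lemma lnorm_powr:
  assumes "0 < q" "x \<in> lspace q"
  shows "lnorm q x powr q = suminf (\<lambda>n. norm (x n) powr q)"
  using assms by (simp add: lnorm_def powr_powr suminf_nonneg lspace_def)

lemma sum_le_lnorm_powr:
  assumes "0 < q" "x \<in> lspace q" "finite S"
  shows "(\<Sum>n\<in>S. norm (x n) powr q) \<le> lnorm q x powr q"
  using assms by (simp add: lnorm_powr lspace_def sum_le_suminf)

lemma lspace_lnorm_leI: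
  assumes "0 < q" "0 \<le> t" "\<And>n. (\<Sum>k<n. norm (x k) powr q) \<le> t powr q"
  shows "x \<in> lspace q" "lnorm q x \<le> t"
proof -
  have s: "summable (\<lambda>n. norm (x n) powr q)"
    by (rule summableI_nonneg_bounded) (use assms in auto)
  then show "x \<in> lspace q" by (simp add: lspace_def)
  have "suminf (\<lambda>n. norm (x n) powr q) \<le> t powr q"
    using s assms(3) by (rule suminf_le_const)
  then have "lnorm q x \<le> (t powr q) powr (1 / q)"
    unfolding lnorm_def using assms by (intro powr_mono2 suminf_nonneg s) auto
  then show "lnorm q x \<le> t" using assms by (simp add: powr_powr)
qed

lemma norm_le_lnorm:
  assumes "0 < q" "x \<in> lspace q"
  shows "norm (x n) \<le> lnorm q x"
proof -
  have "norm (x n) powr q \<le> lnorm q x powr q"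
    using sum_le_lnorm_powr[OF assms, of "{n}"] by simp
  then show ?thesis
    by (meson assms(1) linorder_not_less lnorm_nonneg powr_less_mono2)
qed

section \<open>Inequalities of Minkowski and Hoelder\<close>

text \<open>Convexity is applied between positive arguments; if one argument is 0, the claim reduces
  to \<open>c powr q \<le> c\<close> for c in the unit interval.\<close>

lemma powr_convex_combination:
  fixes x y :: real
  assumes q: "1 \<le> q" and "0 \<le> x" "0 \<le> y" "0 \<le> u" "0 \<le> v" "u + v = 1"
  shows "(u * x + v * y) powr q \<le> u * x powr q + v * y powr q"
proof -
  have le: "c powr q \<le> c" if "0 \<le> c" "c \<le> 1" for c :: real
    using that q powr_mono'[of 1 q c] by (cases "c = 0") auto
  consider "x = 0" | "y = 0" | "0 < x" "0 < y" using assms by linarith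
  then show ?thesis
  proof cases
    case 1 then show ?thesis
      using le[of v] assms by (simp add: powr_mult mult_right_mono)
  next
    case 2 then show ?thesis
      using le[of u] assms by (simp add: powr_mult mult_right_mono)
  next
    case 3 then show ?thesis
      using powr_convex[OF q] assms unfolding convex_on_def by auto
  qed
qed

text \<open>Formulated with arbitrary upper bounds s and t in place of the norms, which is what an
  induction over costs provides.\<close>

lemma Minkowski_sum:
  fixes a b :: "'a \<Rightarrow> real"
  assumes q: "1 \<le> q" and S: "finite S" and nn: "\<And>n. n \<in> S \<Longrightarrow> 0 \<le> a n" "\<And>n. n \<in> S \<Longrightarrow> 0 \<le> b n"
    and "0 \<le> s" "0 \<le> t"
    and a: "(\<Sum>n\<in>S. a n powr q) \<le> s powr q" and b: "(\<Sum>n\<in>S. b n powr q) \<le> t powr q"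
  shows "(\<Sum>n\<in>S. (a n + b n) powr q) \<le> (s + t) powr q"
proof -
  have zero: "f n = 0" if "(\<Sum>n\<in>S. f n powr q) \<le> 0 powr q" "\<And>n. n \<in> S \<Longrightarrow> 0 \<le> f n" "n \<in> S" for f :: "'a \<Rightarrow> real" and n
  proof -
    have "(\<Sum>n\<in>S. f n powr q) = 0" using that by (intro antisym sum_nonneg) auto
    then show ?thesis using that S by (simp add: sum_nonneg_eq_0_iff)
  qed
  consider "s = 0" | "t = 0" | "0 < s" "0 < t" using assms by linarith
  then show ?thesis
  proof cases
    case 1 then show ?thesis using zero[of a] a b nn by simp
  next
    case 2 then show ?thesis using zero[of b] a b nn by simp
  next
    case 3
    define u where "u = s / (s + t)"
    define v where "v = t / (s + t)"
    have uv: "0 \<le> u" "0 \<le> v" "u + v = 1"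
      using 3 by (auto simp: u_def v_def add_divide_distrib[symmetric])
    have "(a n + b n) powr q \<le> (s + t) powr q * (u * (a n powr q / s powr q) + v * (b n powr q / t powr q))"
      if "n \<in> S" for n
    proof -
      \<comment> \<open>Up to the factor s + t the sum is a convex combination of the normalised
        entries \<open>a n / s\<close> and \<open>b n / t\<close>, so convexity applies entry by
        entry.\<close>
      have eq: "a n + b n = (s + t) * (u * (a n / s) + v * (b n / t))"
      proof -
        have "(s + t) * (u * (a n / s)) = a n" "(s + t) * (v * (b n / t)) = b n"
          using 3 by (auto simp: u_def v_def)
        then show ?thesis by (simp add: distrib_left)
      qed
      have "(a n + b n) powr q = (s + t) powr q * (u * (a n / s) + v * (b n / t)) powr q"
        unfolding eq using 3 nn that uv by (subst powr_mult) auto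
      also have "\<dots> \<le> (s + t) powr q * (u * (a n / s) powr q + v * (b n / t) powr q)"
        using 3 nn that uv q by (intro mult_left_mono powr_convex_combination) auto
      finally show ?thesis using 3 nn that by (simp add: powr_divide)
    qed
    then have "(\<Sum>n\<in>S. (a n + b n) powr q) \<le>
        (s + t) powr q * (u * ((\<Sum>n\<in>S. a n powr q) / s powr q) + v * ((\<Sum>n\<in>S. b n powr q) / t powr q))"
      by (simp add: sum_distrib_left sum_divide_distrib flip: sum.distrib)
        (rule sum_mono, simp add: sum_distrib_left sum_divide_distrib)
    also have "\<dots> \<le> (s + t) powr q * (u * 1 + v * 1)"
      using 3 a b uv by (intro mult_left_mono add_mono) auto
    finally show ?thesis using uv by simp
  qed
qed

text \<open>Jensen's inequality for \<open>exp\<close> at the points \<open>ln (x i)\<close>; a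
  vanishing entry makes the product 0 and is split off because it has no logarithm.\<close>

lemma weighted_arith_geom_mean:
  fixes w x :: "'a \<Rightarrow> real"
  assumes S: "finite S" and w: "\<And>i. i \<in> S \<Longrightarrow> 0 \<le> w i" "sum w S = 1"
    and x: "\<And>i. i \<in> S \<Longrightarrow> 0 \<le> x i"
  shows "(\<Prod>i\<in>S. x i powr w i) \<le> (\<Sum>i\<in>S. w i * x i)"
proof (cases "\<exists>i\<in>S. x i = 0")
  case True
  then have "(\<Prod>i\<in>S. x i powr w i) = 0" using S by (auto simp: prod_zero_iff)
  then show ?thesis using w x by (simp add: sum_nonneg)
next
  case False
  then have pos: "0 < x i" if "i \<in> S" for i using x that by force
  have "(\<Prod>i\<in>S. x i powr w i) = exp (\<Sum>i\<in>S. w i *\<^sub>R ln (x i))"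
    using S pos by (simp add: exp_sum powr_def less_imp_neq[symmetric] cong: prod.cong)
  also have "\<dots> \<le> (\<Sum>i\<in>S. w i * exp (ln (x i)))"
    using w by (intro convex_on_sum[OF S _ exp_convex]) auto
  finally show ?thesis using pos by (simp cong: sum.cong)
qed

text \<open>Covers sums of reciprocals on both sides of 1. After normalisation each factor is at
  most 1, so exponents whose sum exceeds 1 may be lowered until they sum to 1, which only enlarges
  the product; then the weighted mean inequality applies.\<close>

lemma Hoelder_sum:
  fixes a :: "'i \<Rightarrow> 'a \<Rightarrow> real" and p :: "'i \<Rightarrow> real"
  assumes A: "finite A" "A \<noteq> {}" and p: "\<And>i. i \<in> A \<Longrightarrow> 0 < p i" and S: "finite S"
    and nn: "\<And>i n. i \<in> A \<Longrightarrow> n \<in> S \<Longrightarrow> 0 \<le> a i n" and t: "\<And>i. i \<in> A \<Longrightarrow> 0 \<le> t i"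
    and le: "\<And>i. i \<in> A \<Longrightarrow> (\<Sum>n\<in>S. a i n powr p i) \<le> t i powr p i"
  shows "(\<Sum>n\<in>S. (\<Prod>i\<in>A. a i n) powr r_exponent p A) \<le> (\<Prod>i\<in>A. t i) powr r_exponent p A"
proof -
  define r where "r = r_exponent p A"
  \<comment> \<open>The excess: it equals 1 if the reciprocals sum to at most 1; otherwise r = 1 and
    it is their sum. Dividing the exponents \<open>r / p i\<close> by it turns them into
    weights.\<close>
  define \<sigma> where "\<sigma> = (\<Sum>i\<in>A. r / p i)"
  have pos: "0 < (\<Sum>i\<in>A. 1 / p i)" using A p by (intro sum_pos) auto
  have r: "1 \<le> r" "r \<ge> 1 / (\<Sum>i\<in>A. 1 / p i)"
    using pos by (auto simp: r_def r_exponent_def min_def field_simps)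
  have \<sigma>: "1 \<le> \<sigma>"
    using r(2) pos by (simp add: \<sigma>_def field_simps sum_distrib_left)
  have term_le: "a i n powr p i \<le> t i powr p i" if "i \<in> A" "n \<in> S" for i n
    using le[OF that(1)] member_le_sum[of n S "\<lambda>n. a i n powr p i"] that S by force
  have a_le: "a i n \<le> t i" if "i \<in> A" "n \<in> S" for i n
    using term_le[OF that] p[OF that(1)] t[OF that(1)]
    by (meson linorder_not_less powr_less_mono2)
  show ?thesis
  proof (cases "\<exists>i\<in>A. t i = 0")
    case True
    then obtain i where i: "i \<in> A" "t i = 0" by blast
    then have "(\<Prod>i\<in>A. a i n) = 0" if "n \<in> S" for n
      using a_le[OF i(1) that] nn[OF i(1) that] A i that by (intro prod_zero) auto
    then show ?thesis by simp
  next
    case False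
    then have tp: "0 < t i" if "i \<in> A" for i using t that by force
    have main: "(\<Prod>i\<in>A. a i n) powr r \<le> (\<Prod>i\<in>A. t i) powr r * (\<Sum>i\<in>A. (r / p i / \<sigma>) * (a i n powr p i / t i powr p i))"
      if n: "n \<in> S" for n
    proof -
      define b where "b i = a i n powr p i / t i powr p i" for i
      have b: "0 \<le> b i" "b i \<le> 1" if "i \<in> A" for i
        using term_le[OF that n] tp[OF that] by (auto simp: b_def)
      have "(\<Prod>i\<in>A. a i n) powr r = (\<Prod>i\<in>A. a i n powr r)"
        using nn n by (simp add: prod_powr_distrib)
      also have "\<dots> = (\<Prod>i\<in>A. t i powr r * b i powr (r / p i))"
      proof (rule prod.cong)
        fix i assume i: "i \<in> A"
        have "b i powr (r / p i) = a i n powr r / t i powr r"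
          using p[OF i] tp[OF i] nn[OF i n] by (simp add: b_def powr_divide powr_powr)
        then show "a i n powr r = t i powr r * b i powr (r / p i)" using tp[OF i] by simp
      qed simp
      also have "\<dots> = (\<Prod>i\<in>A. t i) powr r * (\<Prod>i\<in>A. b i powr (r / p i))"
        using t by (simp add: prod.distrib prod_powr_distrib)
      also have "(\<Prod>i\<in>A. b i powr (r / p i)) \<le> (\<Prod>i\<in>A. b i powr (r / p i / \<sigma>))"
      proof (rule prod_mono, intro conjI)
        fix i assume i: "i \<in> A"
        show "b i powr (r / p i) \<le> b i powr (r / p i / \<sigma>)"
        proof (cases "b i = 0")
          case False
          have "r / p i / \<sigma> \<le> r / p i"
            using \<sigma> r p[OF i] by (simp add: field_simps)
          then show ?thesis using powr_mono' b[OF i] by blast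
        qed simp
      qed simp
      also have "\<dots> \<le> (\<Sum>i\<in>A. (r / p i / \<sigma>) * b i)"
      proof (rule weighted_arith_geom_mean)
        show "(\<Sum>i\<in>A. r / p i / \<sigma>) = 1"
          unfolding sum_divide_distrib[symmetric] \<sigma>_def[symmetric] using \<sigma> by simp
        show "0 \<le> r / p i / \<sigma>" if "i \<in> A" for i
          using that \<sigma> r p[OF that] by simp
      qed (use A b in auto)
      finally show ?thesis by (simp add: b_def mult_left_mono)
    qed
    have "(\<Sum>n\<in>S. (\<Prod>i\<in>A. a i n) powr r) \<le>
        (\<Sum>n\<in>S. (\<Prod>i\<in>A. t i) powr r * (\<Sum>i\<in>A. (r / p i / \<sigma>) * (a i n powr p i / t i powr p i)))"
      by (rule sum_mono) (rule main)
    also have "\<dots> = (\<Prod>i\<in>A. t i) powr r * (\<Sum>i\<in>A. (r / p i / \<sigma>) * ((\<Sum>n\<in>S. a i n powr p i) / t i powr p i))"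
      unfolding sum_distrib_left sum_divide_distrib by (rule sum.swap)
    also have "\<dots> \<le> (\<Prod>i\<in>A. t i) powr r * (\<Sum>i\<in>A. (r / p i / \<sigma>) * 1)"
    proof (intro mult_left_mono sum_mono)
      fix i assume i: "i \<in> A"
      show "(\<Sum>n\<in>S. a i n powr p i) / t i powr p i \<le> 1"
        using le[OF i] tp[OF i] by (simp add: divide_le_eq_1)
      show "0 \<le> r / p i / \<sigma>" using p[OF i] r \<sigma> by simp
    qed simp
    also have "(\<Sum>i\<in>A. (r / p i / \<sigma>) * 1) = 1"
      unfolding mult_1_right sum_divide_distrib[symmetric] \<sigma>_def[symmetric] using \<sigma> by simp
    finally show ?thesis by (simp add: r_def)
  qed
qed

lemma r_exponent_ge_1:
  assumes "finite A" "A \<noteq> {}" "\<And>i. i \<in> A \<Longrightarrow> 0 < p i"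
  shows "1 \<le> r_exponent p A"
proof -
  have "0 < (\<Sum>i\<in>A. 1 / p i)" using assms by (intro sum_pos) auto
  then show ?thesis by (simp add: r_exponent_def min_def field_simps)
qed

section \<open>Linear structure, tails and completeness of l_q\<close>

lemma lspace_add_lnorm:
  assumes q: "1 \<le> q" and x: "x \<in> lspace q" and y: "y \<in> lspace q"
  shows "(\<lambda>n. x n + y n) \<in> lspace q" "lnorm q (\<lambda>n. x n + y n) \<le> lnorm q x + lnorm q y"
proof -
  have "(\<Sum>k<n. norm (x k + y k) powr q) \<le> (lnorm q x + lnorm q y) powr q" for n
  proof -
    have "(\<Sum>k<n. norm (x k + y k) powr q) \<le> (\<Sum>k<n. (norm (x k) + norm (y k)) powr q)"
      using q by (intro sum_mono powr_mono2) (auto intro: norm_triangle_ineq)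
    also have "\<dots> \<le> (lnorm q x + lnorm q y) powr q"
      using q x y by (intro Minkowski_sum sum_le_lnorm_powr) auto
    finally show ?thesis .
  qed
  from lspace_lnorm_leI[OF _ _ this] q
  show "(\<lambda>n. x n + y n) \<in> lspace q" "lnorm q (\<lambda>n. x n + y n) \<le> lnorm q x + lnorm q y"
    by auto
qed

lemma lspace_scale: "x \<in> lspace q \<Longrightarrow> (\<lambda>n. c * x n) \<in> lspace q"
  by (simp add: lspace_def norm_mult powr_mult summable_mult)

lemma lnorm_scale:
  assumes "0 < q" "x \<in> lspace q"
  shows "lnorm q (\<lambda>n. c * x n) = norm c * lnorm q x"
proof -
  have "suminf (\<lambda>n. norm (c * x n) powr q) = norm c powr q * suminf (\<lambda>n. norm (x n) powr q)"
    using assms by (simp add: norm_mult powr_mult lspace_def suminf_mult)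
  then show ?thesis
    using assms by (simp add: lnorm_def powr_mult suminf_nonneg lspace_def powr_powr)
qed

lemma lspace_mono:
  assumes "0 < q" "x \<in> lspace q" "\<And>n. norm (y n) \<le> norm (x n)"
  shows "y \<in> lspace q" "lnorm q y \<le> lnorm q x"
proof -
  have "(\<Sum>k<n. norm (y k) powr q) \<le> lnorm q x powr q" for n
    using assms by (intro order_trans[OF sum_mono sum_le_lnorm_powr]) (auto intro: powr_mono2)
  from lspace_lnorm_leI[OF _ _ this] assms show "y \<in> lspace q" "lnorm q y \<le> lnorm q x" by auto
qed

lemma lspace_zero [simp]: "(\<lambda>n. 0) \<in> lspace q" "lnorm q (\<lambda>n. 0) = 0"
  by (auto simp: lspace_def lnorm_def)

lemma lnorm_eq_0_iff:
  assumes "0 < q" "x \<in> lspace q"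
  shows "lnorm q x = 0 \<longleftrightarrow> x = (\<lambda>n. 0)"
proof
  assume "lnorm q x = 0"
  then show "x = (\<lambda>n. 0)" using norm_le_lnorm[OF assms] by (simp add: fun_eq_iff)
qed simp

lemma lnorm_finite:
  assumes "finite {n. x n \<noteq> 0}" "0 < q"
  shows "x \<in> lspace q" "lnorm q x powr q = (\<Sum>n | x n \<noteq> 0. norm (x n) powr q)"
proof -
  have 1: "(\<lambda>n. norm (x n) powr q) sums (\<Sum>n | x n \<noteq> 0. norm (x n) powr q)"
    by (rule sums_finite) (use assms in auto)
  show "x \<in> lspace q" using 1 by (auto simp: lspace_def sums_iff)
  then show "lnorm q x powr q = (\<Sum>n | x n \<noteq> 0. norm (x n) powr q)"
    using 1 assms lnorm_powr[of q x] by (simp add: sums_iff)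
qed

lemma lnorm_tail_tendsto_0:
  assumes q: "0 < q" and x: "x \<in> lspace q"
  shows "(\<lambda>m. lnorm q (\<lambda>n. if n < m then 0 else x n)) \<longlonglongrightarrow> 0"
proof -
  have s: "summable (\<lambda>n. norm (x n) powr q)" using x by (simp add: lspace_def)
  define f where "f n = norm (x n) powr q" for n
  have sf: "summable f" using s by (simp add: f_def[abs_def])
  have "suminf (\<lambda>n. norm (if n < m then 0 else x n) powr q) = suminf f - sum f {..<m}" for m
  proof -
    have "(\<lambda>n. if n < m then f n else 0) sums sum f {..<m}"
      using sums_If_finite_set[of "{..<m}" f] by simp
    from sums_diff[OF summable_sums[OF sf] this]
    have "(\<lambda>n. f n - (if n < m then f n else 0)) sums (suminf f - sum f {..<m})" .
    moreover have "(\<lambda>n. f n - (if n < m then f n else 0)) = (\<lambda>n. norm (if n < m then 0 else x n) powr q)"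
      by (auto simp: f_def)
    ultimately show ?thesis by (simp add: sums_iff)
  qed
  then have eq: "lnorm q (\<lambda>n. if n < m then 0 else x n) = (suminf f - sum f {..<m}) powr (1 / q)" for m
    by (simp add: lnorm_def)
  have "(\<lambda>m. suminf f - sum f {..<m}) \<longlonglongrightarrow> suminf f - suminf f"
    by (intro tendsto_intros summable_LIMSEQ sf)
  then have lim: "(\<lambda>m. suminf f - sum f {..<m}) \<longlonglongrightarrow> 0" by simp
  have "(\<lambda>m. (suminf f - sum f {..<m}) powr (1 / q)) \<longlonglongrightarrow> 0 powr (1 / q)"
    using q sum_le_suminf[OF sf]
    by (intro tendsto_powr2 lim tendsto_const always_eventually allI) (auto simp: f_def)
  then show ?thesis by (simp add: eq)
qed

lemma lspace_complete:
  fixes x :: "nat \<Rightarrow> nat \<Rightarrow> 'k::{real_normed_field, complete_space}"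
  assumes q: "1 \<le> q" and x: "\<And>n. x n \<in> lspace q"
    and cauchy: "\<And>e. 0 < e \<Longrightarrow> \<exists>M. \<forall>m\<ge>M. \<forall>n\<ge>M. lnorm q (\<lambda>k. x m k - x n k) < e"
  shows "\<exists>y\<in>lspace q. (\<lambda>n. lnorm q (\<lambda>k. x n k - y k)) \<longlonglongrightarrow> 0"
proof -
  have neg: "(\<lambda>k. - 1 * y k) \<in> lspace q" if "y \<in> lspace q" for y :: "nat \<Rightarrow> 'k"
    by (rule lspace_scale[OF that])
  have diff: "(\<lambda>k. y k - z k) \<in> lspace q" if "y \<in> lspace q" "z \<in> lspace q" for y z :: "nat \<Rightarrow> 'k"
    using lspace_add_lnorm(1)[OF q that(1) neg[OF that(2)]] by simp
  have "Cauchy (\<lambda>n. x n k)" for k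
  proof (rule CauchyI)
    fix e :: real assume "0 < e"
    from cauchy[OF this] obtain M where M: "\<forall>m\<ge>M. \<forall>n\<ge>M. lnorm q (\<lambda>k. x m k - x n k) < e" by blast
    have "norm (x m k - x n k) < e" if "m \<ge> M" "n \<ge> M" for m n
      using norm_le_lnorm[of q "\<lambda>k. x m k - x n k" k] diff[OF x x] M that q
      by (meson le_less_trans less_le_trans zero_less_one)
    then show "\<exists>M. \<forall>m\<ge>M. \<forall>n\<ge>M. norm (x m k - x n k) < e" by blast
  qed
  then have "\<exists>y. (\<lambda>n. x n k) \<longlonglongrightarrow> y" for k by (simp add: Cauchy_convergent convergentD)
  then obtain y where y: "\<And>k. (\<lambda>n. x n k) \<longlonglongrightarrow> y k" by metis
  have close: "(\<lambda>k. x m k - y k) \<in> lspace q \<and> lnorm q (\<lambda>k. x m k - y k) \<le> e"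
    if "0 < e" and M: "\<forall>m\<ge>M. \<forall>n\<ge>M. lnorm q (\<lambda>k. x m k - x n k) < e" and m: "m \<ge> M" for e M m
  proof -
    \<comment> \<open>The Cauchy estimate is passed to the coordinatewise limit on finite partial
      sums only; this yields membership and the norm bound together.\<close>
    have "(\<Sum>k<j. norm (x m k - y k) powr q) \<le> e powr q" for j
    proof (rule LIMSEQ_le_const2)
      show "(\<lambda>n. \<Sum>k<j. norm (x m k - x n k) powr q) \<longlonglongrightarrow> (\<Sum>k<j. norm (x m k - y k) powr q)"
        using q by (intro tendsto_sum tendsto_powr2 tendsto_intros y) auto
      have "(\<Sum>k<j. norm (x m k - x n k) powr q) \<le> e powr q" if "n \<ge> M" for n
      proof -
        have "(\<Sum>k<j. norm (x m k - x n k) powr q) \<le> lnorm q (\<lambda>k. x m k - x n k) powr q"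
          using q by (intro sum_le_lnorm_powr diff x) auto
        also have "\<dots> \<le> e powr q"
          using M m that q by (intro powr_mono2) (auto intro: less_imp_le)
        finally show ?thesis .
      qed
      then show "\<exists>N. \<forall>n\<ge>N. (\<Sum>k<j. norm (x m k - x n k) powr q) \<le> e powr q" by blast
    qed
    from lspace_lnorm_leI[OF _ _ this] q that show ?thesis by auto
  qed
  obtain M where "\<forall>m\<ge>M. \<forall>n\<ge>M. lnorm q (\<lambda>k. x m k - x n k) < 1" using cauchy[of 1] by auto
  from close[OF _ this order_refl] have "(\<lambda>k. x M k - y k) \<in> lspace q" by simp
  from diff[OF x[of M] this] have yl: "y \<in> lspace q" by simp
  moreover have "(\<lambda>n. lnorm q (\<lambda>k. x n k - y k)) \<longlonglongrightarrow> 0"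
  proof (rule LIMSEQ_I)
    fix e :: real assume e: "0 < e"
    then obtain M where M: "\<forall>m\<ge>M. \<forall>n\<ge>M. lnorm q (\<lambda>k. x m k - x n k) < e / 2"
      using cauchy[of "e / 2"] by auto
    have "norm (lnorm q (\<lambda>k. x n k - y k) - 0) < e" if "n \<ge> M" for n
      using close[OF _ M that] e by auto
    then show "\<exists>no. \<forall>n\<ge>no. norm (lnorm q (\<lambda>k. x n k - y k) - 0) < e" by blast
  qed
  ultimately show ?thesis by blast
qed

section \<open>Tensors as functions of multi-indices\<close>

text \<open>Multi-indices are total functions of which only the coordinates in A are read, so that
  products over different index sets share one function type and slicing needs no change of
  type.\<close>

definition tens :: "'i set \<Rightarrow> ('i \<Rightarrow> nat \<Rightarrow> 'k) \<Rightarrow> ('i \<Rightarrow> nat) \<Rightarrow> 'k::real_normed_field" where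
  "tens A x k = (\<Prod>i\<in>A. x i (k i))"

text \<open>\<open>trep\<close> keeps track of the cost of a representation by elementary tensors, so that estimates of the
  projective norm become rule inductions; the scalar \<open>c\<close> makes the case \<open>A = {}\<close> meaningful.\<close>

inductive trep ::
    "('i \<Rightarrow> real) \<Rightarrow> 'i set \<Rightarrow> (('i \<Rightarrow> nat) \<Rightarrow> 'k::real_normed_field) \<Rightarrow> real \<Rightarrow> bool"
  for p A where
  zero: "0 \<le> s \<Longrightarrow> trep p A (\<lambda>k. 0) s"
| step: "trep p A u s \<Longrightarrow> (\<And>i. i \<in> A \<Longrightarrow> x i \<in> lspace (p i)) \<Longrightarrow>
         s + norm c * (\<Prod>i\<in>A. lnorm (p i) (x i)) \<le> s' \<Longrightarrow>
         trep p A (\<lambda>k. u k + c * tens A x k) s'"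

definition ptn :: "('i \<Rightarrow> real) \<Rightarrow> 'i set \<Rightarrow> (('i \<Rightarrow> nat) \<Rightarrow> 'k::real_normed_field) \<Rightarrow> real" where
  "ptn p A u = Inf {s. trep p A u s}"

definition tset :: "('i \<Rightarrow> real) \<Rightarrow> 'i set \<Rightarrow> (('i \<Rightarrow> nat) \<Rightarrow> 'k::real_normed_field) set" where
  "tset p A = {u. \<exists>s. trep p A u s}"

section \<open>Calculus of costs and the projective norm of functions\<close>

lemma trep_mono:
  assumes "trep p A u s" "s \<le> s'"
  shows "trep p A u s'"
  using assms(1)
proof cases
  case zero
  then show ?thesis using assms(2) by (simp add: trep.zero)
next
  case (step u t x c)
  then show ?thesis using assms(2) trep.step[of p A u t x c s'] by simp
qed

lemma trep_nonneg: "trep p A u s \<Longrightarrow> 0 \<le> s"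
proof (induction rule: trep.induct)
  case (step u s x c s')
  have "0 \<le> norm c * (\<Prod>i\<in>A. lnorm (p i) (x i))" by (intro mult_nonneg_nonneg prod_nonneg) auto
  then show ?case using step by linarith
qed

lemma trep_add:
  assumes "trep p A u s" "trep p A v t"
  shows "trep p A (\<lambda>k. u k + v k) (s + t)"
  using assms(2)
proof (induction rule: trep.induct)
  case (zero t)
  then show ?case using assms(1) by (auto intro: trep_mono)
next
  case (step v t x c t')
  have "trep p A (\<lambda>k. (u k + v k) + c * tens A x k) (s + t')"
    using step by (intro trep.step[where s = "s + t"]) auto
  then show ?case by (simp add: add.assoc)
qed

lemma trep_tens:
  assumes "\<And>i. i \<in> A \<Longrightarrow> x i \<in> lspace (p i)" "norm c * (\<Prod>i\<in>A. lnorm (p i) (x i)) \<le> s"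
  shows "trep p A (\<lambda>k. c * tens A x k) s"
  using trep.step[OF trep.zero[of 0], of A x p c s] assms by simp

text \<open>A linear operation is contractive once it does not raise the cost of elementary tensors.
  Additivity suffices, as the scalar of each term stays inside the elementary tensor.\<close>

lemma trep_map:
  assumes "trep p A u s"
    and "L (\<lambda>k. 0) = (\<lambda>k. 0)" "\<And>u v. L (\<lambda>k. u k + v k) = (\<lambda>k. L u k + L v k)"
    and "\<And>c x. (\<And>i. i \<in> A \<Longrightarrow> x i \<in> lspace (p i)) \<Longrightarrow>
           trep p B (L (\<lambda>k. c * tens A x k)) (norm c * (\<Prod>i\<in>A. lnorm (p i) (x i)))"
  shows "trep p B (L u) s"
  using assms(1)
proof (induction rule: trep.induct)
  case (zero s)
  then show ?case using assms(2) by (simp add: trep.zero)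
next
  case (step u s x c s')
  then have "trep p B (\<lambda>k. L u k + L (\<lambda>k. c * tens A x k) k) s'"
    by (intro trep_mono[OF trep_add[OF _ assms(4)]]) auto
  then show ?case using assms(3) by simp
qed

lemma trep_scale:
  assumes "trep p A u s"
  shows "trep p A (\<lambda>k. c * u k) (norm c * s)"
  using assms
proof (induction rule: trep.induct)
  case (zero s)
  then show ?case by (auto intro: trep.zero)
next
  case (step u s x d s')
  have "trep p A (\<lambda>k. c * u k + (c * d) * tens A x k) (norm c * s')"
    using step mult_left_mono[OF step.hyps(3), of "norm c"]
    by (intro trep.step[where s = "norm c * s"]) (auto simp: norm_mult algebra_simps)
  then show ?case by (simp add: algebra_simps)
qed

lemma trep_sum:
  assumes "finite S" "\<And>n. n \<in> S \<Longrightarrow> trep p A (u n) (s n)"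
  shows "trep p A (\<lambda>k. \<Sum>n\<in>S. u n k) (\<Sum>n\<in>S. s n)"
  using assms by (induction S rule: finite_induct) (auto intro: trep.zero trep_add)

lemma ptn_le: "trep p A u s \<Longrightarrow> ptn p A u \<le> s"
  unfolding ptn_def by (intro cInf_lower bdd_belowI[where m = 0]) (auto intro: trep_nonneg)

text \<open>The infimum need not be attained, which is why strict upper bounds appear in later
  hypotheses.\<close>

lemma trep_ptn_less: "u \<in> tset p A \<Longrightarrow> ptn p A u < s \<Longrightarrow> trep p A u s"
proof -
  assume "u \<in> tset p A" "ptn p A u < s"
  then obtain t where "trep p A u t" "t < s"
    unfolding ptn_def tset_def using cInf_lessD[of "{s. trep p A u s}" s] by auto
  then show ?thesis using trep_mono less_imp_le by blast
qed

lemma ptn_nonneg: "u \<in> tset p A \<Longrightarrow> 0 \<le> ptn p A u"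
  unfolding ptn_def tset_def by (intro cInf_greatest) (auto intro: trep_nonneg)

lemma ptn_leI:
  assumes "u \<in> tset p A" "\<And>s. trep p A u s \<Longrightarrow> t \<le> s"
  shows "t \<le> ptn p A u"
  using assms unfolding ptn_def tset_def by (intro cInf_greatest) auto

lemma ptn_mapI:
  assumes "u \<in> tset p A" "\<And>s. trep p A u s \<Longrightarrow> trep p B v s"
  shows "v \<in> tset p B" "ptn p B v \<le> ptn p A u"
  using assms by (auto simp: tset_def intro: ptn_leI[OF assms(1)] ptn_le)

lemma tset_add: "u \<in> tset p A \<Longrightarrow> v \<in> tset p A \<Longrightarrow> (\<lambda>k. u k + v k) \<in> tset p A"
  unfolding tset_def using trep_add by blast

lemma tset_scale: "u \<in> tset p A \<Longrightarrow> (\<lambda>k. c * u k) \<in> tset p A"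
  unfolding tset_def using trep_scale by blast

lemma tset_zero: "(\<lambda>k. 0) \<in> tset p A"
  unfolding tset_def using trep.zero by blast

lemma tset_tens:
  assumes "\<And>i. i \<in> A \<Longrightarrow> x i \<in> lspace (p i)"
  shows "(\<lambda>k. c * tens A x k) \<in> tset p A"
  using trep_tens[of A x p c, OF assms order_refl] by (auto simp: tset_def)

lemma tset_diff: "u \<in> tset p A \<Longrightarrow> v \<in> tset p A \<Longrightarrow> (\<lambda>k. u k - v k) \<in> tset p A"
  using tset_add[OF _ tset_scale[of v p A "-1"]] by simp

lemma tset_sum:
  assumes "\<And>n. n \<in> S \<Longrightarrow> u n \<in> tset p A"
  shows "(\<lambda>k. \<Sum>n\<in>S. u n k) \<in> tset p A"
  using assms by (induction S rule: infinite_finite_induct) (auto intro: tset_zero tset_add)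

lemma ptn_zero [simp]: "ptn p A (\<lambda>k. 0) = 0"
  by (intro antisym ptn_le trep.zero ptn_nonneg tset_zero) auto

lemma ptn_triangle:
  assumes "u \<in> tset p A" "v \<in> tset p A"
  shows "ptn p A (\<lambda>k. u k + v k) \<le> ptn p A u + ptn p A v"
proof (rule field_le_epsilon)
  fix e :: real assume "0 < e"
  then have "trep p A u (ptn p A u + e / 2)" "trep p A v (ptn p A v + e / 2)"
    using assms by (auto intro: trep_ptn_less)
  from ptn_le[OF trep_add[OF this]]
  show "ptn p A (\<lambda>k. u k + v k) \<le> ptn p A u + ptn p A v + e" by (simp add: algebra_simps)
qed

lemma ptn_sum:
  assumes "finite S" "\<And>n. n \<in> S \<Longrightarrow> u n \<in> tset p A"
  shows "ptn p A (\<lambda>k. \<Sum>n\<in>S. u n k) \<le> (\<Sum>n\<in>S. ptn p A (u n))"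
  using assms
proof (induction S rule: finite_induct)
  case (insert m S)
  then show ?case
    using ptn_triangle[OF _ tset_sum, of "u m" p A S u] by fastforce
qed simp

lemma ptn_scale:
  assumes u: "u \<in> tset p A"
  shows "ptn p A (\<lambda>k. c * u k) = norm c * ptn p A u"
proof -
  have le: "ptn p A (\<lambda>k. c * u k) \<le> norm c * ptn p A u" if u: "u \<in> tset p A" for u c
  proof (rule field_le_epsilon)
    fix e :: real assume e: "0 < e"
    define d where "d = e / (norm c + 1)"
    have d: "0 < d" "norm c * d \<le> e"
      using e by (auto simp: d_def field_simps add_pos_nonneg)
    have "trep p A u (ptn p A u + d)" using u d by (auto intro: trep_ptn_less)
    from ptn_le[OF trep_scale[OF this, of c]] d(2)
    show "ptn p A (\<lambda>k. c * u k) \<le> norm c * ptn p A u + e"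
      by (simp add: distrib_left)
  qed
  show ?thesis
  proof (cases "c = 0")
    case False
    have "ptn p A u \<le> norm (inverse c) * ptn p A (\<lambda>k. c * u k)"
      using le[OF tset_scale[OF u, of c], of "inverse c"] False by (simp add: mult.assoc[symmetric])
    then have "norm c * ptn p A u \<le> ptn p A (\<lambda>k. c * u k)"
      using False by (simp add: norm_divide inverse_eq_divide field_simps)
    then show ?thesis using le[OF u, of c] by simp
  qed simp
qed

lemma ptn_diff_le:
  assumes "u \<in> tset p A" "v \<in> tset p A"
  shows "ptn p A u \<le> ptn p A v + ptn p A (\<lambda>k. u k - v k)"
  using ptn_triangle[OF assms(2) tset_diff[OF assms]] by simp

lemma ptn_minus_commute:
  assumes "u \<in> tset p A" "v \<in> tset p A"
  shows "ptn p A (\<lambda>k. u k - v k) = ptn p A (\<lambda>k. v k - u k)"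
  using ptn_scale[OF tset_diff[OF assms], of "-1"] by simp

subsection \<open>Contractive multipliers\<close>

text \<open>Contractivity is required for every cost rather than for the infimum, so that products
  and averages of multipliers can be formed without \<epsilon>-estimates.\<close>

definition cmult :: "('i \<Rightarrow> real) \<Rightarrow> 'i set \<Rightarrow> (('i \<Rightarrow> nat) \<Rightarrow> 'k::real_normed_field) \<Rightarrow> bool" where
  "cmult p A m \<longleftrightarrow> (\<forall>u s. trep p A u s \<longrightarrow> trep p A (\<lambda>k. m k * u k) s)"

lemma cmultD: "cmult p A m \<Longrightarrow> trep p A u s \<Longrightarrow> trep p A (\<lambda>k. m k * u k) s"
  by (simp add: cmult_def)

lemma cmult_tset: "cmult p A m \<Longrightarrow> u \<in> tset p A \<Longrightarrow> (\<lambda>k. m k * u k) \<in> tset p A"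
  and cmult_ptn: "cmult p A m \<Longrightarrow> u \<in> tset p A \<Longrightarrow> ptn p A (\<lambda>k. m k * u k) \<le> ptn p A u"
  by (auto intro: ptn_mapI cmultD)

lemma cmult_1: "cmult p A (\<lambda>k. 1)"
  by (simp add: cmult_def)

lemma cmult_mult: "cmult p A m \<Longrightarrow> cmult p A m' \<Longrightarrow> cmult p A (\<lambda>k. m k * m' k)"
  by (simp add: cmult_def mult.assoc)

lemma cmult_prod:
  assumes "finite S" "\<And>n. n \<in> S \<Longrightarrow> cmult p A (m n)"
  shows "cmult p A (\<lambda>k. \<Prod>n\<in>S. m n k)"
  using assms by (induction S rule: finite_induct) (auto intro: cmult_mult cmult_1)

lemma cmult_average:
  fixes m :: "('i \<Rightarrow> nat) \<Rightarrow> 'k::real_normed_field"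
  assumes "cmult p A m" "cmult p A m'"
  shows "cmult p A (\<lambda>k. (m k + m' k) / 2)"
  unfolding cmult_def
proof (intro allI impI)
  fix u :: "('i \<Rightarrow> nat) \<Rightarrow> 'k" and s assume "trep p A u s"
  then have "trep p A (\<lambda>k. (1 / 2) * (m k * u k + m' k * u k)) (norm (1 / 2 :: 'k) * (s + s))"
    using assms by (intro trep_scale trep_add cmultD)
  then show "trep p A (\<lambda>k. (m k + m' k) / 2 * u k) s"
    by (simp add: norm_divide field_simps)
qed

lemma prod_of_bool:
  "finite S \<Longrightarrow> (\<Prod>n\<in>S. of_bool (P n)) = (of_bool (\<forall>n\<in>S. P n) :: 'k::idom)"
  by (induction S rule: finite_induct) auto

locale tensor_factors =
  fixes p :: "'i \<Rightarrow> real" and A :: "'i set"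
  assumes finite_A: "finite A" and p_ge_1: "\<And>i. i \<in> A \<Longrightarrow> 1 \<le> p i"
begin

lemma p_pos: "i \<in> A \<Longrightarrow> 0 < p i"
  using p_ge_1 by force

lemma norm_tens_le:
  assumes "\<And>i. i \<in> A \<Longrightarrow> x i \<in> lspace (p i)"
  shows "norm (tens A x k) \<le> (\<Prod>i\<in>A. lnorm (p i) (x i))"
  unfolding tens_def prod_norm[symmetric]
  using assms p_pos by (intro prod_mono conjI norm_le_lnorm) auto

lemma norm_le_trep: "trep p A u s \<Longrightarrow> norm (u k) \<le> s"
proof (induction rule: trep.induct)
  case (step u s x c s')
  have "norm (u k + c * tens A x k) \<le> norm (u k) + norm c * norm (tens A x k)"
    by (metis norm_mult norm_triangle_ineq)
  also have "\<dots> \<le> s + norm c * (\<Prod>i\<in>A. lnorm (p i) (x i))"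
    using step norm_tens_le[of x k] by (intro add_mono mult_left_mono) auto
  finally show ?case using step by linarith
qed simp

text \<open>The values of g are absorbed into the i-th factor of each elementary tensor and cannot
  increase its norm.\<close>

lemma cmult_coord:
  fixes g :: "nat \<Rightarrow> 'k::real_normed_field"
  assumes i: "i \<in> A" and g: "\<And>n. norm (g n) \<le> 1"
  shows "cmult p A (\<lambda>k. g (k i))"
  unfolding cmult_def
proof (intro allI impI)
  fix u :: "('i \<Rightarrow> nat) \<Rightarrow> 'k" and s assume "trep p A u s"
  then show "trep p A (\<lambda>k. g (k i) * u k) s"
  proof (rule trep_map)
    fix c and x :: "'i \<Rightarrow> nat \<Rightarrow> 'k" assume x: "\<And>i. i \<in> A \<Longrightarrow> x i \<in> lspace (p i)"
    define y where "y = x(i := (\<lambda>n. g n * x i n))"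
    have y: "y j \<in> lspace (p j) \<and> lnorm (p j) (y j) \<le> lnorm (p j) (x j)" if "j \<in> A" for j
      using lspace_mono[OF p_pos[OF i] x[OF i], of "\<lambda>n. g n * x i n"] x[OF that]
        mult_left_le_one_le[OF norm_ge_zero norm_ge_zero g]
      by (auto simp: y_def norm_mult)
    have "tens A y k = g (k i) * tens A x k" for k
      using finite_A i by (simp add: tens_def y_def prod.remove)
    then have "(\<lambda>k. g (k i) * (c * tens A x k)) = (\<lambda>k. c * tens A y k)"
      by (simp add: fun_eq_iff)
    moreover have "trep p A (\<lambda>k. c * tens A y k) (norm c * (\<Prod>i\<in>A. lnorm (p i) (x i)))"
      using y by (intro trep_tens mult_left_mono prod_mono) auto
    ultimately show "trep p A (\<lambda>k. g (k i) * (c * tens A x k)) (norm c * (\<Prod>i\<in>A. lnorm (p i) (x i)))"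
      by simp
  qed (auto simp: algebra_simps)
qed

lemma cmult_box:
  assumes "B \<subseteq> A"
  shows "cmult p A (\<lambda>k. of_bool (\<forall>i\<in>B. k i \<in> G i))"
proof -
  have B: "finite B" using assms finite_A finite_subset by blast
  have "cmult p A (\<lambda>k. \<Prod>i\<in>B. of_bool (k i \<in> G i))"
    using B assms by (intro cmult_prod cmult_coord) auto
  then show ?thesis using B by (simp add: prod_of_bool)
qed

text \<open>The diagonal multiplier is an average of products of two sign changes.\<close>

lemma cmult_iff:
  assumes "i \<in> A" "j \<in> A"
  shows "cmult p A (\<lambda>k. of_bool (k i \<in> J \<longleftrightarrow> k j \<in> J) :: 'k::real_normed_field)"
proof -
  define \<rho> :: "nat \<Rightarrow> 'k" where "\<rho> n = (if n \<in> J then -1 else 1)" for n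
  have "cmult p A (\<lambda>k. (1 + \<rho> (k i) * \<rho> (k j)) / 2)"
    using assms by (intro cmult_average cmult_1 cmult_mult cmult_coord) (auto simp: \<rho>_def)
  moreover have "(\<lambda>k. (1 + \<rho> (k i) * \<rho> (k j)) / 2) = (\<lambda>k. of_bool (k i \<in> J \<longleftrightarrow> k j \<in> J))"
    by (auto simp: \<rho>_def)
  ultimately show ?thesis by simp
qed

text \<open>For disjoint \<open>J n\<close> the surviving multi-indices have all coordinates in one
  common block or all outside every block. This removes the cross terms of an elementary tensor
  without increasing its norm.\<close>

lemma cmult_diagonal:
  assumes "finite S" "j \<in> A"
  shows "cmult p A (\<lambda>k. of_bool (\<forall>n\<in>S. \<forall>i\<in>A. k i \<in> J n \<longleftrightarrow> k j \<in> J n))"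
proof -
  have "cmult p A (\<lambda>k. \<Prod>n\<in>S. \<Prod>i\<in>A. of_bool (k i \<in> J n \<longleftrightarrow> k j \<in> J n))"
    using assms finite_A by (intro cmult_prod cmult_iff)
  then show ?thesis using assms finite_A by (simp add: prod_of_bool)
qed

end

context tensor_factors
begin

subsection \<open>Slices\<close>

text \<open>Coordinate evaluation on a sequence space has norm at most 1; the evaluated factors turn
  into a scalar.\<close>

lemma trep_slice:
  assumes D: "D \<subseteq> A" and u: "trep p A u s"
  shows "trep p (A - D) (\<lambda>k. u (override_on k f D)) s"
  using u
proof (rule trep_map)
  fix c and x :: "'i \<Rightarrow> nat \<Rightarrow> 'k::real_normed_field" assume x: "\<And>i. i \<in> A \<Longrightarrow> x i \<in> lspace (p i)"
  have split: "prod g A = prod g D * prod g (A - D)" for g :: "'i \<Rightarrow> 'm::comm_monoid_mult"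
    using D finite_A by (metis mult.commute prod.subset_diff)
  have eq: "tens A x (override_on k f D) = (\<Prod>i\<in>D. x i (f i)) * tens (A - D) x k" for k
    unfolding tens_def split by (intro arg_cong2[where f = "(*)"] prod.cong) auto
  have "norm (\<Prod>i\<in>D. x i (f i)) \<le> (\<Prod>i\<in>D. lnorm (p i) (x i))"
    unfolding prod_norm[symmetric] using D x p_pos
    by (intro prod_mono conjI norm_le_lnorm) auto
  then have "norm (c * (\<Prod>i\<in>D. x i (f i))) * (\<Prod>i\<in>A - D. lnorm (p i) (x i)) \<le>
      norm c * (\<Prod>i\<in>A. lnorm (p i) (x i))"
    unfolding split[of "\<lambda>i. lnorm (p i) (x i)"] norm_mult mult.assoc
    by (intro mult_left_mono mult_right_mono prod_nonneg) auto
  then have "trep p (A - D) (\<lambda>k. (c * (\<Prod>i\<in>D. x i (f i))) * tens (A - D) x k)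
      (norm c * (\<Prod>i\<in>A. lnorm (p i) (x i)))"
    using x by (intro trep_tens) auto
  then show "trep p (A - D) (\<lambda>k. c * tens A x (override_on k f D))
      (norm c * (\<Prod>i\<in>A. lnorm (p i) (x i)))"
    by (simp add: eq mult.assoc)
qed auto

text \<open>This is tensoring with the unit vectors at the positions \<open>f i\<close>, which have
  norm 1. Together with \<open>trep_slice\<close> it identifies the product over
  \<open>A - D\<close> isometrically with a slice of the product over A.\<close>

lemma trep_extend:
  assumes D: "D \<subseteq> A" and u: "trep p (A - D) u s"
  shows "trep p A (\<lambda>k. of_bool (\<forall>i\<in>D. k i = f i) * u k) s"
  using u
proof (rule trep_map)
  fix c and x :: "'i \<Rightarrow> nat \<Rightarrow> 'k::real_normed_field" assume x: "\<And>i. i \<in> A - D \<Longrightarrow> x i \<in> lspace (p i)"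
  have finD: "finite D" using D finite_A finite_subset by blast
  have split: "prod g A = prod g D * prod g (A - D)" for g :: "'i \<Rightarrow> 'm::comm_monoid_mult"
    using D finite_A by (metis mult.commute prod.subset_diff)
  define e :: "nat \<Rightarrow> nat \<Rightarrow> 'k" where "e m = (\<lambda>n. of_bool (n = m))" for m
  have supp: "{n. e m n \<noteq> 0} = {m}" for m by (auto simp: e_def)
  have e: "e m \<in> lspace q" "lnorm q (e m) = 1" if "0 < q" for m q
  proof -
    show "e m \<in> lspace q" by (rule lnorm_finite) (use supp that in auto)
    have "lnorm q (e m) powr q = 1" using lnorm_finite(2)[of "e m" q] supp that by (simp add: e_def)
    then show "lnorm q (e m) = 1" using that powr_powr[of "lnorm q (e m)" q "1 / q"] by simp
  qed
  define y where "y = (\<lambda>i. if i \<in> D then e (f i) else x i)"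
  have "(\<Prod>i\<in>A. lnorm (p i) (y i)) = (\<Prod>i\<in>A - D. lnorm (p i) (x i))"
    unfolding split using D by (simp add: y_def e p_pos subset_iff)
  moreover have "tens A y k = of_bool (\<forall>i\<in>D. k i = f i) * tens (A - D) x k" for k
    unfolding tens_def split using finD by (simp add: y_def e_def prod_of_bool)
  moreover have "y i \<in> lspace (p i)" if "i \<in> A" for i
    using that x e p_pos by (simp add: y_def)
  ultimately show "trep p A (\<lambda>k. of_bool (\<forall>i\<in>D. k i = f i) * (c * tens (A - D) x k))
      (norm c * (\<Prod>i\<in>A - D. lnorm (p i) (x i)))"
    using trep_tens[of A y p c "norm c * (\<Prod>i\<in>A - D. lnorm (p i) (x i))"]
    by (simp add: mult.left_commute)
qed (auto simp: algebra_simps)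

lemma ptn_slice:
  assumes "i \<in> A" "u \<in> tset p A"
  shows "(\<lambda>k. u (k(i := n))) \<in> tset p (A - {i})"
    and "ptn p (A - {i}) (\<lambda>k. u (k(i := n))) \<le> ptn p A u"
proof -
  have eq: "override_on k (\<lambda>_. n) {i} = k(i := n)" for k :: "'i \<Rightarrow> nat"
    by (auto simp: override_on_def)
  have "trep p (A - {i}) (\<lambda>k. u (k(i := n))) s" if "trep p A u s" for s
    using trep_slice[of "{i}", OF _ that, of "\<lambda>_. n"] assms by (simp add: eq)
  from ptn_mapI[OF assms(2) this]
  show "(\<lambda>k. u (k(i := n))) \<in> tset p (A - {i})"
    "ptn p (A - {i}) (\<lambda>k. u (k(i := n))) \<le> ptn p A u" by auto
qed

lemma ptn_coord_le_slice:
  assumes i: "i \<in> A" and u: "u \<in> tset p A"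
  shows "ptn p A (\<lambda>k. of_bool (k i = n) * u k) \<le> ptn p (A - {i}) (\<lambda>k. u (k(i := n)))"
proof -
  have eq: "(\<lambda>k. of_bool (k i = n) * u k) = (\<lambda>k. of_bool (\<forall>j\<in>{i}. k j = n) * u (k(i := n)))"
    by (auto simp: fun_eq_iff fun_upd_idem)
  show ?thesis
    unfolding eq using i
    by (intro ptn_mapI(2)[OF ptn_slice(1)[OF i u]] trep_extend) auto
qed

lemma ptn_outside_box_le:
  fixes u :: "('i \<Rightarrow> nat) \<Rightarrow> 'k::real_normed_field"
  assumes u: "u \<in> tset p A" and B: "B \<subseteq> A"
  shows "(\<lambda>k. of_bool (\<not> (\<forall>i\<in>B. k i \<in> G i)) * u k) \<in> tset p A \<and>
         ptn p A (\<lambda>k. of_bool (\<not> (\<forall>i\<in>B. k i \<in> G i)) * u k) \<le> (\<Sum>i\<in>B. ptn p A (\<lambda>k. of_bool (k i \<notin> G i) * u k))"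
proof -
  have "finite B" using B finite_A finite_subset by blast
  then show ?thesis using B
  proof (induction B rule: finite_induct)
    case empty
    then show ?case by (simp add: tset_zero)
  next
    case (insert i B)
    let ?out = "\<lambda>B k. of_bool (\<not> (\<forall>i\<in>B. k i \<in> G i)) * u k"
    let ?v = "\<lambda>k. of_bool (k i \<notin> G i) * u k"
    \<comment> \<open>Restricting the new part to the box over the remaining coordinates makes the
      decomposition disjoint, and this restriction is contractive.\<close>
    let ?w = "\<lambda>k. of_bool (\<forall>i\<in>B. k i \<in> G i) * ?v k"
    have v: "?v \<in> tset p A" using cmult_tset[OF cmult_coord[of i "\<lambda>n. of_bool (n \<notin> G i)"] u] insert by simp
    have w: "?w \<in> tset p A" "ptn p A ?w \<le> ptn p A ?v"
      using cmult_tset[OF cmult_box v, of B G] cmult_ptn[OF cmult_box v, of B G] insert by auto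
    have eq: "?out (insert i B) = (\<lambda>k. ?w k + ?out B k)" by (auto simp: fun_eq_iff)
    have IH: "?out B \<in> tset p A" "ptn p A (?out B) \<le> (\<Sum>i\<in>B. ptn p A (\<lambda>k. of_bool (k i \<notin> G i) * u k))"
      using insert by auto
    have "ptn p A (?out (insert i B)) \<le> ptn p A ?w + ptn p A (?out B)"
      unfolding eq by (rule ptn_triangle[OF w(1) IH(1)])
    moreover have "?out (insert i B) \<in> tset p A"
      unfolding eq by (rule tset_add[OF w(1) IH(1)])
    ultimately show ?case using insert w(2) IH(2) by (simp del: insert_iff)
  qed
qed

text \<open>An elementary tensor cut off outside a cube is bounded by a sum over coordinates, in
  each summand of which one factor is replaced by its vanishing tail; representations are finite
  sums of such tensors.\<close>

lemma ptn_tail_tendsto_0: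
  fixes u :: "('i \<Rightarrow> nat) \<Rightarrow> 'k::real_normed_field"
  assumes "u \<in> tset p A"
  shows "(\<lambda>m. ptn p A (\<lambda>k. of_bool (\<not> (\<forall>i\<in>A. k i < m)) * u k)) \<longlonglongrightarrow> 0"
proof -
  obtain s where "trep p A u s" using assms by (auto simp: tset_def)
  then show ?thesis
  proof (induction rule: trep.induct)
    case (step u s x c s')
    let ?out = "\<lambda>m u k. of_bool (\<not> (\<forall>i\<in>A. k i < m)) * (u k :: 'k)"
    let ?t = "\<lambda>i m. lnorm (p i) (\<lambda>n. if n < m then 0 else x i n)"
    define w where "w = (\<lambda>k. c * tens A x k)"
    have u: "u \<in> tset p A" using step by (auto simp: tset_def)
    have w: "w \<in> tset p A" unfolding w_def using tset_tens[of A x p c] step(2) by simp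
    have out: "?out m v \<in> tset p A" "ptn p A (?out m v) \<le> (\<Sum>i\<in>A. ptn p A (\<lambda>k. of_bool (\<not> k i < m) * v k))"
      if "v \<in> tset p A" for m v
      using ptn_outside_box_le[OF that subset_refl, of "\<lambda>_. {..<m}"] by auto
    have tail: "ptn p A (\<lambda>k. of_bool (\<not> k i < m) * w k) \<le> norm c * (?t i m * (\<Prod>j\<in>A - {i}. lnorm (p j) (x j)))"
      if i: "i \<in> A" for i m
    proof -
      define y where "y = x(i := (\<lambda>n. if n < m then 0 else x i n))"
      have "y j \<in> lspace (p j)" if "j \<in> A" for j
        using lspace_mono(1)[OF p_pos[OF i] step(2)[OF i], of "\<lambda>n. if n < m then 0 else x i n"] step(2)[OF that]
        by (auto simp: y_def)
      moreover have "(\<Prod>j\<in>A. lnorm (p j) (y j)) = ?t i m * (\<Prod>j\<in>A - {i}. lnorm (p j) (x j))"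
        using finite_A i by (simp add: y_def prod.remove)
      moreover have "of_bool (\<not> k i < m) * w k = c * tens A y k" for k
        using finite_A i by (simp add: y_def prod.remove tens_def w_def)
      ultimately show ?thesis by (auto intro!: ptn_le trep_tens)
    qed
    have lim: "(\<lambda>m. ptn p A (?out m u) + (\<Sum>i\<in>A. norm c * (?t i m * (\<Prod>j\<in>A - {i}. lnorm (p j) (x j))))) \<longlonglongrightarrow>
       0 + (\<Sum>i\<in>A. norm c * (0 * (\<Prod>j\<in>A - {i}. lnorm (p j) (x j))))"
      using p_pos by (intro tendsto_intros step.IH lnorm_tail_tendsto_0 step.hyps(2))
    have eq: "?out m (\<lambda>k. u k + c * tens A x k) = (\<lambda>k. ?out m u k + ?out m w k)" for m
      by (simp add: w_def algebra_simps)
    have *: "ptn p A (?out m (\<lambda>k. u k + c * tens A x k)) \<le>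
        ptn p A (?out m u) + (\<Sum>i\<in>A. norm c * (?t i m * (\<Prod>j\<in>A - {i}. lnorm (p j) (x j))))" for m
      unfolding eq
      by (intro order_trans[OF ptn_triangle[OF out(1)[OF u] out(1)[OF w]]] add_left_mono
          order_trans[OF out(2)[OF w]] sum_mono tail)
    have "(\<lambda>k. u k + c * tens A x k) \<in> tset p A" using tset_add[OF u w] by (simp add: w_def)
    then have nn: "0 \<le> ptn p A (?out m (\<lambda>k. u k + c * tens A x k))" for m
      by (intro ptn_nonneg out(1))
    show ?case
      by (rule tendsto_sandwich[OF always_eventually[OF allI[OF nn]] always_eventually[OF allI[OF *]]
            tendsto_const lim[unfolded mult_zero_left mult_zero_right sum.neutral_const add_0_left]])
  qed simp
qed

subsection \<open>Block diagonal tensors\<close>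

lemma sum_mask_lnorm_le:
  assumes q: "0 < q" and x: "x \<in> lspace q" and S: "finite S" and I: "disjoint_family_on I S"
  shows "(\<Sum>n\<in>S. lnorm q (\<lambda>k. of_bool (k \<in> I n) * x k) powr q) \<le> lnorm q x powr q"
proof -
  have mask: "(\<lambda>k. of_bool (k \<in> I n) * x k) \<in> lspace q" for n
    by (rule lspace_mono[OF q x]) (simp add: of_bool_def)
  have "(\<Sum>n\<in>S. lnorm q (\<lambda>k. of_bool (k \<in> I n) * x k) powr q) =
      suminf (\<lambda>k. \<Sum>n\<in>S. norm (of_bool (k \<in> I n) * x k) powr q)"
    using mask q by (subst suminf_sum) (auto simp: lnorm_powr lspace_def)
  also have "\<dots> \<le> suminf (\<lambda>k. norm (x k) powr q)"
  proof (rule suminf_le)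
    fix k
    show "(\<Sum>n\<in>S. norm (of_bool (k \<in> I n) * x k) powr q) \<le> norm (x k) powr q"
    proof (cases "\<exists>n\<in>S. k \<in> I n")
      case True
      then obtain n where n: "n \<in> S" "k \<in> I n" by blast
      have "norm (of_bool (k \<in> I m) * x k) powr q = 0" if "m \<in> S - {n}" for m
        using I n that by (auto simp: disjoint_family_on_def)
      then have "(\<Sum>m\<in>S - {n}. norm (of_bool (k \<in> I m) * x k) powr q) = 0"
        by (intro sum.neutral) auto
      then show ?thesis using sum.remove[OF S n(1), of "\<lambda>n. norm (of_bool (k \<in> I n) * x k) powr q"] n by simp
    qed simp
  qed (use mask x in \<open>auto simp: lspace_def intro!: summable_sum\<close>)
  finally show ?thesis using q x by (simp add: lnorm_powr)
qed

text \<open>Lower estimate for block sums, valid whatever u does off the diagonal. For an elementary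
  tensor the block costs are controlled by Hoelder's inequality, and each further term of a
  representation takes one application of Minkowski's inequality in l_r.\<close>

lemma sum_ptn_box_le:
  fixes u :: "('i \<Rightarrow> nat) \<Rightarrow> 'k::real_normed_field"
  assumes u: "trep p A u s" and A: "A \<noteq> {}" and S: "finite S" and I: "disjoint_family_on I S"
  shows "(\<Sum>n\<in>S. ptn p A (\<lambda>k. of_bool (\<forall>i\<in>A. k i \<in> I n) * u k) powr r_exponent p A) \<le> s powr r_exponent p A"
  using u
proof (induction rule: trep.induct)
  case (step u s x c s')
  define r where "r = r_exponent p A"
  have r: "1 \<le> r" unfolding r_def by (rule r_exponent_ge_1[OF finite_A A p_pos])
  let ?box = "\<lambda>n (u :: ('i \<Rightarrow> nat) \<Rightarrow> 'k) k. of_bool (\<forall>i\<in>A. k i \<in> I n) * u k"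
  define w where "w = (\<lambda>k. c * tens A x k)"
  define y where "y n = (\<lambda>i k. of_bool (k \<in> I n) * x i k)" for n
  define a where "a i n = lnorm (p i) (y n i)" for i n
  define t where "t = norm c * (\<Prod>i\<in>A. lnorm (p i) (x i))"
  have u: "u \<in> tset p A" using step by (auto simp: tset_def)
  have w: "w \<in> tset p A" unfolding w_def using tset_tens[of A x p c] step(2) by simp
  have boxt: "?box n v \<in> tset p A" if "v \<in> tset p A" for n v
    using cmult_tset[OF cmult_box[OF subset_refl] that, of "\<lambda>_. I n"] by simp
  have t: "0 \<le> t" unfolding t_def by (intro mult_nonneg_nonneg prod_nonneg) auto
  have s: "0 \<le> s" using step trep_nonneg by blast
  have yl: "y n i \<in> lspace (p i)" if "i \<in> A" for n i
    unfolding y_def by (rule lspace_mono[OF p_pos[OF that] step(2)[OF that]]) (simp add: of_bool_def)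
  have wn: "ptn p A (?box n w) \<le> norm c * (\<Prod>i\<in>A. a i n)" for n
  proof -
    have "?box n w = (\<lambda>k. c * tens A (y n) k)"
      using finite_A by (auto simp: w_def y_def tens_def prod.distrib prod_of_bool)
    then show ?thesis using yl by (auto simp: a_def intro!: ptn_le trep_tens)
  qed
  have "(\<Sum>n\<in>S. ptn p A (?box n (\<lambda>k. u k + w k)) powr r) \<le>
      (\<Sum>n\<in>S. (ptn p A (?box n u) + norm c * (\<Prod>i\<in>A. a i n)) powr r)"
  proof (rule sum_mono, rule powr_mono2)
    fix n
    have "?box n (\<lambda>k. u k + w k) = (\<lambda>k. ?box n u k + ?box n w k)" by (simp add: algebra_simps)
    then show "ptn p A (?box n (\<lambda>k. u k + w k)) \<le> ptn p A (?box n u) + norm c * (\<Prod>i\<in>A. a i n)"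
      using ptn_triangle[OF boxt[OF u] boxt[OF w], of n n] wn[of n] by simp
    show "0 \<le> ptn p A (?box n (\<lambda>k. u k + w k))"
      by (intro ptn_nonneg boxt tset_add u w)
  qed (use r in auto)
  also have "\<dots> \<le> (s + t) powr r"
  proof (rule Minkowski_sum[OF r S])
    show "(\<Sum>n\<in>S. ptn p A (?box n u) powr r) \<le> s powr r" using step.IH by (simp add: r_def)
    have "(\<Sum>n\<in>S. (\<Prod>i\<in>A. a i n) powr r) \<le> (\<Prod>i\<in>A. lnorm (p i) (x i)) powr r"
      unfolding r_def
    proof (rule Hoelder_sum[OF finite_A A p_pos S])
      show "(\<Sum>n\<in>S. a i n powr p i) \<le> lnorm (p i) (x i) powr p i" if "i \<in> A" for i
        unfolding a_def y_def by (rule sum_mask_lnorm_le[OF p_pos[OF that] step(2)[OF that] S I])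
    qed (auto simp: a_def)
    then have "norm c powr r * (\<Sum>n\<in>S. (\<Prod>i\<in>A. a i n) powr r) \<le> norm c powr r * (\<Prod>i\<in>A. lnorm (p i) (x i)) powr r"
      by (intro mult_left_mono) auto
    then show "(\<Sum>n\<in>S. (norm c * (\<Prod>i\<in>A. a i n)) powr r) \<le> t powr r"
      by (simp add: t_def powr_mult prod_nonneg a_def sum_distrib_left)
  qed (use s t in \<open>auto intro!: ptn_nonneg boxt u mult_nonneg_nonneg prod_nonneg simp: a_def\<close>)
  also have "\<dots> \<le> s' powr r"
    using step.hyps(3) s t r by (intro powr_mono2) (auto simp: t_def)
  finally show ?case by (simp add: w_def r_def)
qed simp

text \<open>Upper estimate for elementary blocks. They are superposed in a single elementary tensor
  \<open>tens A z\<close>, whose unwanted mixed products are then removed by a diagonal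
  multiplier.\<close>

lemma trep_diagonal:
  fixes x :: "'n \<Rightarrow> 'i \<Rightarrow> nat \<Rightarrow> 'k::real_normed_field"
  assumes A: "A \<noteq> {}" and S: "finite S" and I: "disjoint_family_on I S"
    and x: "\<And>n i. n \<in> S \<Longrightarrow> i \<in> A \<Longrightarrow> x n i \<in> lspace (p i)"
    and s: "\<And>n. n \<in> S \<Longrightarrow> norm (c n) * (\<Prod>i\<in>A. lnorm (p i) (x n i)) \<le> s n"
    and sum1: "(\<Sum>i\<in>A. r / p i) = 1" and r: "1 \<le> r"
  shows "trep p A (\<lambda>k. \<Sum>n\<in>S. of_bool (\<forall>i\<in>A. k i \<in> I n) * (c n * tens A (x n) k))
           ((\<Sum>n\<in>S. s n powr r) powr (1 / r))"
proof -
  obtain i0 where i0: "i0 \<in> A" using A by blast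
  define R where "R = (\<Sum>n\<in>S. s n powr r)"
  have R: "0 \<le> R" by (simp add: R_def sum_nonneg)
  have s_nn: "0 \<le> s n" if "n \<in> S" for n
    using order_trans[OF _ s[OF that]] by (simp add: prod_nonneg)
  \<comment> \<open>Where the norm vanishes, division by 0 yields the zero sequence, which is
    correct because the factor itself is then 0.\<close>
  define y where "y n i = (\<lambda>k. x n i k / of_real (lnorm (p i) (x n i)))" for n i
  define d where "d n = c n * of_real (\<Prod>i\<in>A. lnorm (p i) (x n i))" for n
  have d: "norm (d n) \<le> s n" if "n \<in> S" for n
    using s[OF that] by (simp add: d_def norm_mult prod_nonneg flip: of_real_prod)
  have xy: "x n i k = of_real (lnorm (p i) (x n i)) * y n i k" if "n \<in> S" "i \<in> A" for n i k
    using norm_le_lnorm[OF p_pos x, OF that(2) that, of k] by (auto simp: y_def)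
  have y: "y n i \<in> lspace (p i)" "lnorm (p i) (y n i) \<le> 1" if "n \<in> S" "i \<in> A" for n i
  proof -
    have eq: "y n i = (\<lambda>k. inverse (of_real (lnorm (p i) (x n i))) * x n i k)"
      by (simp add: y_def field_simps)
    show "y n i \<in> lspace (p i)" unfolding eq by (rule lspace_scale[OF x[OF that]])
    show "lnorm (p i) (y n i) \<le> 1"
      unfolding eq lnorm_scale[OF p_pos[OF that(2)] x[OF that]]
      by (cases "lnorm (p i) (x n i) = 0") (auto simp: norm_inverse)
  qed
  have cx: "c n * tens A (x n) k = d n * tens A (y n) k" if "n \<in> S" for n k
  proof -
    have "tens A (x n) k = (\<Prod>i\<in>A. of_real (lnorm (p i) (x n i)) * y n i (k i))"
      unfolding tens_def using xy[OF that] by (intro prod.cong) auto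
    then show ?thesis by (simp add: tens_def d_def prod.distrib)
  qed
  \<comment> \<open>The cost \<open>s n\<close> is shared among the factors with exponents
    \<open>r / p i\<close>: the product of the shares is \<open>s n\<close>, while the
    \<open>p i\<close>-th power of each is \<open>s n powr r\<close>, so that \<open>z i\<close> has
    norm at most \<open>R powr (1 / p i)\<close>.\<close>
  define z where "z i = (\<lambda>k. \<Sum>n\<in>S. of_real (s n powr (r / p i)) * (of_bool (k \<in> I n) * y n i k))" for i
  have z_in: "z i k = of_real (s n powr (r / p i)) * y n i k" if "n \<in> S" "k \<in> I n" for i n k
  proof -
    have "(\<Sum>m\<in>S - {n}. of_real (s m powr (r / p i)) * (of_bool (k \<in> I m) * y m i k)) = 0"
      using I that by (intro sum.neutral) (auto simp: disjoint_family_on_def)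
    then show ?thesis using that S by (simp add: z_def sum.remove)
  qed
  have z_out: "z i k = 0" if "\<And>n. n \<in> S \<Longrightarrow> k \<notin> I n" for i k
    using that by (auto simp: z_def intro: sum.neutral)
  have z: "z i \<in> lspace (p i)" "lnorm (p i) (z i) \<le> R powr (1 / p i)" if i: "i \<in> A" for i
  proof -
    have pp: "0 < p i" using p_pos i by blast
    have "(\<Sum>k<j. norm (z i k) powr p i) \<le> (R powr (1 / p i)) powr p i" for j
    proof -
      have "(\<Sum>k<j. norm (z i k) powr p i) \<le> (\<Sum>k<j. \<Sum>n\<in>S. s n powr r * norm (y n i k) powr p i)"
      proof (rule sum_mono)
        fix k
        show "norm (z i k) powr p i \<le> (\<Sum>n\<in>S. s n powr r * norm (y n i k) powr p i)"
        proof (cases "\<exists>n\<in>S. k \<in> I n")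
          case True
          then obtain n where n: "n \<in> S" "k \<in> I n" by blast
          have "norm (z i k) powr p i = s n powr r * norm (y n i k) powr p i"
            using pp by (simp add: z_in[OF n] norm_mult powr_mult powr_powr)
          also have "\<dots> \<le> (\<Sum>n\<in>S. s n powr r * norm (y n i k) powr p i)"
            by (rule member_le_sum[OF n(1) _ S]) auto
          finally show ?thesis .
        next
          case False
          then show ?thesis using z_out[of k i] by (auto intro!: sum_nonneg)
        qed
      qed
      also have "\<dots> = (\<Sum>n\<in>S. s n powr r * (\<Sum>k<j. norm (y n i k) powr p i))"
        unfolding sum_distrib_left by (rule sum.swap)
      also have "\<dots> \<le> (\<Sum>n\<in>S. s n powr r * 1)"
      proof (intro sum_mono mult_left_mono)
        fix n assume n: "n \<in> S"
        have "(\<Sum>k<j. norm (y n i k) powr p i) \<le> lnorm (p i) (y n i) powr p i"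
          by (rule sum_le_lnorm_powr[OF pp y(1)[OF n i]]) simp
        also have "\<dots> \<le> 1" using y(2)[OF n i] pp by (simp add: powr_le1)
        finally show "(\<Sum>k<j. norm (y n i k) powr p i) \<le> 1" .
      qed simp
      finally show ?thesis using pp R by (simp add: R_def powr_powr)
    qed
    from lspace_lnorm_leI[OF pp _ this]
    show "z i \<in> lspace (p i)" "lnorm (p i) (z i) \<le> R powr (1 / p i)" by auto
  qed
  have "(\<Prod>i\<in>A. R powr (1 / p i)) = R powr (1 / r)"
  proof -
    have "(\<Sum>i\<in>A. 1 / p i) = 1 / r"
      using sum1 r by (simp add: field_simps sum_distrib_left flip: sum_divide_distrib)
    then show ?thesis using R A finite_A by (cases "R = 0") (auto simp flip: powr_sum)
  qed
  then have "(\<Prod>i\<in>A. lnorm (p i) (z i)) \<le> R powr (1 / r)"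
    using prod_mono[of A "\<lambda>i. lnorm (p i) (z i)" "\<lambda>i. R powr (1 / p i)"] z by simp
  then have tz: "trep p A (\<lambda>k. 1 * tens A z k) (R powr (1 / r))"
    using z by (intro trep_tens) auto
  \<comment> \<open>On block n this carries the phase of \<open>d n\<close> and the slack between
    its modulus and \<open>s n\<close>; if \<open>s n = 0\<close> the quotient is 0, consistent with
    \<open>d n = 0\<close>.\<close>
  define g :: "nat \<Rightarrow> 'k" where "g k = (\<Sum>n\<in>S. of_bool (k \<in> I n) * (d n / of_real (s n)))" for k
  have g_in: "g k = d n / of_real (s n)" if "n \<in> S" "k \<in> I n" for n k
  proof -
    have "(\<Sum>m\<in>S - {n}. of_bool (k \<in> I m) * (d m / of_real (s m))) = 0"
      using I that by (intro sum.neutral) (auto simp: disjoint_family_on_def)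
    then show ?thesis using that S by (simp add: g_def sum.remove)
  qed
  have g: "norm (g k) \<le> 1" for k
  proof (cases "\<exists>n\<in>S. k \<in> I n")
    case True
    then obtain n where n: "n \<in> S" "k \<in> I n" by blast
    show ?thesis using d[OF n(1)] s_nn[OF n(1)]
      by (cases "s n = 0") (simp_all add: g_in[OF n] norm_divide divide_le_eq_1)
  next
    case False
    then have "g k = 0" by (auto simp: g_def intro: sum.neutral)
    then show ?thesis by simp
  qed
  let ?m = "\<lambda>k. of_bool (\<forall>n\<in>S. \<forall>i\<in>A. k i \<in> I n \<longleftrightarrow> k i0 \<in> I n) * g (k i0)"
  have "trep p A (\<lambda>k. ?m k * (1 * tens A z k)) (R powr (1 / r))"
    by (intro cmultD[OF _ tz] cmult_mult cmult_diagonal cmult_coord S i0 g)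
  moreover have "?m k * (1 * tens A z k) = (\<Sum>n\<in>S. of_bool (\<forall>i\<in>A. k i \<in> I n) * (c n * tens A (x n) k))" for k
  proof (cases "\<exists>n\<in>S. k i0 \<in> I n")
    case True
    then obtain n where n: "n \<in> S" "k i0 \<in> I n" by blast
    have other: "k i0 \<notin> I m" if "m \<in> S - {n}" for m
      using I n that by (auto simp: disjoint_family_on_def)
    have "(\<Sum>m\<in>S - {n}. of_bool (\<forall>i\<in>A. k i \<in> I m) * (c m * tens A (x m) k)) = 0"
      using other i0 by (intro sum.neutral) auto
    then have rhs: "(\<Sum>n\<in>S. of_bool (\<forall>i\<in>A. k i \<in> I n) * (c n * tens A (x n) k)) =
        of_bool (\<forall>i\<in>A. k i \<in> I n) * (d n * tens A (y n) k)"
      unfolding sum.remove[OF S n(1)] cx[OF n(1)] by simp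
    show ?thesis
    proof (cases "\<forall>i\<in>A. k i \<in> I n")
      case True
      have iff: "\<forall>m\<in>S. \<forall>i\<in>A. k i \<in> I m \<longleftrightarrow> k i0 \<in> I m"
      proof (intro ballI)
        fix m i assume "m \<in> S" "i \<in> A"
        then show "k i \<in> I m \<longleftrightarrow> k i0 \<in> I m"
          using True n I by (cases "m = n") (auto simp: disjoint_family_on_def)
      qed
      have "tens A z k = (\<Prod>i\<in>A. of_real (s n powr (r / p i)) * y n i (k i))"
        unfolding tens_def using True z_in[OF n(1)] by (intro prod.cong) auto
      also have "\<dots> = of_real (\<Prod>i\<in>A. s n powr (r / p i)) * tens A (y n) k"
        by (simp add: prod.distrib tens_def)
      also have "(\<Prod>i\<in>A. s n powr (r / p i)) = s n"
        using s_nn[OF n(1)] sum1 A finite_A by (cases "s n = 0") (auto simp flip: powr_sum)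
      finally have "g (k i0) * tens A z k = d n * tens A (y n) k"
        using d[OF n(1)] by (auto simp: g_in[OF n])
      then show ?thesis unfolding rhs using iff True by simp
    next
      case False
      then show ?thesis unfolding rhs using n by auto
    qed
  next
    case False
    then have "tens A z k = 0"
      unfolding tens_def using finite_A i0 z_out[of "k i0" i0] by (intro prod_zero) auto
    moreover have "(\<Sum>n\<in>S. of_bool (\<forall>i\<in>A. k i \<in> I n) * (c n * tens A (x n) k)) = 0"
      using False i0 by (intro sum.neutral) auto
    ultimately show ?thesis by simp
  qed
  ultimately show ?thesis by (simp add: R_def)
qed

text \<open>A bound that holds for all elementary tensors of cost at most \<open>s\<close> extends to all \<open>u\<close> with
  \<open>trep p A u s\<close>, because such \<open>u\<close> lie in their convex hull.\<close>

lemma trep_convex: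
  fixes f b :: "('i \<Rightarrow> nat) \<Rightarrow> 'k::real_normed_field"
  assumes elementary: "\<And>c x. (\<And>i. i \<in> A \<Longrightarrow> x i \<in> lspace (p i)) \<Longrightarrow>
        norm c * (\<Prod>i\<in>A. lnorm (p i) (x i)) \<le> s \<Longrightarrow> trep p A (\<lambda>k. b k * (c * tens A x k) + f k) R"
    and u: "trep p A u s"
  shows "trep p A (\<lambda>k. b k * u k + f k) R"
proof -
  have s: "0 \<le> s" using u trep_nonneg by blast
  have f: "trep p A f R" using elementary[of "\<lambda>i n. 0" 0] s by simp
  show ?thesis
  proof (cases "s = 0")
    case True
    then have "u k = 0" for k using norm_le_trep[OF u, of k] by simp
    then show ?thesis using f by simp
  next
    case False
    then have pos: "0 < s" using s by simp
    \<comment> \<open>A partial cost t is accompanied by the share \<open>t / s\<close> of f; in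
      this form the affine claim is additive along a representation, and t = s recovers it.\<close>
    have "trep p A (\<lambda>k. b k * u k + of_real (t / s) * f k) (t / s * R)" if "trep p A u t" for u t
      using that
    proof (induction rule: trep.induct)
      case (zero t)
      then show ?case using trep_scale[OF f, of "of_real (t / s)"] pos by (simp add: norm_divide)
    next
      case (step u t x c t')
      define \<delta> where "\<delta> = (t' - t) / s"
      have cost: "norm c * (\<Prod>i\<in>A. lnorm (p i) (x i)) \<le> \<delta> * s"
        using step.hyps(3) pos by (simp add: \<delta>_def)
      have cost0: "0 \<le> norm c * (\<Prod>i\<in>A. lnorm (p i) (x i))"
        by (intro mult_nonneg_nonneg prod_nonneg) auto
      then have \<delta>: "0 \<le> \<delta>" using order_trans[OF cost0 cost] pos by (simp add: zero_le_mult_iff)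
      have "trep p A (\<lambda>k. b k * (c * tens A x k) + of_real \<delta> * f k) (\<delta> * R)"
      \<comment> \<open>A step without cost adds the zero function; any other step is normalised to
        cost at most s, where the hypothesis on elementary tensors applies.\<close>
      proof (cases "\<delta> = 0")
        case True
        then have "norm (c * tens A x k) \<le> 0" for k
          using cost norm_tens_le[of x k] step.hyps(2)
            mult_left_mono[of "norm (tens A x k)" "\<Prod>i\<in>A. lnorm (p i) (x i)" "norm c"]
          by (simp add: norm_mult del: mult_le_0_iff)
        then have "(\<lambda>k. b k * (c * tens A x k) + of_real \<delta> * f k) = (\<lambda>k. 0)"
          using True by (intro ext) (metis add.right_neutral mult_zero_left mult_zero_right norm_le_zero_iff of_real_0)
        then show ?thesis by (simp only:) (simp add: True trep.zero)
      next
        case False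
        then have "norm (c / of_real \<delta>) * (\<Prod>i\<in>A. lnorm (p i) (x i)) \<le> s"
          using cost \<delta> by (simp add: norm_divide field_simps)
        from trep_scale[OF elementary[OF step.hyps(2) this], of "of_real \<delta>"]
        show ?thesis using False \<delta> by (simp add: algebra_simps)
      qed
      from trep_add[OF step.IH this] show ?case
        using pos by (simp add: \<delta>_def algebra_simps add_divide_distrib diff_divide_distrib)
    qed
    from this[OF u] show ?thesis using pos by simp
  qed
qed

text \<open>If the reciprocals sum to at least 1, the exponent is 1 and the triangle inequality is
  enough. Otherwise the blocks are exchanged one by one for elementary tensors, and convexity
  carries each bound back from elementary to general blocks.\<close>

lemma trep_block_diagonal:
  fixes u :: "'n \<Rightarrow> ('i \<Rightarrow> nat) \<Rightarrow> 'k::real_normed_field"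
  assumes A: "A \<noteq> {}" and S: "finite S" and I: "disjoint_family_on I S"
    and u: "\<And>n. n \<in> S \<Longrightarrow> trep p A (u n) (s n)"
    and supp: "\<And>n k. n \<in> S \<Longrightarrow> u n k \<noteq> 0 \<Longrightarrow> \<forall>i\<in>A. k i \<in> I n"
  shows "trep p A (\<lambda>k. \<Sum>n\<in>S. u n k) ((\<Sum>n\<in>S. s n powr r_exponent p A) powr (1 / r_exponent p A))"
proof (cases "(\<Sum>i\<in>A. 1 / p i) < 1")
  case False
  then have r: "r_exponent p A = 1" by (simp add: r_exponent_def)
  have "(\<Sum>n\<in>S. s n powr 1) = (\<Sum>n\<in>S. s n)"
    using trep_nonneg[OF u] by (intro sum.cong) simp_all
  moreover have "0 \<le> (\<Sum>n\<in>S. s n)" using u trep_nonneg by (intro sum_nonneg) blast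
  ultimately show ?thesis using trep_sum[OF S u] by (simp add: r)
next
  case True
  define r where "r = r_exponent p A"
  have r1: "1 \<le> r" unfolding r_def by (rule r_exponent_ge_1[OF finite_A A p_pos])
  have "0 < (\<Sum>i\<in>A. 1 / p i)" using A finite_A p_pos by (intro sum_pos) auto
  then have sum1: "(\<Sum>i\<in>A. r / p i) = 1"
    using True by (simp add: r_def r_exponent_def min_def sum_divide_distrib[symmetric] sum_distrib_left[symmetric] divide_inverse)
  define R where "R = (\<Sum>n\<in>S. s n powr r) powr (1 / r)"
  let ?box = "\<lambda>n k. of_bool (\<forall>i\<in>A. k i \<in> I n) :: 'k"
  define elem where "elem w t \<longleftrightarrow> (\<exists>c x. (\<forall>i\<in>A. x i \<in> lspace (p i)) \<and>
      norm c * (\<Prod>i\<in>A. lnorm (p i) (x i)) \<le> t \<and> w = (\<lambda>k. c * tens A x k))"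
    for w :: "('i \<Rightarrow> nat) \<Rightarrow> 'k" and t
  \<comment> \<open>T collects the positions that are still general. The multiplier
    \<open>?box n\<close> is kept because the elementary tensors substituted for \<open>u n\<close>
    need not be supported in its block.\<close>
  have "trep p A (\<lambda>k. \<Sum>n\<in>S. ?box n k * w n k) R"
    if "T \<subseteq> S" "\<And>n. n \<in> T \<Longrightarrow> trep p A (w n) (s n)" "\<And>n. n \<in> S - T \<Longrightarrow> elem (w n) (s n)" for T w
    using finite_subset[OF that(1) S] that
  proof (induction T arbitrary: w rule: finite_induct)
    case empty
    then have "\<forall>n\<in>S. \<exists>h. (\<forall>i\<in>A. snd h i \<in> lspace (p i)) \<and>
      norm (fst h) * (\<Prod>i\<in>A. lnorm (p i) (snd h i)) \<le> s n \<and> w n = (\<lambda>k. fst h * tens A (snd h) k)"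
      by (simp add: elem_def)
    from bchoice[OF this] obtain h where h: "\<forall>n\<in>S. (\<forall>i\<in>A. snd (h n) i \<in> lspace (p i)) \<and>
      norm (fst (h n)) * (\<Prod>i\<in>A. lnorm (p i) (snd (h n) i)) \<le> s n \<and>
      w n = (\<lambda>k. fst (h n) * tens A (snd (h n)) k)" ..
    define c where "c n = fst (h n)" for n
    define x where "x n = snd (h n)" for n
    have cx: "(\<forall>i\<in>A. x n i \<in> lspace (p i)) \<and>
      norm (c n) * (\<Prod>i\<in>A. lnorm (p i) (x n i)) \<le> s n \<and> w n = (\<lambda>k. c n * tens A (x n) k)"
      if "n \<in> S" for n
      using h that by (simp add: c_def x_def)
    have "trep p A (\<lambda>k. \<Sum>n\<in>S. ?box n k * (c n * tens A (x n) k)) R"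
      unfolding R_def using cx by (intro trep_diagonal A S I sum1 r1) auto
    then show ?case using cx by simp
  next
    case (insert m T)
    \<comment> \<open>All blocks except m are frozen, which makes the sum affine in block m.\<close>
    define f where "f = (\<lambda>k. \<Sum>n\<in>S - {m}. ?box n k * w n k)"
    have m: "m \<in> S" using insert by auto
    have eq: "(\<Sum>n\<in>S. ?box n k * (w(m := v)) n k) = ?box m k * v k + f k" for v k
      using sum.remove[OF S m, of "\<lambda>n. ?box n k * (w(m := v)) n k"] by (simp add: f_def)
    have "trep p A (\<lambda>k. ?box m k * w m k + f k) R"
    proof (rule trep_convex)
      show "trep p A (w m) (s m)" using insert by simp
      fix c :: 'k and x :: "'i \<Rightarrow> nat \<Rightarrow> 'k"
      assume x: "\<And>i. i \<in> A \<Longrightarrow> x i \<in> lspace (p i)" "norm c * (\<Prod>i\<in>A. lnorm (p i) (x i)) \<le> s m"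
      then have "elem (\<lambda>k. c * tens A x k) (s m)" unfolding elem_def by blast
      then have "trep p A (\<lambda>k. \<Sum>n\<in>S. ?box n k * (w(m := (\<lambda>k. c * tens A x k))) n k) R"
        using insert by (intro insert.IH) auto
      then show "trep p A (\<lambda>k. ?box m k * (c * tens A x k) + f k) R" by (simp only: eq)
    qed
    then show ?case using eq[of _ "w m"] by simp
  qed
  from this[of S u] have "trep p A (\<lambda>k. \<Sum>n\<in>S. ?box n k * u n k) R" using u by simp
  moreover have "?box n k * u n k = u n k" if "n \<in> S" for n k
    using supp[OF that, of k] by (cases "u n k = 0") auto
  ultimately show ?thesis by (simp add: R_def r_def)
qed

end

section \<open>Block sequences and strictly singular seminorms\<close>

definition c00 :: "(nat \<Rightarrow> 'k::real_normed_field) set" where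
  "c00 = {a. finite {n. a n \<noteq> 0}}"

text \<open>Summing over the support of a gives a finite sum for a in \<open>c00\<close>; y may
  consist of sequences or of tensors alike.\<close>

definition comb :: "(nat \<Rightarrow> 'j \<Rightarrow> 'k) \<Rightarrow> (nat \<Rightarrow> 'k) \<Rightarrow> 'j \<Rightarrow> 'k::real_normed_field" where
  "comb y a = (\<lambda>j. \<Sum>n | a n \<noteq> 0. a n * y n j)"

definition unit_seq :: "nat \<Rightarrow> nat \<Rightarrow> 'k::real_normed_field" where
  "unit_seq m = (\<lambda>n. of_bool (n = m))"

text \<open>Disjointness of supports, without any order, already makes \<open>comb z\<close>
  isometric for l_q; such sequences play the role of normalised block bases.\<close>

definition dseq :: "real \<Rightarrow> (nat \<Rightarrow> nat \<Rightarrow> 'k::real_normed_field) \<Rightarrow> bool" where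
  "dseq q z \<longleftrightarrow> (\<forall>n. z n \<in> c00 \<and> lnorm q (z n) = 1) \<and> (\<forall>m n j. m \<noteq> n \<longrightarrow> z m j = 0 \<or> z n j = 0)"

lemma comb_eq:
  assumes "finite S" "\<And>n. n \<notin> S \<Longrightarrow> a n = 0"
  shows "comb y a = (\<lambda>j. \<Sum>n\<in>S. a n * y n j)"
  unfolding comb_def using assms by (intro ext sum.mono_neutral_left) auto

lemma c00_add: "a \<in> c00 \<Longrightarrow> b \<in> c00 \<Longrightarrow> (\<lambda>n. a n + b n) \<in> c00"
  unfolding c00_def by (auto intro: finite_subset[of _ "{n. a n \<noteq> 0} \<union> {n. b n \<noteq> 0}"])

lemma c00_scale: "a \<in> c00 \<Longrightarrow> (\<lambda>n. c * a n) \<in> c00"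
  unfolding c00_def by (auto intro: finite_subset[of _ "{n. a n \<noteq> 0}"])

lemma c00_zero: "(\<lambda>n. 0) \<in> c00"
  by (simp add: c00_def)

lemma c00_sum:
  assumes "\<And>n. n \<in> S \<Longrightarrow> a n \<in> c00"
  shows "(\<lambda>k. \<Sum>n\<in>S. a n k) \<in> c00"
  using assms by (induction S rule: infinite_finite_induct) (auto intro: c00_zero c00_add)

lemma comb_c00: "(\<And>n. y n \<in> c00) \<Longrightarrow> comb y a \<in> c00"
  unfolding comb_def by (intro c00_sum c00_scale)

lemma c00_lspace: "a \<in> c00 \<Longrightarrow> 0 < q \<Longrightarrow> a \<in> lspace q"
  by (simp add: c00_def lnorm_finite)

lemma lnorm_powr_c00:
  assumes q: "0 < q" and S: "finite S" "\<And>n. n \<notin> S \<Longrightarrow> a n = 0"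
  shows "lnorm q a powr q = (\<Sum>n\<in>S. norm (a n) powr q)"
proof -
  have "finite {n. a n \<noteq> 0}" using S by (auto intro: finite_subset[of _ S])
  from lnorm_finite(2)[OF this q] show ?thesis
    using S by (simp, intro sum.mono_neutral_left) auto
qed

lemma comb_add:
  assumes "a \<in> c00" "b \<in> c00"
  shows "comb y (\<lambda>n. a n + b n) = (\<lambda>j. comb y a j + comb y b j)"
proof -
  let ?S = "{n. a n \<noteq> 0} \<union> {n. b n \<noteq> 0}"
  have S: "finite ?S" using assms by (simp add: c00_def)
  show ?thesis
    by (subst comb_eq[OF S], simp, subst comb_eq[OF S], simp, subst comb_eq[OF S], simp)
      (simp add: algebra_simps sum.distrib)
qed

lemma comb_scale: "comb y (\<lambda>n. c * a n) = (\<lambda>j. c * comb y a j)"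
  by (cases "c = 0") (simp_all add: comb_def sum_distrib_left mult.assoc)

lemma comb_unit: "comb y (unit_seq m) = y m"
  by (subst comb_eq[of "{m}"]) (auto simp: unit_seq_def)

lemma unit_c00: "unit_seq m \<in> c00"
  by (simp add: c00_def unit_seq_def)

lemma comb_unit_seq:
  assumes "a \<in> c00"
  shows "comb unit_seq a = a"
proof
  fix j
  have "comb unit_seq a j = (\<Sum>n\<in>insert j {n. a n \<noteq> 0}. a n * unit_seq n j)"
    by (subst comb_eq[of "insert j {n. a n \<noteq> 0}"]) (use assms in \<open>auto simp: c00_def\<close>)
  also have "\<dots> = (\<Sum>n\<in>insert j {n. a n \<noteq> 0}. if j = n then a n else 0)"
    by (intro sum.cong) (auto simp: unit_seq_def)
  also have "\<dots> = a j" using assms by (subst sum.delta') (auto simp: c00_def)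
  finally show "comb unit_seq a j = a j" .
qed

lemma comb_comb:
  assumes a: "a \<in> c00" and b: "\<And>n. b n \<in> c00"
  shows "comb y (comb b a) = comb (\<lambda>n. comb y (b n)) a"
proof
  fix j
  let ?S = "{n. a n \<noteq> 0}"
  let ?T = "\<Union>n\<in>?S. {m. b n m \<noteq> 0}"
  have T: "finite ?T" using a b by (auto simp: c00_def)
  have 1: "comb b a m = 0" if "m \<notin> ?T" for m
    using that by (auto simp: comb_def intro!: sum.neutral)
  have 2: "comb y (b n) j = (\<Sum>m\<in>?T. b n m * y m j)" if "n \<in> ?S" for n
    using that T by (subst comb_eq[of ?T]) auto
  have "comb y (comb b a) j = (\<Sum>m\<in>?T. comb b a m * y m j)"
    by (subst comb_eq[OF T 1]) auto
  also have "\<dots> = (\<Sum>m\<in>?T. \<Sum>n\<in>?S. a n * b n m * y m j)"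
    by (simp add: comb_def sum_distrib_right)
  also have "\<dots> = (\<Sum>n\<in>?S. \<Sum>m\<in>?T. a n * b n m * y m j)"
    by (rule sum.swap)
  also have "\<dots> = comb (\<lambda>n. comb y (b n)) a j"
    unfolding comb_def[of _ a] by (intro sum.cong) (simp_all add: 2 sum_distrib_left mult.assoc)
  finally show "comb y (comb b a) j = comb (\<lambda>n. comb y (b n)) a j" .
qed

section \<open>Isometric spans of disjoint normalised sequences\<close>

lemma dseqD:
  assumes "dseq q z"
  shows "z n \<in> c00" "lnorm q (z n) = 1" "m \<noteq> n \<Longrightarrow> z m j = 0 \<or> z n j = 0"
  using assms by (auto simp: dseq_def)

lemma lnorm_unit: "0 < q \<Longrightarrow> lnorm q (unit_seq m :: nat \<Rightarrow> 'k::real_normed_field) = 1"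
proof -
  assume q: "0 < q"
  have "lnorm q (unit_seq m :: nat \<Rightarrow> 'k) powr q = 1"
    using lnorm_powr_c00[OF q, of "{m}" "unit_seq m :: nat \<Rightarrow> 'k"] by (simp add: unit_seq_def)
  then show ?thesis using q powr_powr[of "lnorm q (unit_seq m :: nat \<Rightarrow> 'k)" q "1 / q"] by simp
qed

lemma dseq_unit: "0 < q \<Longrightarrow> inj f \<Longrightarrow> dseq q (\<lambda>n. unit_seq (f n))"
  unfolding dseq_def using lnorm_unit unit_c00 by (auto simp: unit_seq_def dest: injD)

lemma lnorm_comb:
  assumes q: "0 < q" and z: "dseq q z" and a: "a \<in> c00"
  shows "lnorm q (comb z a) = lnorm q a"
proof -
  let ?S = "{n. a n \<noteq> 0}"
  let ?T = "\<Union>n\<in>?S. {m. z n m \<noteq> 0}"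
  have S: "finite ?S" using a by (simp add: c00_def)
  have T: "finite ?T" using S dseqD(1)[OF z] by (auto simp: c00_def)
  have T0: "comb z a j = 0" if "j \<notin> ?T" for j
    using that by (auto simp: comb_def intro!: sum.neutral)
  \<comment> \<open>At each coordinate at most one summand survives, so the power passes inside the
    sum.\<close>
  have pt: "norm (comb z a j) powr q = (\<Sum>n\<in>?S. norm (a n) powr q * norm (z n j) powr q)" for j
  proof (cases "\<exists>n\<in>?S. z n j \<noteq> 0")
    case True
    then obtain n where n: "n \<in> ?S" "z n j \<noteq> 0" by blast
    have 0: "z m j = 0" if "m \<in> ?S - {n}" for m using dseqD(3)[OF z, of m n j] that n by auto
    have "(\<Sum>m\<in>?S - {n}. a m * z m j) = 0" "(\<Sum>m\<in>?S - {n}. norm (a m) powr q * norm (z m j) powr q) = 0"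
      using 0 by (auto intro!: sum.neutral)
    then show ?thesis
      unfolding comb_def sum.remove[OF S n(1)] by (simp add: norm_mult powr_mult)
  next
    case False
    then have "comb z a j = 0" "(\<Sum>n\<in>?S. norm (a n) powr q * norm (z n j) powr q) = 0"
      unfolding comb_def by (intro sum.neutral; auto)+
    then show ?thesis by simp
  qed
  have "lnorm q (comb z a) powr q = (\<Sum>j\<in>?T. \<Sum>n\<in>?S. norm (a n) powr q * norm (z n j) powr q)"
    using lnorm_powr_c00[OF q T T0] by (simp only: pt)
  also have "\<dots> = (\<Sum>n\<in>?S. norm (a n) powr q * (\<Sum>j\<in>?T. norm (z n j) powr q))"
    unfolding sum_distrib_left by (rule sum.swap)
  also have "\<dots> = (\<Sum>n\<in>?S. norm (a n) powr q * 1)"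
  proof (intro sum.cong arg_cong2[where f = "(*)"])
    fix n assume n: "n \<in> ?S"
    have "lnorm q (z n) powr q = (\<Sum>j\<in>?T. norm (z n j) powr q)"
      by (rule lnorm_powr_c00[OF q T]) (use n in auto)
    then show "(\<Sum>j\<in>?T. norm (z n j) powr q) = 1" using dseqD(2)[OF z] by simp
  qed auto
  also have "\<dots> = lnorm q a powr q"
    using lnorm_powr_c00[OF q S, of a] by simp
  finally have "(lnorm q (comb z a) powr q) powr (1 / q) = (lnorm q a powr q) powr (1 / q)" by simp
  then show ?thesis using q by (simp add: powr_powr)
qed

lemma dseq_comb:
  assumes q: "0 < q" and y: "dseq q y" and b: "dseq q b"
  shows "dseq q (\<lambda>n. comb y (b n))"
  unfolding dseq_def
proof (intro conjI allI impI)
  fix n show "comb y (b n) \<in> c00" using dseqD[OF y] by (intro comb_c00)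
  show "lnorm q (comb y (b n)) = 1" using lnorm_comb[OF q y] dseqD[OF b] by simp
next
  fix m n j :: nat assume mn: "m \<noteq> n"
  have ex: "\<exists>k. a k \<noteq> 0 \<and> y k j \<noteq> 0" if "comb y a j \<noteq> 0" for a
    using that unfolding comb_def by (elim sum.not_neutral_contains_not_neutral) auto
  show "comb y (b m) j = 0 \<or> comb y (b n) j = 0"
  proof (rule ccontr)
    assume "\<not> ?thesis"
    then obtain k l where "b m k \<noteq> 0" "y k j \<noteq> 0" "b n l \<noteq> 0" "y l j \<noteq> 0"
      using ex[of "b m"] ex[of "b n"] by auto
    then show False using dseqD(3)[OF y, of k l j] dseqD(3)[OF b mn, of k] by (cases "k = l") auto
  qed
qed

text \<open>The gliding hump in general form. P sees both ends of the window: the left end is fixed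
  before the vector is chosen, the right end afterwards, so that it can be pushed as far as P
  requires.\<close>

lemma block_selection:
  assumes "\<And>n J. \<exists>a J'. a \<in> c00 \<and> lnorm q a = 1 \<and> (\<forall>m<J. a m = 0) \<and> J \<le> J' \<and> (\<forall>m\<ge>J'. a m = 0) \<and> P n J a J'"
  obtains b J where "dseq q b" "incseq J" "\<And>n. P n (J n) (b n) (J (Suc n))"
proof -
  define Q where "Q n J a J' \<longleftrightarrow> a \<in> c00 \<and> lnorm q a = 1 \<and> (\<forall>m<J. a m = 0) \<and>
      J \<le> J' \<and> (\<forall>m\<ge>J'. a m = 0) \<and> P n J a J'" for n J a J'
  have "\<forall>x. \<exists>y. Q (fst x) (snd x) (fst y) (snd y)" using assms by (simp add: Q_def)
  from choice[OF this] obtain h where h: "\<And>x. Q (fst x) (snd x) (fst (h x)) (snd (h x))" by blast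
  define f where "f n J = fst (h (n, J))" for n J
  define g where "g n J = snd (h (n, J))" for n J
  have fg: "f n J \<in> c00 \<and> lnorm q (f n J) = 1 \<and> (\<forall>m<J. f n J m = 0) \<and>
      J \<le> g n J \<and> (\<forall>m\<ge>g n J. f n J m = 0) \<and> P n J (f n J) (g n J)" for n J
    using h[of "(n, J)"] by (simp add: f_def g_def Q_def)
  define J where "J = rec_nat 0 g"
  have J: "J (Suc n) = g n (J n)" for n by (simp add: J_def)
  have inc: "incseq J" using fg J by (intro incseq_SucI) simp
  have "f m (J m) j = 0 \<or> f n (J n) j = 0" if "m < n" for m n j
  proof (cases "j < J n")
    case False
    have "J (Suc m) \<le> J n" using inc that by (simp add: incseqD)
    then show ?thesis using False fg[where n = m and J = "J m"] J by auto
  qed (use fg in blast)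
  then have "f m (J m) j = 0 \<or> f n (J n) j = 0" if "m \<noteq> n" for m n j
    using that by (metis linorder_neqE_nat)
  then have "dseq q (\<lambda>n. f n (J n))" using fg by (auto simp: dseq_def)
  then show ?thesis using inc fg J by (intro that[of "\<lambda>n. f n (J n)" J]) auto
qed

section \<open>Strictly singular seminorms\<close>

definition csemi :: "((nat \<Rightarrow> 'k::real_normed_field) \<Rightarrow> real) \<Rightarrow> bool" where
  "csemi s \<longleftrightarrow> (\<forall>a\<in>c00. 0 \<le> s a) \<and> (\<forall>a\<in>c00. \<forall>b\<in>c00. s (\<lambda>n. a n + b n) \<le> s a + s b) \<and>
     (\<forall>c. \<forall>a\<in>c00. s (\<lambda>n. c * a n) = norm c * s a)"

text \<open>Seminorm analogue of a strictly singular operator, tested on spans of disjoint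
  normalised sequences. Its failure provides such a span on which the seminorm is bounded below on
  the unit sphere.\<close>

definition strictly_singular :: "real \<Rightarrow> ((nat \<Rightarrow> 'k::real_normed_field) \<Rightarrow> real) \<Rightarrow> bool" where
  "strictly_singular q s \<longleftrightarrow>
     (\<forall>z \<delta>. dseq q z \<and> 0 < \<delta> \<longrightarrow> (\<exists>a\<in>c00. lnorm q a = 1 \<and> s (comb z a) < \<delta>))"

lemma csemi_comb_le:
  assumes s: "csemi s" and w: "\<And>n. w n \<in> c00" and a: "a \<in> c00"
  shows "s (comb w a) \<le> (\<Sum>n | a n \<noteq> 0. norm (a n) * s (w n))"
proof -
  have "s (\<lambda>j. \<Sum>n\<in>S. a n * w n j) \<le> (\<Sum>n\<in>S. norm (a n) * s (w n))" if "finite S" for S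
    using that
  proof (induction S rule: finite_induct)
    case empty
    have "\<forall>c. \<forall>a\<in>c00. s (\<lambda>n. c * a n) = norm c * s a" using s by (simp add: csemi_def)
    from this[rule_format, OF c00_zero, of 0] show ?case by simp
  next
    case (insert m S)
    have "(\<lambda>j. \<Sum>n\<in>insert m S. a n * w n j) = (\<lambda>j. a m * w m j + (\<Sum>n\<in>S. a n * w n j))"
      using insert by simp
    moreover have "s (\<lambda>j. a m * w m j + (\<Sum>n\<in>S. a n * w n j)) \<le> s (\<lambda>j. a m * w m j) + s (\<lambda>j. \<Sum>n\<in>S. a n * w n j)"
      using s c00_scale[OF w] c00_sum[of S "\<lambda>n j. a n * w n j", OF c00_scale[OF w]]
      by (simp add: csemi_def)
    moreover have "s (\<lambda>j. a m * w m j) = norm (a m) * s (w m)"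
      using s w by (simp add: csemi_def)
    ultimately show ?case using insert by simp
  qed
  then show ?thesis using a by (simp add: comb_def c00_def)
qed

text \<open>Strict singularity applies equally to the shifted sequence \<open>z (n + J)\<close>, and
  coefficients with respect to it start at J when read along z.\<close>

lemma strictly_singular_tail:
  fixes s :: "(nat \<Rightarrow> 'k::real_normed_field) \<Rightarrow> real"
  assumes q: "0 < q" and s: "strictly_singular q s" and z: "dseq q z" and \<delta>: "0 < \<delta>"
  shows "\<exists>a\<in>c00. lnorm q a = 1 \<and> (\<forall>m<J. a m = 0) \<and> s (comb z a) < \<delta>"
proof -
  define e :: "nat \<Rightarrow> nat \<Rightarrow> 'k" where "e n = unit_seq (n + J)" for n
  have e: "dseq q e" unfolding e_def by (rule dseq_unit[OF q]) (simp add: inj_on_def)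
  have "dseq q (\<lambda>n. comb z (e n))" by (rule dseq_comb[OF q z e])
  then obtain a where a: "a \<in> c00" "lnorm q a = 1" "s (comb (\<lambda>n. comb z (e n)) a) < \<delta>"
    using s \<delta> unfolding strictly_singular_def by blast
  have "comb e a m = 0" if "m < J" for m
    using that by (auto simp: comb_def e_def unit_seq_def intro: sum.neutral)
  then show ?thesis
    using a lnorm_comb[OF q e a(1)] comb_c00[of e a] dseqD[OF e] comb_comb[OF a(1) dseqD(1)[OF e], of z]
    by (intro bexI[of _ "comb e a"]) auto
qed

lemma strictly_singular_sequence:
  assumes q: "0 < q" and s: "strictly_singular q s" and z: "dseq q z" and \<epsilon>: "\<And>n. 0 < \<epsilon> n"
  obtains b where "dseq q b" "\<And>n::nat. s (comb z (b n)) < \<epsilon> n"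
proof -
  have "\<exists>a J'. a \<in> c00 \<and> lnorm q a = 1 \<and> (\<forall>m<J. a m = 0) \<and> J \<le> J' \<and> (\<forall>m\<ge>J'. a m = 0) \<and> s (comb z a) < \<epsilon> n"
    for n J
  proof -
    obtain a where a: "a \<in> c00" "lnorm q a = 1" "\<forall>m<J. a m = 0" "s (comb z a) < \<epsilon> n"
      using strictly_singular_tail[OF q s z \<epsilon>] by blast
    obtain K where "\<forall>m\<in>{n. a n \<noteq> 0}. m < K"
      using a(1) finite_nat_set_iff_bounded[of "{n. a n \<noteq> 0}"] by (auto simp: c00_def)
    then have "\<forall>m\<ge>max J K. a m = 0" by force
    then show ?thesis using a by (intro exI[of _ a] exI[of _ "max J K"]) auto
  qed
  from block_selection[where P = "\<lambda>n J a J'. s (comb z a) < \<epsilon> n", OF this] that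
  show ?thesis by blast
qed

text \<open>The first summand is made small on a whole block subspace, inside of which the second one is
  then made small.\<close>

lemma strictly_singular_add:
  fixes s t :: "(nat \<Rightarrow> 'k::real_normed_field) \<Rightarrow> real"
  assumes q: "0 < q" and s: "csemi s" "strictly_singular q s" and t: "strictly_singular q t"
  shows "strictly_singular q (\<lambda>a. s a + t a)"
  unfolding strictly_singular_def
proof (intro allI impI, elim conjE)
  fix z :: "nat \<Rightarrow> nat \<Rightarrow> 'k" and \<delta> :: real
  assume z: "dseq q z" and \<delta>: "0 < \<delta>"
  \<comment> \<open>Coefficients of a normalised vector are at most 1 and the geometric series sums
    to 2, so these errors contribute at most \<open>\<delta> / 2\<close> and leave
    \<open>\<delta> / 2\<close> for t.\<close>
  obtain b where b: "dseq q b" "\<And>n::nat. s (comb z (b n)) < \<delta> / 4 * (1 / 2) ^ n"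
    using strictly_singular_sequence[OF q s(2) z, of "\<lambda>n. \<delta> / 4 * (1 / 2) ^ n"] \<delta> by auto
  define w where "w n = comb z (b n)" for n
  have w: "dseq q w" unfolding w_def by (rule dseq_comb[OF q z b(1)])
  obtain a where a: "a \<in> c00" "lnorm q a = 1" "t (comb w a) < \<delta> / 2"
    using t w \<delta> unfolding strictly_singular_def by (meson half_gt_zero)
  have "s (comb w a) \<le> (\<Sum>n | a n \<noteq> 0. norm (a n) * s (w n))"
    using a dseqD[OF w] by (intro csemi_comb_le s) auto
  also have "\<dots> \<le> (\<Sum>n | a n \<noteq> 0. 1 * (\<delta> / 4 * (1 / 2) ^ n))"
  proof (intro sum_mono mult_mono)
    show "norm (a n) \<le> 1" for n using norm_le_lnorm[OF q c00_lspace[OF a(1) q], of n] a by simp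
    show "s (w n) \<le> \<delta> / 4 * (1 / 2) ^ n" for n using b(2)[of n] by (simp add: w_def)
    show "0 \<le> s (w n)" for n using s(1) dseqD(1)[OF w] by (auto simp: csemi_def)
  qed auto
  also have "\<dots> = \<delta> / 4 * (\<Sum>n | a n \<noteq> 0. (1 / 2) ^ n)"
    by (simp add: sum_distrib_left)
  also have "(\<Sum>n | a n \<noteq> 0. (1 / 2 :: real) ^ n) \<le> suminf (\<lambda>n. (1 / 2) ^ n)"
    using a by (intro sum_le_suminf summable_geometric) (auto simp: c00_def)
  also have "\<dots> = 2" by (subst suminf_geometric) auto
  finally have "s (comb w a) \<le> \<delta> / 2" using \<delta> by simp
  moreover have "comb w a = comb z (comb b a)"
    unfolding w_def using comb_comb[OF a(1) dseqD(1)[OF b(1)], of z] by simp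
  ultimately show "\<exists>a\<in>c00. lnorm q a = 1 \<and> s (comb z a) + t (comb z a) < \<delta>"
    using a lnorm_comb[OF q b(1) a(1)] comb_c00[of b a] dseqD(1)[OF b(1)]
    by (intro bexI[of _ "comb b a"]) auto
qed

lemma strictly_singular_sum:
  assumes q: "0 < q" and "finite F" "\<And>i. i \<in> F \<Longrightarrow> csemi (s i) \<and> strictly_singular q (s i)"
  shows "strictly_singular q (\<lambda>a. \<Sum>i\<in>F. s i a)"
  using assms(2,3)
proof (induction F rule: finite_induct)
  case empty
  show ?case
    using lnorm_unit[OF q] unit_c00 by (auto simp: strictly_singular_def intro!: bexI[of _ "unit_seq 0"])
next
  case (insert i F)
  then show ?case using strictly_singular_add[OF q, of "s i" "\<lambda>a. \<Sum>i\<in>F. s i a"] by simp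
qed

section \<open>Sequences in a projective tensor product equivalent to a unit vector basis\<close>

lemma powr_growth_le:
  fixes K L \<alpha> \<beta> :: real
  assumes K: "0 < K" and le: "\<And>M::nat. 1 \<le> M \<Longrightarrow> K * real M powr \<alpha> \<le> L * real M powr \<beta>"
  shows "\<alpha> \<le> \<beta>"
proof (rule ccontr)
  assume "\<not> \<alpha> \<le> \<beta>"
  then have d: "0 < \<alpha> - \<beta>" by simp
  define t where "t = (\<bar>L / K\<bar> + 1) powr (1 / (\<alpha> - \<beta>))"
  obtain M :: nat where M: "max 1 t \<le> real M" using real_arch_simple by blast
  then have M1: "1 \<le> M" "0 < real M" by auto
  have "L / K < (\<bar>L / K\<bar> + 1)" by linarith
  also have "\<dots> = t powr (\<alpha> - \<beta>)" using d by (simp add: t_def powr_powr)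
  also have "\<dots> \<le> real M powr (\<alpha> - \<beta>)" using M d by (intro powr_mono2) (auto simp: t_def)
  also have "\<dots> = real M powr \<alpha> / real M powr \<beta>" by (simp add: powr_diff)
  finally have "L * real M powr \<beta> < K * real M powr \<alpha>"
    using K M1 by (simp add: field_simps)
  then show False using le[OF M1(1)] by simp
qed

text \<open>Both bounds have the same order of growth, which is what identifies the exponent. The
  upper bound on each block is strict so that a representation of cost hi exists.\<close>

lemma (in tensor_factors) block_diagonal_growth:
  fixes u :: "nat \<Rightarrow> ('i \<Rightarrow> nat) \<Rightarrow> 'k::real_normed_field"
  assumes A: "A \<noteq> {}" and I: "disjoint_family_on I {..<M}"
    and u: "\<And>n. n < M \<Longrightarrow> u n \<in> tset p A"
    and supp: "\<And>n k. n < M \<Longrightarrow> u n k \<noteq> 0 \<Longrightarrow> \<forall>i\<in>A. k i \<in> I n"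
    and bounds: "\<And>n. n < M \<Longrightarrow> lo \<le> ptn p A (u n)" "\<And>n. n < M \<Longrightarrow> ptn p A (u n) < hi"
    and lohi: "0 \<le> lo" "0 \<le> hi"
  shows "lo * real M powr (1 / r_exponent p A) \<le> ptn p A (\<lambda>k. \<Sum>n<M. u n k)"
    and "ptn p A (\<lambda>k. \<Sum>n<M. u n k) \<le> hi * real M powr (1 / r_exponent p A)"
proof -
  define r where "r = r_exponent p A"
  have r: "1 \<le> r" unfolding r_def by (rule r_exponent_ge_1[OF finite_A A p_pos])
  have root: "(real M * t powr r) powr (1 / r) = t * real M powr (1 / r)" if "0 \<le> t" for t
    using that r by (simp add: powr_mult powr_powr)
  have box: "of_bool (\<forall>i\<in>A. k i \<in> I n) * u m k = (if m = n then u n k else 0)" if "n < M" "m < M" for k m n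
  proof (cases "m = n \<or> u m k = 0")
    case True
    then show ?thesis using supp[OF that(1), of k] by (cases "u n k = 0") auto
  next
    case False
    obtain i where i: "i \<in> A" using A by blast
    then have "k i \<in> I m" using supp[OF that(2), of k] False by blast
    then have "k i \<notin> I n" using I that False by (auto simp: disjoint_family_on_def)
    then show ?thesis using False i by auto
  qed
  have boxsum: "(\<lambda>k. of_bool (\<forall>i\<in>A. k i \<in> I n) * (\<Sum>m<M. u m k)) = u n" if "n < M" for n
    using that by (simp add: sum_distrib_left box)
  show "lo * real M powr (1 / r_exponent p A) \<le> ptn p A (\<lambda>k. \<Sum>n<M. u n k)"
  proof (rule ptn_leI)
    show "(\<lambda>k. \<Sum>n<M. u n k) \<in> tset p A" using u by (intro tset_sum) auto
    fix s assume s: "trep p A (\<lambda>k. \<Sum>n<M. u n k) s"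
    have "real M * lo powr r = (\<Sum>n<M. lo powr r)" by simp
    also have "\<dots> \<le> (\<Sum>n<M. ptn p A (u n) powr r)"
      using bounds lohi r by (intro sum_mono powr_mono2) auto
    also have "\<dots> = (\<Sum>n\<in>{..<M}. ptn p A (\<lambda>k. of_bool (\<forall>i\<in>A. k i \<in> I n) * (\<Sum>m<M. u m k)) powr r)"
      by (intro sum.cong) (auto simp: boxsum)
    also have "\<dots> \<le> s powr r"
      using sum_ptn_box_le[OF s A _ I] by (simp add: r_def)
    finally have "(real M * lo powr r) powr (1 / r) \<le> (s powr r) powr (1 / r)"
      using r by (intro powr_mono2) auto
    then show "lo * real M powr (1 / r_exponent p A) \<le> s"
      using r trep_nonneg[OF s] lohi by (simp add: root powr_powr flip: r_def)
  qed
  have "trep p A (\<lambda>k. \<Sum>n\<in>{..<M}. u n k) ((\<Sum>n\<in>{..<M}. hi powr r_exponent p A) powr (1 / r_exponent p A))"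
    using bounds(2) u by (intro trep_block_diagonal[OF A _ I _ supp] trep_ptn_less) auto
  from ptn_le[OF this] show "ptn p A (\<lambda>k. \<Sum>n<M. u n k) \<le> hi * real M powr (1 / r_exponent p A)"
    using lohi by (simp add: root flip: r_def)
qed

text \<open>The empty tensor product is the scalar field; this is the base of the descent on
  A.\<close>

lemma trep_empty_const: "trep p {} u s \<Longrightarrow> u k = u k'"
  by (induction rule: trep.induct) (auto simp: tens_def)

lemma comb_tset: "(\<And>n. v n \<in> tset p A) \<Longrightarrow> comb v a \<in> tset p A"
  unfolding comb_def by (intro tset_sum tset_scale)

text \<open>If some slice of the sequence is not strictly singular, one factor can be dropped. Otherwise all
  slices vanish along suitable normalised blocks, whose images are therefore almost block diagonal.\<close>

theorem basis_equivalence_exponent: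
  fixes v :: "nat \<Rightarrow> ('i \<Rightarrow> nat) \<Rightarrow> 'k::real_normed_field"
  assumes "finite A" and q: "1 \<le> q" and "\<And>i. i \<in> A \<Longrightarrow> 1 \<le> p i"
    and "\<And>n. v n \<in> tset p A" and "0 < c"
    and "\<And>a. a \<in> c00 \<Longrightarrow> c * lnorm q a \<le> ptn p A (comb v a)"
    and "\<And>a. a \<in> c00 \<Longrightarrow> ptn p A (comb v a) \<le> C * lnorm q a"
  shows "\<exists>B. B \<noteq> {} \<and> B \<subseteq> A \<and> q = r_exponent p B"
  using assms(1,3-)
proof (induction A arbitrary: v c rule: finite_psubset_induct)
  case (psubset A)
  note v = psubset.prems(2) and c = psubset.prems(3) and lower = psubset.prems(4) and upper = psubset.prems(5)
  interpret tensor_factors p A by unfold_locales (use psubset in auto)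
  have q0: "0 < q" using q by simp
  have vt: "comb v a \<in> tset p A" for a by (rule comb_tset[OF v])
  have C: "c \<le> C" using lower[OF unit_c00[of 0]] upper[OF unit_c00[of 0]] lnorm_unit[OF q0, of 0, where 'k = 'k]
    by simp
  define s where "s i j a = ptn p (A - {i}) (\<lambda>k. comb v a (k(i := j)))" for i j a
  show ?case
  proof (cases "A = {}")
    case True
    have const: "comb v a k = comb v a k'" for a k k'
      using vt[of a] True trep_empty_const[of p "comb v a"] by (auto simp: tset_def)
    define k0 :: "'i \<Rightarrow> nat" where "k0 = (\<lambda>_. 0)"
    \<comment> \<open>Any two elements of a one-dimensional space are dependent, so some non-zero
      combination of the first two unit vectors is annihilated, against the lower bound.\<close>
    obtain a where a: "a \<in> c00" "a \<noteq> (\<lambda>n. 0)" "comb v a k0 = 0"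
    proof (cases "v 0 k0 = 0")
      case True
      moreover have "unit_seq 0 \<noteq> (\<lambda>n. 0 :: 'k)" by (auto simp: unit_seq_def fun_eq_iff)
      ultimately show ?thesis by (intro that[of "unit_seq 0"]) (auto simp: unit_c00 comb_unit)
    next
      case False
      define d where "d = - v 0 k0"
      define a where "a = (\<lambda>n. v 1 k0 * unit_seq 0 n + d * unit_seq 1 n)"
      have "comb v a k0 = 0"
        unfolding a_def using unit_c00
        by (subst comb_add) (auto intro: c00_scale simp: comb_scale comb_unit, simp add: d_def)
      moreover have "a 1 \<noteq> 0" using False by (simp add: a_def d_def unit_seq_def)
      moreover have "a \<in> c00" unfolding a_def by (intro c00_add c00_scale unit_c00)
      ultimately show ?thesis using that[of a] by auto
    qed
    then have "comb v a = (\<lambda>k. 0)" using const[of a _ k0] by auto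
    then have "c * lnorm q a \<le> 0" using lower[OF a(1)] by simp
    then have "lnorm q a = 0" using c lnorm_nonneg[of q a] by (simp add: mult_le_0_iff)
    then show ?thesis using a lnorm_eq_0_iff[OF q0 c00_lspace[OF a(1) q0]] by simp
  next
    case ne: False
    have slice: "(\<lambda>k. comb v a (k(i := j))) \<in> tset p (A - {i})"
      "s i j a \<le> ptn p A (comb v a)" if "i \<in> A" for i j a
      using ptn_slice[OF that vt, of a j] by (auto simp: s_def)
    show ?thesis
    proof (cases "\<exists>i\<in>A. \<exists>j. \<not> strictly_singular q (s i j)")
      case True
      then obtain i j where i: "i \<in> A" and "\<not> strictly_singular q (s i j)" by blast
      then obtain z \<delta> where z: "dseq q z" "0 < \<delta>" and \<delta>: "\<And>a. a \<in> c00 \<Longrightarrow> lnorm q a = 1 \<Longrightarrow> \<delta> \<le> s i j (comb z a)"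
        unfolding strictly_singular_def by (auto simp: not_less)
      \<comment> \<open>On the span of z the slice is bounded below by \<delta>, and slicing is
        contractive; hence the new sequence is again equivalent to the l_q basis, with one factor
        fewer.\<close>
      define v' where "v' n = (\<lambda>k. comb v (z n) (k(i := j)))" for n
      have v': "comb v' a = (\<lambda>k. comb v (comb z a) (k(i := j)))" if "a \<in> c00" for a
        using comb_comb[OF that dseqD(1)[OF z(1)], of v] by (simp add: v'_def comb_def fun_eq_iff)
      have ptn_v': "ptn p (A - {i}) (comb v' a) = s i j (comb z a)" if "a \<in> c00" for a
        using v'[OF that] by (simp add: s_def)
      have "\<exists>B. B \<noteq> {} \<and> B \<subseteq> A - {i} \<and> q = r_exponent p B"
      proof (rule psubset.IH)
        show "A - {i} \<subset> A" using i by blast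
        show "1 \<le> p k" if "k \<in> A - {i}" for k using that psubset.prems(1) by blast
        show "v' n \<in> tset p (A - {i})" for n unfolding v'_def by (rule slice(1)[OF i])
        show "0 < \<delta>" by (rule z(2))
        show "ptn p (A - {i}) (comb v' a) \<le> C * lnorm q a" if a: "a \<in> c00" for a
          using slice(2)[OF i, of j "comb z a"] upper[OF comb_c00[of z a]] dseqD[OF z(1)]
            lnorm_comb[OF q0 z(1) a] ptn_v'[OF a] by simp
        show "\<delta> * lnorm q a \<le> ptn p (A - {i}) (comb v' a)" if a: "a \<in> c00" for a
        proof (cases "lnorm q a = 0")
          case True
          then show ?thesis using ptn_nonneg[OF slice(1)[OF i, of "comb z a" j]] v'[OF a] by simp
        next
          case False
          define t where "t = lnorm q a"
          have t: "0 < t" using False lnorm_nonneg[of q a] unfolding t_def by linarith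
          define a' where "a' = (\<lambda>n. inverse (of_real t) * a n)"
          have a': "a' \<in> c00" unfolding a'_def by (rule c00_scale[OF a])
          have "lnorm q a' = 1"
            unfolding a'_def lnorm_scale[OF q0 c00_lspace[OF a q0]] using t by (simp add: norm_inverse t_def)
          from \<delta>[OF a' this] have "\<delta> \<le> ptn p (A - {i}) (comb v' a')" by (simp add: ptn_v'[OF a'])
          also have "comb v' a' = (\<lambda>k. inverse (of_real t) * comb v' a k)"
            unfolding a'_def by (rule comb_scale)
          also have "ptn p (A - {i}) \<dots> = inverse t * ptn p (A - {i}) (comb v' a)"
            using slice(1)[OF i] v'[OF a] t by (subst ptn_scale) (auto simp: norm_inverse)
          finally show ?thesis using t by (simp add: t_def field_simps)
        qed
      qed
      then show ?thesis by blast
    next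
      case False
      then have ss: "strictly_singular q (s i j)" if "i \<in> A" for i j using that by blast
      have semi: "csemi (s i j)" if i: "i \<in> A" for i j
        unfolding csemi_def s_def
        using ptn_triangle[OF slice(1)[OF i] slice(1)[OF i]] ptn_scale[OF slice(1)[OF i]] ptn_nonneg[OF slice(1)[OF i]]
        by (simp add: comb_add comb_scale)
      define r where "r = r_exponent p A"
      have growth: "c / 2 * real M powr (1 / q) \<le> (C + c) * real M powr (1 / r) \<and>
          c / 2 * real M powr (1 / r) \<le> (C + c) * real M powr (1 / q)" if M: "1 \<le> M" for M :: nat
      proof -
        \<comment> \<open>M is fixed before the blocks are chosen. Each of the M blocks will be
          moved by at most \<open>2 * \<epsilon>\<close>, which adds up to \<open>c / 2\<close>,
          half of the lower constant.\<close>
        define \<epsilon> where "\<epsilon> = c / (4 * real M)"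
        have \<epsilon>: "0 < \<epsilon>" using c M by (simp add: \<epsilon>_def)
        have M\<epsilon>: "real M * (2 * \<epsilon>) = c / 2" using M by (simp add: \<epsilon>_def)
        have \<epsilon>c: "2 * \<epsilon> \<le> c / 2" using M c by (simp add: \<epsilon>_def field_simps)
        let ?out = "\<lambda>m u k. of_bool (\<not> (\<forall>i\<in>A. k i < m)) * (u k :: 'k)"
        have ex: "\<exists>a J'. a \<in> c00 \<and> lnorm q a = 1 \<and> (\<forall>m<J. a m = 0) \<and> J \<le> J' \<and> (\<forall>m\<ge>J'. a m = 0) \<and>
            ((\<Sum>(i, j)\<in>A \<times> {..<J}. s i j a) < \<epsilon> \<and> ptn p A (?out J' (comb v a)) < \<epsilon>)" for J :: nat
        proof -
          \<comment> \<open>Only the finitely many slices at positions below J have to be small, so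
            the sum of their seminorms is still strictly singular. The right end of the window is
            chosen afterwards, from the vanishing tail of the image.\<close>
          have "strictly_singular q (\<lambda>a. \<Sum>ij\<in>A \<times> {..<J}. s (fst ij) (snd ij) a)"
            using finite_A ss semi by (intro strictly_singular_sum[OF q0]) auto
          from strictly_singular_tail[OF q0 this dseq_unit[OF q0 inj_on_id] \<epsilon>, of J]
          obtain a where a: "a \<in> c00" "lnorm q a = 1" "\<forall>m<J. a m = 0"
            and small: "(\<Sum>ij\<in>A \<times> {..<J}. s (fst ij) (snd ij) (comb (\<lambda>n. unit_seq (id n)) a)) < \<epsilon>" by blast
          have "comb (\<lambda>n. unit_seq (id n)) a = a"
            using comb_unit_seq[OF a(1)] by (simp add: id_def)
          then have small: "(\<Sum>(i, j)\<in>A \<times> {..<J}. s i j a) < \<epsilon>"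
            using small by (simp add: case_prod_unfold)
          have "eventually (\<lambda>m. ptn p A (?out m (comb v a)) < \<epsilon>) sequentially"
            using ptn_tail_tendsto_0[OF vt, of a] \<epsilon> by (intro order_tendstoD) auto
          then obtain K where K: "\<And>m. m \<ge> K \<Longrightarrow> ptn p A (?out m (comb v a)) < \<epsilon>"
            by (auto simp: eventually_sequentially)
          obtain L where "\<forall>m\<in>{n. a n \<noteq> 0}. m < L"
            using a(1) finite_nat_set_iff_bounded[of "{n. a n \<noteq> 0}"] by (auto simp: c00_def)
          then have "\<forall>m\<ge>max J (max K L). a m = 0" by force
          then show ?thesis
            using a small K[of "max J (max K L)"] by (intro exI[of _ a] exI[of _ "max J (max K L)"]) auto
        qed
        obtain b J where b: "dseq q b" and J: "incseq J"
          and bJ: "\<And>n::nat. (\<Sum>(i, j)\<in>A \<times> {..<J n}. s i j (b n)) < \<epsilon> \<and> ptn p A (?out (J (Suc n)) (comb v (b n))) < \<epsilon>"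
          by (rule block_selection[where P = "\<lambda>n J a J'. (\<Sum>(i, j)\<in>A \<times> {..<J}. s i j a) < \<epsilon> \<and>
                ptn p A (?out J' (comb v a)) < \<epsilon>", OF ex]) (rule that)
        note small = conjunct1[OF bJ] and tail = conjunct2[OF bJ]
        define u where "u n = comb v (b n)" for n
        define I where "I n = {J n..<J (Suc n)}" for n
        define u' where "u' n = (\<lambda>k. of_bool (\<forall>i\<in>A. k i \<in> I n) * u n k)" for n
        have ut: "u n \<in> tset p A" for n unfolding u_def by (rule vt)
        have u't: "u' n \<in> tset p A" "ptn p A (u' n) \<le> ptn p A (u n)" for n
          using cmult_tset[OF cmult_box[OF subset_refl] ut[of n], of "\<lambda>_. I n"]
            cmult_ptn[OF cmult_box[OF subset_refl] ut[of n], of "\<lambda>_. I n"] by (auto simp: u'_def)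
        \<comment> \<open>A multi-index off the block either has a coordinate beyond the window, or
          lies before its right end with some coordinate before its left end. The first part is the
          tail, the second is bounded by slices, and each has norm below \<epsilon>.\<close>
        have near: "ptn p A (\<lambda>k. u n k - u' n k) \<le> 2 * \<epsilon>" for n
        proof -
          let ?Y = "\<lambda>k. of_bool (\<forall>i\<in>A. k i \<in> {..<J (Suc n)}) :: 'k"
          let ?w = "\<lambda>k. of_bool (\<not> (\<forall>i\<in>A. k i \<in> {J n..})) * u n k"
          have w: "?w \<in> tset p A" "ptn p A ?w \<le> (\<Sum>i\<in>A. ptn p A (\<lambda>k. of_bool (k i \<notin> {J n..}) * u n k))"
            by (rule conjunct1[OF ptn_outside_box_le[OF ut subset_refl]],
                rule conjunct2[OF ptn_outside_box_le[OF ut subset_refl]])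
          have Y: "(\<lambda>k. ?Y k * ?w k) \<in> tset p A" "ptn p A (\<lambda>k. ?Y k * ?w k) \<le> ptn p A ?w"
            by (rule cmult_tset[OF cmult_box[OF subset_refl] w(1)], rule cmult_ptn[OF cmult_box[OF subset_refl] w(1)])
          have out: "?out (J (Suc n)) (u n) \<in> tset p A"
            using ptn_outside_box_le[OF ut[of n] subset_refl, of "\<lambda>_. {..<J (Suc n)}"] by simp
          have eq: "(\<lambda>k. u n k - u' n k) = (\<lambda>k. ?out (J (Suc n)) (u n) k + ?Y k * ?w k)"
          proof
            fix k
            have "(\<forall>i\<in>A. k i \<in> I n) \<longleftrightarrow> (\<forall>i\<in>A. k i < J (Suc n)) \<and> (\<forall>i\<in>A. k i \<in> {J n..})"
              by (auto simp: I_def)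
            then show "u n k - u' n k = ?out (J (Suc n)) (u n) k + ?Y k * ?w k"
              by (auto simp: u'_def)
          qed
          have "ptn p A (\<lambda>k. of_bool (k i \<notin> {J n..}) * u n k) \<le> (\<Sum>j<J n. s i j (b n))" if i: "i \<in> A" for i
          proof -
            have eq: "(\<lambda>k. of_bool (k i \<notin> {J n..}) * u n k) = (\<lambda>k. \<Sum>j<J n. of_bool (k i = j) * u n k)"
              by (auto simp: fun_eq_iff not_le sum_distrib_right[symmetric] of_bool_def)
            have coord: "(\<lambda>k. of_bool (k i = j) * u n k) \<in> tset p A" for j
              using cmult_tset[OF cmult_coord[OF i, of "\<lambda>n. of_bool (n = j)"] ut[of n]] by simp
            have "ptn p A (\<lambda>k. of_bool (k i = j) * u n k) \<le> s i j (b n)" for j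
              using ptn_coord_le_slice[OF i ut[of n], of j] by (simp add: s_def u_def)
            then show ?thesis unfolding eq by (intro order_trans[OF ptn_sum[OF finite_lessThan coord] sum_mono])
          qed
          then have "ptn p A ?w \<le> (\<Sum>i\<in>A. \<Sum>j<J n. s i j (b n))"
            using w(2) by (meson order_trans sum_mono)
          also have "\<dots> < \<epsilon>" using small[of n] by (simp add: sum.cartesian_product)
          finally show ?thesis
            unfolding eq using ptn_triangle[OF out Y(1)] Y(2) tail[of n] by (simp add: u_def)
        qed
        have u_bounds: "c \<le> ptn p A (u n)" "ptn p A (u n) \<le> C" for n
          using lower[OF dseqD(1)[OF b], of n] upper[OF dseqD(1)[OF b], of n] dseqD(2)[OF b] by (auto simp: u_def)
        define U where "U = (\<lambda>k. \<Sum>n<M. u n k)"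
        define U' where "U' = (\<lambda>k. \<Sum>n<M. u' n k)"
        have Ut: "U \<in> tset p A" "U' \<in> tset p A" unfolding U_def U'_def using ut u't by (auto intro!: tset_sum)
        have disj: "disjoint_family_on I {..<M}"
          unfolding disjoint_family_on_def
        proof (intro ballI impI)
          fix m n :: nat assume "m \<noteq> n"
          then consider "Suc m \<le> n" | "Suc n \<le> m" by linarith
          then show "I m \<inter> I n = {}"
            using incseqD[OF J, of "Suc m" n] incseqD[OF J, of "Suc n" m] by cases (auto simp: I_def)
        qed
        have u'_lower: "c / 2 \<le> ptn p A (u' n)" for n
          using ptn_diff_le[OF ut u't(1), of n n] near[of n] u_bounds[of n] \<epsilon>c by simp
        have u'_upper: "ptn p A (u' n) < C + c" for n
          using u't(2)[of n] u_bounds[of n] c by simp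
        have supp: "\<forall>i\<in>A. k i \<in> I n" if "u' n k \<noteq> 0" for n k
          using that by (auto simp: u'_def split: if_splits)
        have "0 \<le> c / 2" "0 \<le> C + c" using c C by auto
        note blocks = block_diagonal_growth[where u = u', OF ne disj u't(1) supp u'_lower u'_upper this,
            folded U'_def r_def]
        have diff: "ptn p A (\<lambda>k. U k - U' k) \<le> c / 2"
        proof -
          have "ptn p A (\<lambda>k. \<Sum>n\<in>{..<M}. u n k - u' n k) \<le> (\<Sum>n\<in>{..<M}. ptn p A (\<lambda>k. u n k - u' n k))"
            using ut u't by (intro ptn_sum tset_diff) auto
          also have "\<dots> \<le> (\<Sum>n\<in>{..<M}. 2 * \<epsilon>)" by (rule sum_mono[OF near])
          finally show ?thesis using M\<epsilon> by (simp add: U_def U'_def sum_subtractf)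
        qed
        \<comment> \<open>The sum of the first M blocks has l_q norm
          \<open>real M powr (1 / q)\<close>, since the blocks are disjoint and normalised.\<close>
        define a :: "nat \<Rightarrow> 'k" where "a n = of_bool (n < M)" for n
        have supp_a: "a n = 0" if "n \<notin> {..<M}" for n using that by (simp add: a_def)
        have a: "a \<in> c00" using supp_a finite_subset[of "{n. a n \<noteq> 0}" "{..<M}"] by (auto simp: c00_def)
        have "lnorm q a powr q = real M"
          using lnorm_powr_c00[of q "{..<M}" a, OF q0 finite_lessThan supp_a] by (simp add: a_def)
        then have norm_a: "lnorm q a = real M powr (1 / q)"
          using q0 powr_powr[of "lnorm q a" q "1 / q"] by simp
        have "U = comb v (comb b a)"
          unfolding comb_comb[OF a dseqD(1)[OF b]]
          using comb_eq[of "{..<M}" a "\<lambda>n. comb v (b n)", OF finite_lessThan supp_a]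
          by (simp add: U_def u_def a_def)
        then have Ub: "c * real M powr (1 / q) \<le> ptn p A U" "ptn p A U \<le> C * real M powr (1 / q)"
          using lower[of "comb b a"] upper[of "comb b a"] comb_c00[of b a] dseqD[OF b]
            lnorm_comb[OF q0 b a] norm_a by auto
        \<comment> \<open>The additive perturbation \<open>c / 2\<close> is thereby absorbed, by
          half of the lower bound on the one side and by the slack in \<open>C + c\<close> on the
          other.\<close>
        have "1 \<le> real M powr (1 / q)" using M q by (simp add: ge_one_powr_ge_zero)
        then have "c / 2 * 1 \<le> c / 2 * real M powr (1 / q)" using c by (intro mult_left_mono) auto
        moreover have "ptn p A U \<le> ptn p A U' + c / 2" "ptn p A U' \<le> ptn p A U + c / 2"
          using ptn_diff_le[OF Ut] ptn_diff_le[OF Ut(2,1)] ptn_minus_commute[OF Ut] diff by auto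
        ultimately show ?thesis using Ub blocks by (simp add: algebra_simps)
      qed
      \<comment> \<open>The blocks depend on M, but the constants in \<open>growth\<close> do not,
        so the two orders of growth can be compared.\<close>
      have "1 / q \<le> 1 / r" "1 / r \<le> 1 / q"
        by (rule powr_growth_le[OF half_gt_zero[OF c] conjunct1[OF growth]], assumption,
            rule powr_growth_le[OF half_gt_zero[OF c] conjunct2[OF growth]], assumption)
      then have "1 / q = 1 / r" by simp
      then have "q = r" by simp
      then show ?thesis using ne by (auto simp: r_def)
    qed
  qed
qed

section \<open>Normed spaces on carriers\<close>

text \<open>Negatives are scalings by -1; the law for scaling by 0 is what makes
  \<open>vdiff V x x\<close> the zero vector.\<close>

locale vector_nspace =
  fixes V :: "('k::real_normed_field, 'v) nspace"
  assumes add_closed: "x \<in> elems V \<Longrightarrow> y \<in> elems V \<Longrightarrow> vadd V x y \<in> elems V"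
    and scale_closed: "x \<in> elems V \<Longrightarrow> vscale V c x \<in> elems V"
    and zero_closed: "vzero V \<in> elems V"
    and add_assoc: "x \<in> elems V \<Longrightarrow> y \<in> elems V \<Longrightarrow> z \<in> elems V \<Longrightarrow>
          vadd V (vadd V x y) z = vadd V x (vadd V y z)"
    and add_commute: "x \<in> elems V \<Longrightarrow> y \<in> elems V \<Longrightarrow> vadd V x y = vadd V y x"
    and add_zero: "x \<in> elems V \<Longrightarrow> vadd V x (vzero V) = x"
    and scale_add_right: "x \<in> elems V \<Longrightarrow> y \<in> elems V \<Longrightarrow>
          vscale V c (vadd V x y) = vadd V (vscale V c x) (vscale V c y)"
    and scale_add_left: "x \<in> elems V \<Longrightarrow> vscale V (c + d) x = vadd V (vscale V c x) (vscale V d x)"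
    and scale_scale: "x \<in> elems V \<Longrightarrow> vscale V c (vscale V d x) = vscale V (c * d) x"
    and scale_one: "x \<in> elems V \<Longrightarrow> vscale V 1 x = x"
    and scale_zero: "x \<in> elems V \<Longrightarrow> vscale V 0 x = vzero V"
begin

lemma diff_closed: "x \<in> elems V \<Longrightarrow> y \<in> elems V \<Longrightarrow> vdiff V x y \<in> elems V"
  by (simp add: vdiff_def add_closed scale_closed)

lemma zero_add: "x \<in> elems V \<Longrightarrow> vadd V (vzero V) x = x"
  using add_commute add_zero zero_closed by metis

lemma diff_self: "x \<in> elems V \<Longrightarrow> vdiff V x x = vzero V"
  using scale_add_left[of x 1 "-1"] by (simp add: vdiff_def scale_one scale_zero)

lemma diff_add: "x \<in> elems V \<Longrightarrow> y \<in> elems V \<Longrightarrow> vadd V (vdiff V x y) y = x"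
  using scale_add_left[of y "-1" 1, symmetric]
  by (simp add: vdiff_def add_assoc scale_closed scale_one scale_zero add_zero)

lemma diff_eq_zeroD: "x \<in> elems V \<Longrightarrow> y \<in> elems V \<Longrightarrow> vdiff V x y = vzero V \<Longrightarrow> x = y"
  using diff_add zero_add by metis

lemma add_interchange:
  assumes "x \<in> elems V" "y \<in> elems V" "z \<in> elems V" "w \<in> elems V"
  shows "vadd V (vadd V x y) (vadd V z w) = vadd V (vadd V x z) (vadd V y w)"
proof -
  have "vadd V y (vadd V z w) = vadd V z (vadd V y w)"
    using assms add_commute[of y z] by (metis add_assoc)
  then show ?thesis using assms by (simp add: add_assoc add_closed)
qed

lemma diff_add_add:
  assumes "x \<in> elems V" "y \<in> elems V" "z \<in> elems V" "w \<in> elems V"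
  shows "vdiff V (vadd V x y) (vadd V z w) = vadd V (vdiff V x z) (vdiff V y w)"
  using assms add_interchange[of x y "vscale V (-1) z" "vscale V (-1) w"]
  by (simp add: vdiff_def scale_add_right scale_closed)

lemma diff_scale:
  assumes "x \<in> elems V" "y \<in> elems V"
  shows "vdiff V (vscale V c x) (vscale V c y) = vscale V c (vdiff V x y)"
  using assms by (simp add: vdiff_def scale_add_right scale_closed scale_scale)

lemma diff_swap:
  assumes "x \<in> elems V" "y \<in> elems V"
  shows "vdiff V y x = vscale V (-1) (vdiff V x y)"
  using assms add_commute[of y "vscale V (-1) x"]
  by (simp add: vdiff_def scale_add_right scale_closed scale_scale scale_one)

lemma diff_trans:
  assumes "x \<in> elems V" "y \<in> elems V" "z \<in> elems V"
  shows "vdiff V x z = vadd V (vdiff V x y) (vdiff V y z)"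
proof -
  have "vadd V (vdiff V x y) (vdiff V y z) = vadd V (vadd V (vdiff V x y) y) (vscale V (-1) z)"
    using assms by (simp add: vdiff_def[of V y z] add_assoc diff_closed scale_closed)
  then show ?thesis using assms by (simp add: diff_add) (simp add: vdiff_def)
qed

end

locale seminormed_nspace = vector_nspace V for V :: "('k::real_normed_field, 'v) nspace" +
  assumes norm_nonneg: "x \<in> elems V \<Longrightarrow> 0 \<le> vnorm V x"
    and norm_scale: "x \<in> elems V \<Longrightarrow> vnorm V (vscale V c x) = norm c * vnorm V x"
    and norm_triangle: "x \<in> elems V \<Longrightarrow> y \<in> elems V \<Longrightarrow> vnorm V (vadd V x y) \<le> vnorm V x + vnorm V y"
begin

lemma norm_zero: "vnorm V (vzero V) = 0"
  using norm_scale[OF zero_closed, of 0] scale_zero[OF zero_closed] by simp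

lemma norm_diff_commute: "x \<in> elems V \<Longrightarrow> y \<in> elems V \<Longrightarrow> vnorm V (vdiff V y x) = vnorm V (vdiff V x y)"
  by (simp add: diff_swap[of x y] norm_scale diff_closed)

lemma norm_diff_triangle:
  "x \<in> elems V \<Longrightarrow> y \<in> elems V \<Longrightarrow> z \<in> elems V \<Longrightarrow>
    vnorm V (vdiff V x z) \<le> vnorm V (vdiff V x y) + vnorm V (vdiff V y z)"
  by (simp add: diff_trans[of x y z] norm_triangle diff_closed)

lemma norm_le_diff: "x \<in> elems V \<Longrightarrow> y \<in> elems V \<Longrightarrow> vnorm V x \<le> vnorm V y + vnorm V (vdiff V x y)"
  using norm_triangle[of "vdiff V x y" y] by (simp add: diff_add diff_closed)

lemma abs_norm_diff_le:
  assumes "x \<in> elems V" "y \<in> elems V"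
  shows "\<bar>vnorm V x - vnorm V y\<bar> \<le> vnorm V (vdiff V x y)"
  using norm_le_diff[OF assms] norm_le_diff[OF assms(2,1)] norm_diff_commute[OF assms] by linarith

lemma norm_diff_add_add:
  assumes "x \<in> elems V" "y \<in> elems V" "z \<in> elems V" "w \<in> elems V"
  shows "vnorm V (vdiff V (vadd V x y) (vadd V z w)) \<le> vnorm V (vdiff V x z) + vnorm V (vdiff V y w)"
  using assms by (simp add: diff_add_add norm_triangle diff_closed)

end

locale normed_nspace = seminormed_nspace V for V :: "('k::real_normed_field, 'v) nspace" +
  assumes norm_eq_zeroD: "x \<in> elems V \<Longrightarrow> vnorm V x = 0 \<Longrightarrow> x = vzero V"

sublocale normed_nspace \<subseteq> M: Metric_space "elems V" "vdist V"
proof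
  show "0 \<le> vdist V x y" for x y by (simp add: vdist_def norm_nonneg diff_closed)
  show "vdist V x y = vdist V y x" for x y using norm_diff_commute by (auto simp: vdist_def)
  show "vdist V x y = 0 \<longleftrightarrow> x = y" if "x \<in> elems V" "y \<in> elems V" for x y
    using that diff_self[of x] norm_zero norm_eq_zeroD[OF diff_closed[OF that]] diff_eq_zeroD[OF that]
    by (auto simp: vdist_def)
  show "vdist V x z \<le> vdist V x y + vdist V y z" if "x \<in> elems V" "y \<in> elems V" "z \<in> elems V" for x y z
    using that norm_diff_triangle by (auto simp: vdist_def)
qed

lemma (in normed_nspace) dist_zero: "x \<in> elems V \<Longrightarrow> vdist V (vzero V) x = vnorm V x"
  using M.commute[of "vzero V" x] zero_closed scale_zero[OF zero_closed] scale_scale[OF zero_closed, of "-1" 0]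
  by (simp add: vdist_def vdiff_def add_zero)

subsection \<open>Embeddings\<close>

lemma linear_map_onD:
  assumes "linear_map_on V W T"
  shows "x \<in> elems V \<Longrightarrow> T x \<in> elems W"
    and "x \<in> elems V \<Longrightarrow> y \<in> elems V \<Longrightarrow> T (vadd V x y) = vadd W (T x) (T y)"
    and "x \<in> elems V \<Longrightarrow> T (vscale V c x) = vscale W c (T x)"
  using assms by (auto simp: linear_map_on_def)

text \<open>Continuity at zero gives the upper bound and openness onto the range the lower one;
  homogeneity carries both from a ball to the whole space.\<close>

lemma embeds_into_bounds:
  fixes V :: "('k::real_normed_field, 'v) nspace" and W :: "('k, 'w) nspace"
  assumes V: "normed_nspace V" and W: "normed_nspace W" and emb: "embeds_into V W"
  obtains T c C where "linear_map_on V W T" "0 < c"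
    "\<And>x. x \<in> elems V \<Longrightarrow> c * vnorm V x \<le> vnorm W (T x)"
    "\<And>x. x \<in> elems V \<Longrightarrow> vnorm W (T x) \<le> C * vnorm V x"
proof -
  interpret V: normed_nspace V by (rule V)
  interpret W: normed_nspace W by (rule W)
  obtain T where T: "linear_map_on V W T"
    and homeo: "homeomorphic_map V.M.mtopology (subtopology W.M.mtopology (T ` elems V)) T"
    using emb by (auto simp: embeds_into_def norm_topology_def)
  note Tin = linear_map_onD(1)[OF T] and Tscale = linear_map_onD(3)[OF T]
  have T0: "T (vzero V) = vzero W"
    using Tscale[OF V.zero_closed, of 0] V.scale_zero[OF V.zero_closed] W.scale_zero[OF Tin[OF V.zero_closed]] by simp
  note distV = V.dist_zero and distW = W.dist_zero
  have "continuous_map V.M.mtopology W.M.mtopology T"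
    using homeomorphic_imp_continuous_map[OF homeo] by (rule continuous_map_into_fulltopology)
  then have "openin V.M.mtopology {x \<in> elems V. T x \<in> W.M.mball (vzero W) 1}"
    using openin_continuous_map_preimage[OF _ W.M.openin_mball, of V.M.mtopology T "vzero W" 1] by simp
  moreover have "vzero V \<in> {x \<in> elems V. T x \<in> W.M.mball (vzero W) 1}"
    using V.zero_closed W.zero_closed by (simp add: T0)
  ultimately obtain r where r: "0 < r" "V.M.mball (vzero V) r \<subseteq> {x \<in> elems V. T x \<in> W.M.mball (vzero W) 1}"
    unfolding V.M.openin_mtopology by blast
  have cont: "vnorm W (T x) < 1" if "x \<in> elems V" "vnorm V x < r" for x
  proof -
    have "x \<in> V.M.mball (vzero V) r" using that distV V.zero_closed by simp
    then have "T x \<in> W.M.mball (vzero W) 1" using r(2) by blast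
    then show ?thesis using distW[of "T x"] by simp
  qed
  have "open_map V.M.mtopology (subtopology W.M.mtopology (T ` elems V)) T"
    by (rule homeomorphic_imp_open_map[OF homeo])
  then have "openin (subtopology W.M.mtopology (T ` elems V)) (T ` V.M.mball (vzero V) 1)"
    unfolding open_map_def by blast
  then obtain U where U: "openin W.M.mtopology U" "T ` V.M.mball (vzero V) 1 = U \<inter> T ` elems V"
    unfolding openin_subtopology by blast
  have "vzero W \<in> T ` V.M.mball (vzero V) 1"
    using T0 V.zero_closed by (metis V.M.centre_in_mball_iff image_eqI zero_less_one)
  then have "vzero W \<in> U" using U by blast
  then obtain c where c: "0 < c" "W.M.mball (vzero W) c \<subseteq> U"
    using U(1) unfolding W.M.openin_mtopology by blast
  have inj: "inj_on T (elems V)" using homeomorphic_imp_injective_map[OF homeo] by simp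
  have opn: "vnorm V x < 1" if x: "x \<in> elems V" "vnorm W (T x) < c" for x
  proof -
    have "T x \<in> U" using c(2) x distW[OF Tin] Tin W.zero_closed by auto
    then have "T x \<in> T ` V.M.mball (vzero V) 1" using U(2) x by blast
    then obtain y where "y \<in> V.M.mball (vzero V) 1" "T x = T y" by blast
    then show ?thesis using inj x distV by (auto dest: inj_onD)
  qed
  have zero: "vnorm W (T x) = 0" if "x \<in> elems V" "vnorm V x = 0" for x
    using V.norm_eq_zeroD[OF that] T0 W.norm_zero by simp
  have normalise: "vnorm V (vscale V (of_real t) x) = t * vnorm V x"
    "vnorm W (T (vscale V (of_real t) x)) = t * vnorm W (T x)" if "x \<in> elems V" "0 \<le> t" for x t
    using that by (simp_all add: V.norm_scale Tscale W.norm_scale Tin)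
  show ?thesis
  proof (rule that[OF T c(1)])
    fix x assume x: "x \<in> elems V"
    show "c * vnorm V x \<le> vnorm W (T x)"
    proof (cases "vnorm V x = 0")
      case False
      then have pos: "0 < vnorm V x" using V.norm_nonneg[OF x] by simp
      define t where "t = 1 / vnorm V x"
      \<comment> \<open>At norm exactly 1 an image of norm below c is impossible, as it would force
        norm below 1.\<close>
      have t: "0 \<le> t" "t * vnorm V x = 1" using pos by (auto simp: t_def)
      then have "c \<le> t * vnorm W (T x)"
        using opn[OF V.scale_closed[OF x], of "of_real t"] normalise[OF x t(1)] by fastforce
      then show ?thesis using pos by (simp add: t_def field_simps)
    qed (use zero x in simp)
    show "vnorm W (T x) \<le> (2 / r) * vnorm V x"
    proof (cases "vnorm V x = 0")
      case False
      then have pos: "0 < vnorm V x" using V.norm_nonneg[OF x] by simp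
      \<comment> \<open>Scaling to norm \<open>r / 2\<close> lands strictly inside the ball; this is
        the origin of the constant \<open>2 / r\<close>.\<close>
      define t where "t = r / (2 * vnorm V x)"
      have t: "0 < t" "t * vnorm V x < r" using pos r by (auto simp: t_def)
      have "t * vnorm W (T x) < 1"
        using cont[OF V.scale_closed[OF x], of "of_real t"] normalise[OF x, of t] t by simp
      then show ?thesis using pos r by (simp add: t_def field_simps)
    qed (use zero x in simp)
  qed
qed

text \<open>An isometry is a homeomorphism onto its range, and completeness of V makes the range
  closed: preimages of a convergent sequence are Cauchy, and the image of their limit is the given
  limit.\<close>

lemma isometry_embeds_into:
  fixes V :: "('k::real_normed_field, 'v) nspace" and W :: "('k, 'w) nspace"
  assumes V: "normed_nspace V" and W: "normed_nspace W" and T: "linear_map_on V W T"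
    and iso: "\<And>x. x \<in> elems V \<Longrightarrow> vnorm W (T x) = vnorm V x"
    and complete: "\<And>s. cauchy_in V s \<Longrightarrow> \<exists>x\<in>elems V. (\<lambda>n. vnorm V (vdiff V (s n) x)) \<longlonglongrightarrow> 0"
  shows "embeds_into V W"
proof -
  interpret V: normed_nspace V by (rule V)
  interpret W: normed_nspace W by (rule W)
  note Tin = linear_map_onD(1)[OF T]
  let ?S = "T ` elems V"
  have sub: "?S \<subseteq> elems W" using Tin by blast
  interpret S: Submetric "elems W" "vdist W" ?S by unfold_locales (rule sub)
  have Tdiff: "T (vdiff V x y) = vdiff W (T x) (T y)" if "x \<in> elems V" "y \<in> elems V" for x y
    using that by (simp add: vdiff_def linear_map_onD[OF T] V.scale_closed)
  have dist: "vdist W (T x) (T y) = vdist V x y" if "x \<in> elems V" "y \<in> elems V" for x y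
    using that Tin by (simp add: vdist_def V.diff_closed iso flip: Tdiff)
  have ball: "T ` V.M.mball x r = S.sub.mball (T x) r" if "x \<in> elems V" for x r
    using that by (auto simp: dist)
  have inj: "inj_on T (elems V)"
  proof (rule inj_onI)
    fix x y assume xy: "x \<in> elems V" "y \<in> elems V" "T x = T y"
    then have "vdist V x y = 0" using dist[of x y] Tin by simp
    then show "x = y" using xy by simp
  qed
  have cont: "continuous_map V.M.mtopology S.sub.mtopology T"
    unfolding continuous_map_def
  proof (intro conjI allI impI)
    show "T \<in> topspace V.M.mtopology \<rightarrow> topspace S.sub.mtopology" by auto
    fix U assume "openin S.sub.mtopology U"
    then have U: "\<And>y. y \<in> U \<Longrightarrow> \<exists>r>0. S.sub.mball y r \<subseteq> U" by (simp add: S.sub.openin_mtopology)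
    show "openin V.M.mtopology {x \<in> topspace V.M.mtopology. T x \<in> U}"
      unfolding V.M.openin_mtopology
    proof (intro conjI allI impI)
      fix x assume "x \<in> {x \<in> topspace V.M.mtopology. T x \<in> U}"
      then have x: "x \<in> elems V" "T x \<in> U" by auto
      then obtain r where r: "r > 0" "S.sub.mball (T x) r \<subseteq> U" using U by blast
      then have "T ` V.M.mball x r \<subseteq> U" by (simp add: ball[OF x(1)])
      then show "\<exists>r>0. V.M.mball x r \<subseteq> {x \<in> topspace V.M.mtopology. T x \<in> U}"
        using r(1) V.M.mball_subset_mspace by (intro exI[of _ r]) auto
    qed simp
  qed
  have opn: "open_map V.M.mtopology S.sub.mtopology T"
    unfolding open_map_def
  proof (intro allI impI)
    fix U assume "openin V.M.mtopology U"
    then have U: "U \<subseteq> elems V" "\<And>x. x \<in> U \<Longrightarrow> \<exists>r>0. V.M.mball x r \<subseteq> U" by (simp_all add: V.M.openin_mtopology)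
    show "openin S.sub.mtopology (T ` U)"
      unfolding S.sub.openin_mtopology
    proof (intro conjI allI impI)
      show "T ` U \<subseteq> ?S" using U by blast
      fix y assume "y \<in> T ` U"
      then obtain x where x: "x \<in> U" "y = T x" by blast
      then obtain r where r: "r > 0" "V.M.mball x r \<subseteq> U" using U by blast
      then have "S.sub.mball y r \<subseteq> T ` U" using ball[of x r] x U(1) by blast
      then show "\<exists>r>0. S.sub.mball y r \<subseteq> T ` U" using r by blast
    qed
  qed
  have homeo: "homeomorphic_map V.M.mtopology (subtopology W.M.mtopology ?S) T"
    unfolding S.mtopology_submetric[symmetric]
    by (rule bijective_open_imp_homeomorphic_map[OF cont opn]) (use inj in simp_all)
  have "closedin W.M.mtopology ?S"
    unfolding W.M.metric_closedin_iff_sequentially_closed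
  proof (intro conjI allI impI sub, elim conjE)
    fix \<sigma> l assume \<sigma>: "range \<sigma> \<subseteq> ?S" and l: "limitin W.M.mtopology \<sigma> l sequentially"
    then have "\<forall>n. \<exists>x. x \<in> elems V \<and> \<sigma> n = T x" by blast
    then obtain s where s: "\<And>n. s n \<in> elems V" "\<And>n. \<sigma> n = T (s n)" by metis
    have lW: "l \<in> elems W" and lim: "\<And>e. 0 < e \<Longrightarrow> \<exists>N. \<forall>n\<ge>N. vdist W (\<sigma> n) l < e"
      using l unfolding W.M.limit_metric_sequentially by blast+
    have "cauchy_in V s"
      unfolding cauchy_in_def
    proof (intro conjI allI impI)
      show "range s \<subseteq> elems V" using s by blast
      fix e :: real assume "0 < e"
      then obtain N where N: "\<And>n. n \<ge> N \<Longrightarrow> vdist W (\<sigma> n) l < e / 2" using lim[of "e / 2"] by auto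
      have "vnorm V (vdiff V (s m) (s n)) < e" if "m \<ge> N" "n \<ge> N" for m n
      proof -
        have "vdist W (\<sigma> m) (\<sigma> n) \<le> vdist W (\<sigma> m) l + vdist W (\<sigma> n) l"
          using W.M.triangle[of "\<sigma> m" l "\<sigma> n"] W.M.commute[of l "\<sigma> n"] s Tin lW by simp
        then show ?thesis using N[OF that(1)] N[OF that(2)] dist[OF s(1) s(1), of m n] s by (simp add: vdist_def)
      qed
      then show "\<exists>M. \<forall>m\<ge>M. \<forall>n\<ge>M. vnorm V (vdiff V (s m) (s n)) < e" by blast
    qed
    from complete[OF this] obtain x where x: "x \<in> elems V" "(\<lambda>n. vnorm V (vdiff V (s n) x)) \<longlonglongrightarrow> 0" by blast
    have "vdist W (T x) l \<le> e" if e: "0 < e" for e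
    proof -
      obtain N where N: "\<And>n. n \<ge> N \<Longrightarrow> vdist W (\<sigma> n) l < e / 2" using lim[of "e / 2"] e by auto
      have "eventually (\<lambda>n. vnorm V (vdiff V (s n) x) < e / 2) sequentially"
        using x(2) e by (intro order_tendstoD) auto
      then obtain N' where N': "\<And>n. n \<ge> N' \<Longrightarrow> vnorm V (vdiff V (s n) x) < e / 2"
        by (auto simp: eventually_sequentially)
      define n where "n = max N N'"
      have "vdist W (T x) l \<le> vdist W (\<sigma> n) (T x) + vdist W (\<sigma> n) l"
        using W.M.triangle[of "T x" "\<sigma> n" l] W.M.commute[of "T x" "\<sigma> n"] s Tin lW x by simp
      moreover have "vdist W (\<sigma> n) (T x) = vnorm V (vdiff V (s n) x)"
        using dist[OF s(1) x(1), of n] s x by (simp add: vdist_def)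
      ultimately show ?thesis using N[of n] N'[of n] by (simp add: n_def)
    qed
    then have "vdist W (T x) l \<le> 0" by (rule dense_ge)
    then have "vdist W (T x) l = 0" by (simp add: antisym)
    then have "T x = l" using lW Tin[OF x(1)] by simp
    then show "l \<in> ?S" using x by blast
  qed
  then show ?thesis using T homeo unfolding embeds_into_def norm_topology_def by blast
qed

subsection \<open>Quotients and completions\<close>

lemma quotient_nspace_simps [simp]:
  "elems (quotient_nspace V R \<nu>) = elems V // R"
  "vzero (quotient_nspace V R \<nu>) = R `` {vzero V}"
  "vnorm (quotient_nspace V R \<nu>) = \<nu>"
  by (simp_all add: quotient_nspace_def)

locale quotient_data = vector_nspace V for V :: "('k::real_normed_field, 'v) nspace" +
  fixes R :: "('v \<times> 'v) set"
  assumes R: "equiv (elems V) R"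
    and R_add: "(x, x') \<in> R \<Longrightarrow> (y, y') \<in> R \<Longrightarrow> (vadd V x y, vadd V x' y') \<in> R"
    and R_scale: "(x, x') \<in> R \<Longrightarrow> (vscale V c x, vscale V c x') \<in> R"
begin

lemma quotient_add:
  assumes "x \<in> elems V" "y \<in> elems V"
  shows "vadd (quotient_nspace V R \<nu>) (R `` {x}) (R `` {y}) = R `` {vadd V x y}"
proof -
  have "(\<lambda>a b. R `` {vadd V a b}) respects2 R"
    by (intro congruent2I' equiv_class_eq[OF R] R_add)
  then show ?thesis
    using UN_equiv_class2[OF R R _ assms] by (simp add: quotient_nspace_def)
qed

lemma quotient_scale:
  assumes "x \<in> elems V"
  shows "vscale (quotient_nspace V R \<nu>) c (R `` {x}) = R `` {vscale V c x}"
proof -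
  have "(\<lambda>a. R `` {vscale V c a}) respects R"
    by (intro congruentI equiv_class_eq[OF R] R_scale)
  then show ?thesis
    using UN_equiv_class[OF R _ assms] by (simp add: quotient_nspace_def)
qed

lemma quotient_vector_nspace: "vector_nspace (quotient_nspace V R \<nu>)"
proof
  fix X Y Z and c d :: 'k assume "X \<in> elems (quotient_nspace V R \<nu>)"
  then obtain x where x: "x \<in> elems V" "X = R `` {x}" by (auto elim: quotientE)
  note ops = quotient_add quotient_scale add_closed scale_closed zero_closed
  let ?Q = "quotient_nspace V R \<nu>"
  show "vscale ?Q c X \<in> elems ?Q" using x by (simp add: ops quotientI)
  show "vadd ?Q X (vzero ?Q) = X" using x by (simp add: ops add_zero)
  show "vscale ?Q (c + d) X = vadd ?Q (vscale ?Q c X) (vscale ?Q d X)" using x by (simp add: ops scale_add_left)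
  show "vscale ?Q c (vscale ?Q d X) = vscale ?Q (c * d) X" using x by (simp add: ops scale_scale)
  show "vscale ?Q 1 X = X" using x by (simp add: ops scale_one)
  show "vscale ?Q 0 X = vzero ?Q" using x by (simp add: ops scale_zero)
  assume "Y \<in> elems ?Q"
  then obtain y where y: "y \<in> elems V" "Y = R `` {y}" by (auto elim: quotientE)
  show "vadd ?Q X Y \<in> elems ?Q" using x y by (simp add: ops quotientI)
  show "vadd ?Q X Y = vadd ?Q Y X" using x y add_commute[of x y] by (simp add: ops)
  show "vscale ?Q c (vadd ?Q X Y) = vadd ?Q (vscale ?Q c X) (vscale ?Q c Y)"
    using x y by (simp add: ops scale_add_right)
  assume "Z \<in> elems ?Q"
  then obtain z where z: "z \<in> elems V" "Z = R `` {z}" by (auto elim: quotientE)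
  show "vadd ?Q (vadd ?Q X Y) Z = vadd ?Q X (vadd ?Q Y Z)" using x y z by (simp add: ops add_assoc)
qed (simp add: quotientI zero_closed)

end

section \<open>The completion as a quotient of the space of Cauchy sequences\<close>

lemma cauchy_nspace_simps [simp]:
  "elems (cauchy_nspace V) = {s. cauchy_in V s}"
  "vadd (cauchy_nspace V) s t = (\<lambda>n. vadd V (s n) (t n))"
  "vscale (cauchy_nspace V) c s = (\<lambda>n. vscale V c (s n))"
  "vzero (cauchy_nspace V) = (\<lambda>n. vzero V)"
  "vnorm (cauchy_nspace V) s = lim (\<lambda>n. vnorm V (s n))"
  by (simp_all add: cauchy_nspace_def)

context seminormed_nspace
begin

lemma cauchy_inD: "cauchy_in V s \<Longrightarrow> s n \<in> elems V"
  by (auto simp: cauchy_in_def)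

lemma cauchy_in_const: "x \<in> elems V \<Longrightarrow> cauchy_in V (\<lambda>n. x)"
  by (auto simp: cauchy_in_def diff_self norm_zero)

lemma cauchy_in_add:
  assumes "cauchy_in V s" "cauchy_in V t"
  shows "cauchy_in V (\<lambda>n. vadd V (s n) (t n))"
  unfolding cauchy_in_def
proof (intro conjI allI impI)
  note st = cauchy_inD[OF assms(1)] cauchy_inD[OF assms(2)]
  show "range (\<lambda>n. vadd V (s n) (t n)) \<subseteq> elems V" using st add_closed by blast
  fix e :: real assume "0 < e"
  then have e: "0 < e / 2" by simp
  obtain M where M: "\<forall>m\<ge>M. \<forall>n\<ge>M. vnorm V (vdiff V (s m) (s n)) < e / 2"
    using assms(1) e unfolding cauchy_in_def by blast
  obtain M' where M': "\<forall>m\<ge>M'. \<forall>n\<ge>M'. vnorm V (vdiff V (t m) (t n)) < e / 2"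
    using assms(2) e unfolding cauchy_in_def by blast
  have "vnorm V (vdiff V (vadd V (s m) (t m)) (vadd V (s n) (t n))) < e"
    if "m \<ge> max M M'" "n \<ge> max M M'" for m n
    using norm_diff_add_add[of "s m" "t m" "s n" "t n"] st M[rule_format, of m n] M'[rule_format, of m n] that by simp
  then show "\<exists>M. \<forall>m\<ge>M. \<forall>n\<ge>M. vnorm V (vdiff V (vadd V (s m) (t m)) (vadd V (s n) (t n))) < e" by blast
qed

lemma cauchy_in_scale:
  assumes "cauchy_in V s"
  shows "cauchy_in V (\<lambda>n. vscale V c (s n))"
  unfolding cauchy_in_def
proof (intro conjI allI impI)
  note s = cauchy_inD[OF assms]
  show "range (\<lambda>n. vscale V c (s n)) \<subseteq> elems V" using s scale_closed by blast
  fix e :: real assume e: "0 < e"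
  have pos: "0 < norm c + 1" by (simp add: add_nonneg_pos)
  then obtain M where M: "\<forall>m\<ge>M. \<forall>n\<ge>M. vnorm V (vdiff V (s m) (s n)) < e / (norm c + 1)"
    using assms e unfolding cauchy_in_def by (meson divide_pos_pos)
  have "vnorm V (vdiff V (vscale V c (s m)) (vscale V c (s n))) < e" if "m \<ge> M" "n \<ge> M" for m n
  proof -
    have "vnorm V (vdiff V (vscale V c (s m)) (vscale V c (s n))) = norm c * vnorm V (vdiff V (s m) (s n))"
      using s by (simp add: diff_scale norm_scale diff_closed)
    also have "\<dots> \<le> (norm c + 1) * vnorm V (vdiff V (s m) (s n))"
      using s by (intro mult_right_mono norm_nonneg diff_closed) auto
    also have "\<dots> < (norm c + 1) * (e / (norm c + 1))"
      using M that pos by (intro mult_strict_left_mono) auto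
    finally show ?thesis using pos by simp
  qed
  then show "\<exists>M. \<forall>m\<ge>M. \<forall>n\<ge>M. vnorm V (vdiff V (vscale V c (s m)) (vscale V c (s n))) < e" by blast
qed

lemma cauchy_in_norm_tendsto:
  assumes "cauchy_in V s"
  shows "(\<lambda>n. vnorm V (s n)) \<longlonglongrightarrow> vnorm (cauchy_nspace V) s"
proof -
  have "Cauchy (\<lambda>n. vnorm V (s n))"
  proof (rule CauchyI)
    fix e :: real assume "0 < e"
    then obtain M where "\<forall>m\<ge>M. \<forall>n\<ge>M. vnorm V (vdiff V (s m) (s n)) < e"
      using assms unfolding cauchy_in_def by blast
    then have "\<forall>m\<ge>M. \<forall>n\<ge>M. norm (vnorm V (s m) - vnorm V (s n)) < e"
      unfolding real_norm_def
      by (blast intro: le_less_trans[OF abs_norm_diff_le[OF cauchy_inD[OF assms] cauchy_inD[OF assms]]])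
    then show "\<exists>M. \<forall>m\<ge>M. \<forall>n\<ge>M. norm (vnorm V (s m) - vnorm V (s n)) < e" ..
  qed
  then show ?thesis by (simp add: Cauchy_convergent_iff convergent_LIMSEQ_iff)
qed

lemma cauchy_seminormed: "seminormed_nspace (cauchy_nspace V)"
proof
  fix s t and c :: 'k
  assume s: "s \<in> elems (cauchy_nspace V)"
  then have cs: "cauchy_in V s" by simp
  note lim_s = cauchy_in_norm_tendsto[OF cs]
  show "0 \<le> vnorm (cauchy_nspace V) s"
    by (rule LIMSEQ_le_const[OF lim_s]) (auto intro: norm_nonneg cauchy_inD[OF cs])
  have "(\<lambda>n. vnorm V (vscale V c (s n))) \<longlonglongrightarrow> norm c * vnorm (cauchy_nspace V) s"
    using tendsto_mult_left[OF lim_s, of "norm c"] by (simp add: norm_scale cauchy_inD[OF cs])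
  then show "vnorm (cauchy_nspace V) (vscale (cauchy_nspace V) c s) = norm c * vnorm (cauchy_nspace V) s"
    by (simp add: limI)
  assume "t \<in> elems (cauchy_nspace V)"
  then have ct: "cauchy_in V t" by simp
  have "(\<lambda>n. vnorm V (s n) + vnorm V (t n)) \<longlonglongrightarrow> vnorm (cauchy_nspace V) s + vnorm (cauchy_nspace V) t"
    by (intro tendsto_add lim_s cauchy_in_norm_tendsto ct)
  from LIMSEQ_le[OF cauchy_in_norm_tendsto[OF cauchy_in_add[OF cs ct]] this]
  show "vnorm (cauchy_nspace V) (vadd (cauchy_nspace V) s t) \<le> vnorm (cauchy_nspace V) s + vnorm (cauchy_nspace V) t"
    by (auto intro: norm_triangle cauchy_inD[OF cs] cauchy_inD[OF ct])
qed (auto simp: cauchy_in_add cauchy_in_scale cauchy_in_const zero_closed add_assoc add_zero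
    scale_add_left scale_add_right scale_scale scale_one scale_zero cauchy_inD intro!: ext add_commute)

text \<open>With null differences expressed as the kernel of the limit seminorm, the completion
  becomes an instance of dividing a seminormed space by its null vectors.\<close>

lemma null_rel_iff:
  "(s, t) \<in> null_rel V \<longleftrightarrow> cauchy_in V s \<and> cauchy_in V t \<and> vnorm (cauchy_nspace V) (vdiff (cauchy_nspace V) s t) = 0"
proof -
  have "(\<lambda>n. vnorm V (vdiff V (s n) (t n))) \<longlonglongrightarrow> vnorm (cauchy_nspace V) (vdiff (cauchy_nspace V) s t)"
    if "cauchy_in V s" "cauchy_in V t"
    using cauchy_in_norm_tendsto[OF cauchy_in_add[OF that(1) cauchy_in_scale[OF that(2), of "-1"]]]
    by (simp add: vdiff_def)
  then show ?thesis unfolding null_rel_def by (auto dest: LIMSEQ_unique)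
qed

end

text \<open>The seminorm is constant on classes, so \<open>the_elem\<close> extracts its value. The
  lemma is kept general in order to be applied to the space of Cauchy sequences.\<close>

lemma (in seminormed_nspace) quotient_null:
  assumes R: "\<And>x y. (x, y) \<in> R \<longleftrightarrow> x \<in> elems V \<and> y \<in> elems V \<and> vnorm V (vdiff V x y) = 0"
  shows "quotient_data V R"
    and "x \<in> elems V \<Longrightarrow> the_elem (vnorm V ` (R `` {x})) = vnorm V x"
    and "normed_nspace (quotient_nspace V R (\<lambda>X. the_elem (vnorm V ` X)))"
proof -
  have nn: "0 \<le> vnorm V (vdiff V x y)" if "x \<in> elems V" "y \<in> elems V" for x y
    using that by (intro norm_nonneg diff_closed)
  have eq: "equiv (elems V) R"
  proof (rule equivI)
    show "R \<subseteq> elems V \<times> elems V" using R by auto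
    show "refl_on (elems V) R" unfolding refl_on_def R by (simp add: diff_self norm_zero)
    show "sym R" unfolding sym_def R by (simp add: norm_diff_commute)
    show "trans R"
    proof (rule transI)
      fix x y z assume "(x, y) \<in> R" "(y, z) \<in> R"
      then show "(x, z) \<in> R" unfolding R using norm_diff_triangle[of x y z] nn[of x z] by auto
    qed
  qed
  show Q: "quotient_data V R"
  proof
    show "equiv (elems V) R" by (rule eq)
    show "(vadd V x y, vadd V x' y') \<in> R" if "(x, x') \<in> R" "(y, y') \<in> R" for x x' y y'
    proof -
      have xy: "x \<in> elems V" "x' \<in> elems V" "vnorm V (vdiff V x x') = 0"
        "y \<in> elems V" "y' \<in> elems V" "vnorm V (vdiff V y y') = 0" using that R by blast+
      then show ?thesis
        unfolding R using norm_diff_add_add[of x y x' y'] nn[of "vadd V x y" "vadd V x' y'"]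
        by (simp add: add_closed)
    qed
    show "(vscale V c x, vscale V c x') \<in> R" if "(x, x') \<in> R" for c x x'
    proof -
      have x: "x \<in> elems V" "x' \<in> elems V" "vnorm V (vdiff V x x') = 0" using that R by blast+
      then show ?thesis unfolding R by (simp add: scale_closed diff_scale norm_scale diff_closed)
    qed
  qed
  then interpret Q: quotient_data V R .
  show norm: "the_elem (vnorm V ` (R `` {x})) = vnorm V x" if x: "x \<in> elems V" for x
  proof -
    have "vnorm V y = vnorm V x" if "(x, y) \<in> R" for y
      using that abs_norm_diff_le[of x y] unfolding R by auto
    moreover have "(x, x) \<in> R" unfolding R using x by (simp add: diff_self norm_zero)
    ultimately have "vnorm V ` (R `` {x}) = {vnorm V x}" by blast
    then show ?thesis by simp
  qed
  let ?Q = "quotient_nspace V R (\<lambda>X. the_elem (vnorm V ` X))"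
  interpret QV: vector_nspace ?Q by (rule Q.quotient_vector_nspace)
  show "normed_nspace ?Q"
  proof
    fix X Y and c :: 'k assume "X \<in> elems ?Q"
    then obtain x where x: "x \<in> elems V" "X = R `` {x}" by (auto elim: quotientE)
    show "0 \<le> vnorm ?Q X" using x by (simp add: norm norm_nonneg)
    show "vnorm ?Q (vscale ?Q c X) = norm c * vnorm ?Q X"
      using x by (simp add: norm Q.quotient_scale norm_scale scale_closed)
    show "X = vzero ?Q" if "vnorm ?Q X = 0"
    proof -
      have "vnorm V x = 0" using that x by (simp add: norm)
      moreover have "vdiff V x (vzero V) = x"
        using x scale_zero[OF zero_closed] scale_scale[OF zero_closed, of "-1" 0]
        by (simp add: vdiff_def add_zero)
      ultimately have "(x, vzero V) \<in> R" unfolding R using x zero_closed by simp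
      then show ?thesis using x equiv_class_eq[OF eq] by simp
    qed
    assume "Y \<in> elems ?Q"
    then obtain y where y: "y \<in> elems V" "Y = R `` {y}" by (auto elim: quotientE)
    show "vnorm ?Q (vadd ?Q X Y) \<le> vnorm ?Q X + vnorm ?Q Y"
      using x y by (simp add: norm Q.quotient_add norm_triangle add_closed)
  qed
qed

context seminormed_nspace
begin

definition cls :: "(nat \<Rightarrow> 'v) \<Rightarrow> (nat \<Rightarrow> 'v) set" where
  "cls s = null_rel V `` {s}"

lemma completion_normed: "normed_nspace (completion V)"
  unfolding completion_def
  by (rule seminormed_nspace.quotient_null(3)[OF cauchy_seminormed]) (simp add: null_rel_iff)

lemma completion_cls:
  shows cls_closed: "cauchy_in V s \<Longrightarrow> cls s \<in> elems (completion V)"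
    and cls_add: "cauchy_in V s \<Longrightarrow> cauchy_in V t \<Longrightarrow> vadd (completion V) (cls s) (cls t) = cls (\<lambda>n. vadd V (s n) (t n))"
    and cls_scale: "cauchy_in V s \<Longrightarrow> vscale (completion V) c (cls s) = cls (\<lambda>n. vscale V c (s n))"
    and cls_norm: "cauchy_in V s \<Longrightarrow> (\<lambda>n. vnorm V (s n)) \<longlonglongrightarrow> vnorm (completion V) (cls s)"
    and cls_cases: "X \<in> elems (completion V) \<Longrightarrow> \<exists>s. cauchy_in V s \<and> X = cls s"
proof -
  interpret C: seminormed_nspace "cauchy_nspace V" by (rule cauchy_seminormed)
  interpret Q: quotient_data "cauchy_nspace V" "null_rel V"
    by (rule C.quotient_null) (simp add: null_rel_iff)
  show "cauchy_in V s \<Longrightarrow> cls s \<in> elems (completion V)"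
    by (simp add: completion_def cls_def quotientI)
  show "cauchy_in V s \<Longrightarrow> cauchy_in V t \<Longrightarrow> vadd (completion V) (cls s) (cls t) = cls (\<lambda>n. vadd V (s n) (t n))"
    by (simp add: completion_def cls_def Q.quotient_add)
  show "cauchy_in V s \<Longrightarrow> vscale (completion V) c (cls s) = cls (\<lambda>n. vscale V c (s n))"
    by (simp add: completion_def cls_def Q.quotient_scale)
  show "(\<lambda>n. vnorm V (s n)) \<longlonglongrightarrow> vnorm (completion V) (cls s)" if "cauchy_in V s"
  proof -
    have "vnorm (completion V) (cls s) = vnorm (cauchy_nspace V) s"
      unfolding completion_def cls_def quotient_nspace_simps
      by (rule C.quotient_null(2)) (use that in \<open>simp_all add: null_rel_iff\<close>)
    then show ?thesis using cauchy_in_norm_tendsto[OF that] by simp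
  qed
  show "X \<in> elems (completion V) \<Longrightarrow> \<exists>s. cauchy_in V s \<and> X = cls s"
    by (auto simp: completion_def cls_def elim: quotientE)
qed

text \<open>A late member of a representing Cauchy sequence serves as approximation; the margin of
  one half compensates for strict bounds becoming non-strict in the limit.\<close>

lemma completion_dense:
  assumes X: "X \<in> elems (completion V)" and e: "0 < e"
  obtains x where "x \<in> elems V" "vnorm (completion V) (vdiff (completion V) X (cls (\<lambda>n. x))) < e"
proof -
  obtain s where s: "cauchy_in V s" "X = cls s" using cls_cases[OF X] by blast
  obtain M where M: "\<forall>m\<ge>M. \<forall>n\<ge>M. vnorm V (vdiff V (s m) (s n)) < e / 2"
    using s(1) e unfolding cauchy_in_def by (meson half_gt_zero)
  have sM: "s M \<in> elems V" by (rule cauchy_inD[OF s(1)])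
  have c: "cauchy_in V (\<lambda>n. vscale V (-1) (s M))" by (intro cauchy_in_const scale_closed sM)
  have "vdiff (completion V) X (cls (\<lambda>n. s M)) = cls (\<lambda>n. vdiff V (s n) (s M))"
    unfolding s(2) vdiff_def by (simp add: cls_scale cauchy_in_const sM cls_add s(1) c)
  moreover have "(\<lambda>n. vnorm V (vdiff V (s n) (s M))) \<longlonglongrightarrow> vnorm (completion V) (cls (\<lambda>n. vdiff V (s n) (s M)))"
    unfolding vdiff_def by (intro cls_norm cauchy_in_add s(1) c)
  ultimately have "vnorm (completion V) (vdiff (completion V) X (cls (\<lambda>n. s M))) \<le> e / 2"
    using M by (metis (no_types, lifting) LIMSEQ_le_const2 less_imp_le order_refl)
  then show ?thesis using that[OF sM] e by simp
qed

end

lemma ell_normed: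
  assumes q: "1 \<le> q"
  shows "normed_nspace (ell q :: ('k::real_normed_field, nat \<Rightarrow> 'k) nspace)"
proof -
  have q0: "0 < q" using q by simp
  have ops: "vadd (ell q) = (\<lambda>x y n. x n + y n)" "vzero (ell q) = (\<lambda>n. 0)"
    "vscale (ell q) = (\<lambda>c x n. c * x n)" for q :: real
    by (simp_all add: ell_def)
  show ?thesis
    by unfold_locales
      (auto simp: ops algebra_simps lspace_scale lnorm_scale[OF q0] lnorm_eq_0_iff[OF q0] lspace_add_lnorm[OF q])
qed

section \<open>The algebraic tensor product inside the functions of multi-indices\<close>

type_synonym ('i, 'k) free_tuples = "('i \<Rightarrow> nat \<Rightarrow> 'k) \<Rightarrow>\<^sub>0 'k"

text \<open>The linear map induced by \<open>tens\<close>; on combinations of admissible tuples its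
  kernel will be exactly the span of the relators, so that it realises algebraic tensors as
  functions.\<close>

definition tensor_fun :: "'i set \<Rightarrow> ('i, 'k::real_normed_field) free_tuples \<Rightarrow> ('i \<Rightarrow> nat) \<Rightarrow> 'k" where
  "tensor_fun I u = (\<lambda>k. \<Sum>t\<in>Poly_Mapping.keys u. Poly_Mapping.lookup u t * tens I t k)"

lemma tensor_fun_eq:
  assumes "finite S" "Poly_Mapping.keys u \<subseteq> S"
  shows "tensor_fun I u = (\<lambda>k. \<Sum>t\<in>S. Poly_Mapping.lookup u t * tens I t k)"
  unfolding tensor_fun_def using assms
  by (intro ext sum.mono_neutral_left) (auto simp: in_keys_iff)

lemma tensor_fun_add: "tensor_fun I (u + v) = (\<lambda>k. tensor_fun I u k + tensor_fun I v k)"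
proof -
  let ?S = "Poly_Mapping.keys u \<union> Poly_Mapping.keys v"
  have "finite ?S" "Poly_Mapping.keys (u + v) \<subseteq> ?S" using Poly_Mapping.keys_add[of u v] by auto
  then show ?thesis
    by (simp add: tensor_fun_eq[of ?S u] tensor_fun_eq[of ?S v] tensor_fun_eq[of ?S "u + v"]
        lookup_add algebra_simps sum.distrib)
qed

lemma tensor_fun_fscale: "tensor_fun I (fscale c u) = (\<lambda>k. c * tensor_fun I u k)"
proof -
  have "Poly_Mapping.keys (fscale c u) \<subseteq> Poly_Mapping.keys u"
    by (auto simp: in_keys_iff lookup_fscale)
  then show ?thesis
    by (subst tensor_fun_eq[of "Poly_Mapping.keys u" "fscale c u"])
      (simp_all add: lookup_fscale tensor_fun_def sum_distrib_left mult.assoc)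
qed

lemma tensor_fun_zero: "tensor_fun I 0 = (\<lambda>k. 0)"
  by (simp add: tensor_fun_def)

lemma tensor_fun_diff: "tensor_fun I (u - v) = (\<lambda>k. tensor_fun I u k - tensor_fun I v k)"
  using tensor_fun_add[of I "u - v" v] by (simp add: fun_eq_iff)

lemma tensor_fun_sum: "tensor_fun I (\<Sum>n\<in>S. u n) = (\<lambda>k. \<Sum>n\<in>S. tensor_fun I (u n) k)"
  by (induction S rule: infinite_finite_induct) (simp_all add: tensor_fun_zero tensor_fun_add)

lemma tensor_fun_gen: "tensor_fun I (gen t) = tens I t"
  by (simp add: tensor_fun_def fun_eq_iff)

lemma fscale_gen_sum: "u = (\<Sum>t\<in>Poly_Mapping.keys u. fscale (Poly_Mapping.lookup u t) (gen t))"
proof (rule poly_mapping_eqI)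
  fix t
  have "(\<Sum>s\<in>Poly_Mapping.keys u. Poly_Mapping.lookup u s * Poly_Mapping.lookup (gen s :: _ \<Rightarrow>\<^sub>0 'b) t) =
      (\<Sum>s\<in>Poly_Mapping.keys u. if s = t then Poly_Mapping.lookup u t else 0)"
    by (intro sum.cong) (auto simp: lookup_single when_def)
  also have "\<dots> = Poly_Mapping.lookup u t" by (simp add: in_keys_iff)
  finally show "Poly_Mapping.lookup u t =
      Poly_Mapping.lookup (\<Sum>t\<in>Poly_Mapping.keys u. fscale (Poly_Mapping.lookup u t) (gen t)) t"
    by (simp add: lookup_sum lookup_fscale)
qed

definition supported_on :: "'t set \<Rightarrow> ('t \<Rightarrow>\<^sub>0 'k::field) \<Rightarrow> bool" where
  "supported_on G u \<longleftrightarrow> Poly_Mapping.keys u \<subseteq> G"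

lemma supported_on_iff: "supported_on G u \<longleftrightarrow> (\<forall>t. Poly_Mapping.lookup u t \<noteq> 0 \<longrightarrow> t \<in> G)"
  by (auto simp: supported_on_def in_keys_iff)

lemma supported_on_add: "supported_on G u \<Longrightarrow> supported_on G v \<Longrightarrow> supported_on G (u + v)"
  unfolding supported_on_iff lookup_add by (metis add.right_neutral)

lemma supported_on_fscale: "supported_on G u \<Longrightarrow> supported_on G (fscale c u)"
  by (simp add: supported_on_iff lookup_fscale)

lemma supported_on_gen: "t \<in> G \<Longrightarrow> supported_on G (gen t)"
  by (simp add: supported_on_iff lookup_single when_def)

lemma supported_on_zero: "supported_on G 0"
  by (simp add: supported_on_iff)

lemma supported_on_sum: "(\<And>n. n \<in> S \<Longrightarrow> supported_on G (u n)) \<Longrightarrow> supported_on G (\<Sum>n\<in>S. u n)"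
  by (induction S rule: infinite_finite_induct) (simp_all add: supported_on_add supported_on_zero)

text \<open>A finite-dimensional space of functions is determined by finitely many nodes K, and the
  \<open>b l\<close> are dual to evaluation at these nodes. L stands for the sequence space in which
  the basis has to lie.\<close>

lemma coordinate_interpolation:
  fixes S :: "(nat \<Rightarrow> 'k::field) set"
  assumes "finite S" "S \<subseteq> L"
    and L: "\<And>x y c. x \<in> L \<Longrightarrow> y \<in> L \<Longrightarrow> (\<lambda>n. x n + c * y n) \<in> L" "(\<lambda>n. 0) \<in> L"
  shows "\<exists>K b. finite K \<and> (\<forall>l\<in>K. b l \<in> L) \<and> (\<forall>l\<in>K. \<forall>m\<in>K. b l m = of_bool (l = m)) \<and>
      (\<forall>x\<in>S. \<forall>n. x n = (\<Sum>l\<in>K. x l * b l n))"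
  using assms(1,2)
proof (induction S rule: finite_induct)
  case empty
  show ?case by (intro exI[of _ "{}"]) auto
next
  case (insert y S)
  then have "S \<subseteq> L" by simp
  from insert.IH[OF this] obtain K b where Kb: "finite K \<and> (\<forall>l\<in>K. b l \<in> L) \<and>
      (\<forall>l\<in>K. \<forall>m\<in>K. b l m = of_bool (l = m)) \<and> (\<forall>x\<in>S. \<forall>n. x n = (\<Sum>l\<in>K. x l * b l n))"
    by (elim exE)
  then have K: "finite K" "\<And>l. l \<in> K \<Longrightarrow> b l \<in> L"
    and dual: "\<And>l m. l \<in> K \<Longrightarrow> m \<in> K \<Longrightarrow> b l m = of_bool (l = m)"
    and rep: "\<And>x n. x \<in> S \<Longrightarrow> x n = (\<Sum>l\<in>K. x l * b l n)" by blast+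
  \<comment> \<open>The part of y that the nodes in K do not reproduce; if it is non-zero, a
    coordinate where it does not vanish becomes the next node.\<close>
  define z where "z n = y n - (\<Sum>l\<in>K. y l * b l n)" for n
  have y: "y n = z n + (\<Sum>l\<in>K. y l * b l n)" for n by (simp add: z_def)
  have zK: "z m = 0" if "m \<in> K" for m
  proof -
    have "(\<Sum>l\<in>K. y l * b l m) = (\<Sum>l\<in>K. if l = m then y m else 0)"
      using dual that by (intro sum.cong) auto
    then show ?thesis using K that by (simp add: z_def)
  qed
  have sumL: "(\<lambda>n. \<Sum>l\<in>M. c l * b l n) \<in> L" if "M \<subseteq> K" for M c
    using finite_subset[OF that K(1)] that
  proof (induction M rule: finite_induct)
    case (insert m M)
    then show ?case using L(1)[of "\<lambda>n. \<Sum>l\<in>M. c l * b l n" "b m" "c m"] K(2)[of m] by (simp add: add.commute)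
  qed (simp add: L)
  have zL: "z \<in> L"
    using L(1)[OF _ sumL[OF subset_refl, of y], of y "-1"] insert.prems by (simp add: z_def[abs_def])
  show ?case
  proof (cases "\<exists>n. z n \<noteq> 0")
    case False
    have "y n = (\<Sum>l\<in>K. y l * b l n)" for n
    proof -
      have "z n = 0" using False by blast
      then show ?thesis unfolding z_def by (simp only: right_minus_eq)
    qed
    then show ?thesis using Kb by (intro exI[of _ K] exI[of _ b]) blast
  next
    case True
    then obtain n0 where n0: "z n0 \<noteq> 0" by blast
    then have n0K: "n0 \<notin> K" using zK by blast
    \<comment> \<open>Elimination: the rescaled remainder is 1 at the new node, and subtracting
      multiples of it makes the old basis vanish there. Values at the old nodes are unchanged
      because z is 0 on K.\<close>
    define b' where "b' l = (\<lambda>n. if l = n0 then z n / z n0 else b l n - b l n0 / z n0 * z n)" for l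
    have b'_old: "b' l n = b l n - b l n0 / z n0 * z n" if "l \<in> K" for l n
      using that n0K by (auto simp: b'_def)
    have b'_new: "b' n0 n = z n / z n0" for n by (simp add: b'_def)
    have expand: "(\<Sum>l\<in>insert n0 K. x l * b' l n) =
        (\<Sum>l\<in>K. x l * b l n) + (x n0 - (\<Sum>l\<in>K. x l * b l n0)) / z n0 * z n" for x n
    proof -
      have "(\<Sum>l\<in>K. x l * b' l n) = (\<Sum>l\<in>K. x l * b l n - x l * b l n0 * (z n / z n0))"
        by (intro sum.cong) (auto simp: b'_old algebra_simps)
      also have "\<dots> = (\<Sum>l\<in>K. x l * b l n) - (\<Sum>l\<in>K. x l * b l n0) * (z n / z n0)"
        by (simp add: sum_subtractf sum_distrib_right sum_divide_distrib)
      finally show ?thesis using K n0K n0 by (simp add: b'_new field_simps)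
    qed
    have "b' l \<in> L" if "l \<in> insert n0 K" for l
    proof (cases "l = n0")
      case True
      have "b' l = (\<lambda>n. 0 + (1 / z n0) * z n)" unfolding True by (simp add: b'_new fun_eq_iff)
      then show ?thesis using L(1)[OF L(2) zL, of "1 / z n0"] by simp
    next
      case False
      then have l: "l \<in> K" using that by blast
      have "b' l = (\<lambda>n. b l n + (- (b l n0 / z n0)) * z n)" using l by (simp add: b'_old fun_eq_iff)
      then show ?thesis using L(1)[OF K(2)[OF l] zL, of "- (b l n0 / z n0)"] by simp
    qed
    moreover have "b' l m = of_bool (l = m)" if "l \<in> insert n0 K" "m \<in> insert n0 K" for l m
      using that n0 n0K zK dual by (auto simp: b'_def)
    moreover have "x n = (\<Sum>l\<in>insert n0 K. x l * b' l n)" if "x \<in> insert y S" for x n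
    proof (cases "x = y")
      case True
      have "y n0 - (\<Sum>l\<in>K. y l * b l n0) = z n0" by (simp add: z_def)
      then show ?thesis unfolding True expand using y[of n] by (simp only: divide_self[OF n0] mult_1 add.commute)
    next
      case False
      then have x: "x \<in> S" using that by blast
      show ?thesis unfolding expand rep[OF x, of n0, symmetric] by (simp only: diff_self div_0 mult_zero_left add_0_right rep[OF x, of n, symmetric])
    qed
    ultimately show ?thesis using K(1) by (intro exI[of _ "insert n0 K"] exI[of _ b']) auto
  qed
qed

text \<open>The parameter \<open>scalar\<close> fixes the scalar type; non-emptiness allows a scalar
  coefficient to be moved into a factor.\<close>

locale lspace_tensor = tensor_factors p I
  for p :: "'i \<Rightarrow> real" and I :: "'i set" +
  fixes scalar :: "'k::real_normed_field itself"
  assumes I_nonempty: "I \<noteq> {}"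
begin

abbreviation factors :: "'i \<Rightarrow> ('k, nat \<Rightarrow> 'k) nspace" where
  "factors \<equiv> \<lambda>i. ell (p i)"

abbreviation tups :: "('i \<Rightarrow> nat \<Rightarrow> 'k) set" where
  "tups \<equiv> tuples I factors"

abbreviation nulls :: "('i, 'k) free_tuples set" where
  "nulls \<equiv> free_space.span (multilinear_relators I factors)"

lemma tuples_iff: "t \<in> tups \<longleftrightarrow> t \<in> extensional I \<and> (\<forall>i\<in>I. t i \<in> lspace (p i))"
  by (auto simp: tuples_def PiE_iff)

lemma tuples_upd: "t \<in> tups \<Longrightarrow> i \<in> I \<Longrightarrow> x \<in> lspace (p i) \<Longrightarrow> t(i := x) \<in> tups"
  by (auto simp: tuples_iff extensional_def)

lemma tens_upd: "i \<in> I \<Longrightarrow> tens I (t(i := x)) k = x (k i) * (\<Prod>j\<in>I - {i}. t j (k j))"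
  using finite_A by (simp add: tens_def prod.remove)

lemma relator_add:
  assumes "t \<in> tups" "i \<in> I" "x \<in> lspace (p i)" "y \<in> lspace (p i)"
  shows "gen (t(i := (\<lambda>n. x n + y n))) - (gen (t(i := x)) + gen (t(i := y))) \<in> nulls"
proof (rule free_space.span_base)
  have "gen (t(i := vadd (factors i) x y)) - (gen (t(i := x)) + gen (t(i := y))) \<in> multilinear_relators I factors"
    unfolding multilinear_relators_def using assms by blast
  then show "gen (t(i := (\<lambda>n. x n + y n))) - (gen (t(i := x)) + gen (t(i := y))) \<in> multilinear_relators I factors"
    by (simp add: ell_def)
qed

lemma relator_scale:
  assumes "t \<in> tups" "i \<in> I" "x \<in> lspace (p i)"
  shows "gen (t(i := (\<lambda>n. c * x n))) - fscale c (gen (t(i := x))) \<in> nulls"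
proof (rule free_space.span_base)
  have "gen (t(i := vscale (factors i) c x)) - fscale c (gen (t(i := x))) \<in> multilinear_relators I factors"
    unfolding multilinear_relators_def using assms by blast
  then show "gen (t(i := (\<lambda>n. c * x n))) - fscale c (gen (t(i := x))) \<in> multilinear_relators I factors"
    by (simp add: ell_def)
qed

section \<open>The kernel of the map from formal combinations to functions\<close>

lemma tensor_fun_nulls:
  assumes "u \<in> nulls"
  shows "tensor_fun I u = (\<lambda>k. 0)"
proof -
  have "multilinear_relators I factors \<subseteq> {u. tensor_fun I u = (\<lambda>k. 0)}"
  proof
    have ops: "vadd (ell q) x y = (\<lambda>n. x n + y n)" "vscale (ell q) c x = (\<lambda>n. c * x n)"
      for q :: real and x y :: "nat \<Rightarrow> 'k" and c by (simp_all add: ell_def)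
    fix r assume "r \<in> multilinear_relators I factors"
    then show "r \<in> {u. tensor_fun I u = (\<lambda>k. 0)}"
      unfolding multilinear_relators_def
      by (elim UnE CollectE exE conjE)
        (simp_all add: ops tensor_fun_diff tensor_fun_add tensor_fun_gen tensor_fun_fscale tens_upd
          distrib_right mult.assoc)
  qed
  moreover have "free_space.subspace {u. tensor_fun I u = (\<lambda>k. 0)}"
    by (auto simp: free_space.subspace_def tensor_fun_zero tensor_fun_add tensor_fun_fscale)
  ultimately have "nulls \<subseteq> {u. tensor_fun I u = (\<lambda>k. 0)}" by (rule free_space.span_minimal)
  then show ?thesis using assms by blast
qed

lemma lspace_sum:
  assumes "i \<in> I" "\<And>l. l \<in> K \<Longrightarrow> b l \<in> lspace (p i)"
  shows "(\<lambda>n. \<Sum>l\<in>K. c l * b l n) \<in> lspace (p i)"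
  using assms(2)
proof (induction K rule: infinite_finite_induct)
  case (insert m K)
  then show ?case
    using lspace_add_lnorm(1)[OF p_ge_1[OF assms(1)] lspace_scale, of "b m" "\<lambda>n. \<Sum>l\<in>K. c l * b l n" "c m"] by simp
qed simp_all

lemma gen_expand:
  assumes t: "t \<in> tups" and i: "i \<in> I" and "finite K" and b: "\<And>l. l \<in> K \<Longrightarrow> b l \<in> lspace (p i)"
  shows "gen (t(i := (\<lambda>n. \<Sum>l\<in>K. c l * b l n))) - (\<Sum>l\<in>K. fscale (c l) (gen (t(i := b l)))) \<in> nulls"
  using assms(3,4)
proof (induction K rule: finite_induct)
  case empty
  show ?case using relator_scale[OF t i lspace_zero(1), of 0] by (simp add: fun_upd_def)
next
  case (insert m K)
  let ?s = "\<lambda>n. \<Sum>l\<in>K. c l * b l n"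
  let ?g = "\<lambda>x. gen (t(i := x))"
  have s: "?s \<in> lspace (p i)"
    using insert by (intro lspace_sum[OF i]) auto
  have bm: "b m \<in> lspace (p i)" using insert by simp
  have 1: "?g (\<lambda>n. c m * b m n + ?s n) - (?g (\<lambda>n. c m * b m n) + ?g ?s) \<in> nulls"
    by (intro relator_add t i lspace_scale bm s)
  have 2: "?g (\<lambda>n. c m * b m n) - fscale (c m) (?g (b m)) \<in> nulls"
    by (intro relator_scale t i bm)
  have 3: "?g ?s - (\<Sum>l\<in>K. fscale (c l) (?g (b l))) \<in> nulls"
    by (rule insert.IH) (use insert.prems in simp)
  have eq: "?g (\<lambda>n. \<Sum>l\<in>insert m K. c l * b l n) - (\<Sum>l\<in>insert m K. fscale (c l) (?g (b l))) =
      (?g (\<lambda>n. c m * b m n + ?s n) - (?g (\<lambda>n. c m * b m n) + ?g ?s)) +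
      ((?g (\<lambda>n. c m * b m n) - fscale (c m) (?g (b m))) + (?g ?s - (\<Sum>l\<in>K. fscale (c l) (?g (b l)))))"
    using insert.hyps by (simp add: algebra_simps)
  have "?g (\<lambda>n. \<Sum>l\<in>insert m K. c l * b l n) - (\<Sum>l\<in>insert m K. fscale (c l) (?g (b l))) \<in> nulls"
    unfolding eq by (intro free_space.span_add 1 2 3)
  then show ?case by (simp only: fun_upd_def)
qed

text \<open>Replacing the factors by a dual system turns \<open>u\<close> into a combination of generators whose
  coefficients are values of \<open>tensor_fun I u\<close>.\<close>

lemma nulls_of_tensor_fun_zero:
  assumes u: "supported_on tups u" and zero: "tensor_fun I u = (\<lambda>k. 0)"
  shows "u \<in> nulls"
proof -
  have "\<exists>K b. finite K \<and> (\<forall>l\<in>K. b l \<in> lspace (p i)) \<and> (\<forall>l\<in>K. \<forall>m\<in>K. b l m = of_bool (l = m)) \<and>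
      (\<forall>t\<in>Poly_Mapping.keys u. \<forall>n. t i n = (\<Sum>l\<in>K. t i l * b l n))" if i: "i \<in> I" for i
  proof -
    let ?S = "(\<lambda>t. t i) ` Poly_Mapping.keys u"
    have S: "finite ?S" "?S \<subseteq> lspace (p i)"
      using u i by (auto simp: supported_on_def tuples_iff)
    have L: "(\<lambda>n. x n + c * y n) \<in> lspace (p i)" if "x \<in> lspace (p i)" "y \<in> lspace (p i)" for x y :: "nat \<Rightarrow> 'k" and c
      by (rule lspace_add_lnorm(1)[OF p_ge_1[OF i] that(1) lspace_scale[OF that(2)]])
    have "\<exists>K b. finite K \<and> (\<forall>l\<in>K. b l \<in> lspace (p i)) \<and> (\<forall>l\<in>K. \<forall>m\<in>K. b l m = of_bool (l = m)) \<and>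
      (\<forall>x\<in>?S. \<forall>n. x n = (\<Sum>l\<in>K. x l * b l n))"
      by (rule coordinate_interpolation[OF S L lspace_zero(1)])
    then show ?thesis by (simp only: ball_simps)
  qed
  then have "\<forall>i\<in>I. \<exists>Kb. finite (fst Kb) \<and> (\<forall>l\<in>fst Kb. snd Kb l \<in> lspace (p i)) \<and>
      (\<forall>l\<in>fst Kb. \<forall>m\<in>fst Kb. snd Kb l m = of_bool (l = m)) \<and>
      (\<forall>t\<in>Poly_Mapping.keys u. \<forall>n. t i n = (\<Sum>l\<in>fst Kb. t i l * snd Kb l n))" by simp
  from bchoice[OF this] obtain Kb where Kb: "\<forall>i\<in>I. finite (fst (Kb i)) \<and>
      (\<forall>l\<in>fst (Kb i). snd (Kb i) l \<in> lspace (p i)) \<and>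
      (\<forall>l\<in>fst (Kb i). \<forall>m\<in>fst (Kb i). snd (Kb i) l m = of_bool (l = m)) \<and>
      (\<forall>t\<in>Poly_Mapping.keys u. \<forall>n. t i n = (\<Sum>l\<in>fst (Kb i). t i l * snd (Kb i) l n))" ..
  define K where "K i = fst (Kb i)" for i
  define b where "b i = snd (Kb i)" for i
  have K: "finite (K i)" "\<And>l. l \<in> K i \<Longrightarrow> b i l \<in> lspace (p i)"
    and dual: "\<And>l m. l \<in> K i \<Longrightarrow> m \<in> K i \<Longrightarrow> b i l m = of_bool (l = m)"
    and rep: "\<And>t n. t \<in> Poly_Mapping.keys u \<Longrightarrow> t i n = (\<Sum>l\<in>K i. t i l * b i l n)" if "i \<in> I" for i
    using Kb that by (auto simp: K_def b_def)
  \<comment> \<open>Slots in J already hold basis vectors, while the others still satisfy their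
    interpolation formula, so that the next slot can be expanded.\<close>
  define G where "G J = {t \<in> tups. (\<forall>i\<in>J. t i \<in> b i ` K i) \<and> (\<forall>i\<in>I - J. \<forall>n. t i n = (\<Sum>l\<in>K i. t i l * b i l n))}" for J
  have "\<exists>w. supported_on (G J) w \<and> u - w \<in> nulls" if "J \<subseteq> I" for J
    using finite_subset[OF that finite_A] that
  proof (induction J rule: finite_induct)
    case empty
    have "supported_on (G {}) u" using u rep by (auto simp: supported_on_def G_def)
    then show ?case using free_space.span_zero by (intro exI[of _ u]) simp
  next
    case (insert i J)
    then obtain w where w: "supported_on (G J) w" "u - w \<in> nulls" and i: "i \<in> I" by auto
    let ?new = "\<lambda>t. \<Sum>l\<in>K i. fscale (t i l) (gen (t(i := b i l)))"
    have step: "gen t - ?new t \<in> nulls \<and> supported_on (G (insert i J)) (?new t)" if t: "t \<in> G J" for t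
    proof
      have tt: "t \<in> tups" using t by (simp add: G_def)
      have "t i = (\<lambda>n. \<Sum>l\<in>K i. t i l * b i l n)" using t i insert.hyps by (auto simp: G_def fun_eq_iff)
      then have "t(i := (\<lambda>n. \<Sum>l\<in>K i. t i l * b i l n)) = t" by (metis fun_upd_triv)
      then show "gen t - ?new t \<in> nulls"
        using gen_expand[OF tt i K(1)[OF i], of "b i" "t i"] K(2)[OF i] by simp
      have "t(i := b i l) \<in> G (insert i J)" if l: "l \<in> K i" for l
      proof -
        have "t(i := b i l) \<in> tups" by (rule tuples_upd[OF tt i K(2)[OF i l]])
        then show ?thesis using t l by (auto simp: G_def)
      qed
      then show "supported_on (G (insert i J)) (?new t)"
        by (intro supported_on_sum supported_on_fscale supported_on_gen)
    qed
    have keys: "t \<in> G J" if "t \<in> Poly_Mapping.keys w" for t using w(1) that by (auto simp: supported_on_def)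
    define w' where "w' = (\<Sum>t\<in>Poly_Mapping.keys w. fscale (Poly_Mapping.lookup w t) (?new t))"
    have "w - w' = (\<Sum>t\<in>Poly_Mapping.keys w. fscale (Poly_Mapping.lookup w t) (gen t - ?new t))"
      by (subst fscale_gen_sum[of w]) (simp add: w'_def sum_subtractf free_space.scale_right_diff_distrib)
    then have "w - w' \<in> nulls"
      using step keys by (auto intro!: free_space.span_sum free_space.span_scale)
    then have "u - w' \<in> nulls" using free_space.span_add[OF w(2)] by fastforce
    moreover have "supported_on (G (insert i J)) w'"
      unfolding w'_def by (rule supported_on_sum, rule supported_on_fscale) (use step keys in blast)
    ultimately show ?case by blast
  qed
  from this[of I] obtain w where w: "supported_on (G I) w" "u - w \<in> nulls" by blast
  have fw: "tensor_fun I w = (\<lambda>k. 0)"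
    using tensor_fun_nulls[OF w(2)] zero by (simp add: tensor_fun_diff fun_eq_iff)
  have "w = 0"
  proof (rule poly_mapping_eqI)
    fix t0
    show "Poly_Mapping.lookup w t0 = Poly_Mapping.lookup 0 t0"
    proof (cases "t0 \<in> Poly_Mapping.keys w")
      case True
      then have t0: "t0 \<in> G I" using w(1) by (auto simp: supported_on_def)
      then have "\<forall>i\<in>I. \<exists>l. l \<in> K i \<and> t0 i = b i l" by (auto simp: G_def)
      \<comment> \<open>The multi-index of the nodes belonging to t0: by duality every other tuple
        occurring in w takes the value 0 there, so evaluation isolates the coefficient of
        t0.\<close>
      from bchoice[OF this] obtain l where l: "\<forall>i\<in>I. l i \<in> K i \<and> t0 i = b i (l i)" ..
      have other: "tens I t l = 0" if t: "t \<in> Poly_Mapping.keys w - {t0}" for t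
      proof -
        have tG: "t \<in> G I" using w(1) t by (auto simp: supported_on_def)
        have "\<exists>i\<in>I. t i \<noteq> t0 i"
        proof (rule ccontr)
          assume "\<not> ?thesis"
          then have "t = t0" using tG t0 by (intro extensionalityI[of t I t0]) (auto simp: G_def tuples_iff)
          then show False using t by blast
        qed
        then obtain i where i: "i \<in> I" "t i \<noteq> t0 i" by blast
        obtain m where m: "m \<in> K i" "t i = b i m" using tG i by (auto simp: G_def)
        then have "t i (l i) = 0" using i l dual[OF i(1), of m "l i"] by auto
        then show ?thesis unfolding tens_def using i(1) finite_A by (intro prod_zero) auto
      qed
      have "tens I t0 l = 1" unfolding tens_def using l dual by (intro prod.neutral) auto
      moreover have "tensor_fun I w l = Poly_Mapping.lookup w t0 * tens I t0 l"
        unfolding tensor_fun_def using other True by (simp add: sum.remove)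
      ultimately show ?thesis using fw by (simp add: fun_eq_iff)
    qed (simp add: in_keys_iff)
  qed
  then show ?thesis using w(2) by simp
qed

subsection \<open>The projective norm\<close>

abbreviation rel :: "(('i, 'k) free_tuples \<times> ('i, 'k) free_tuples) set" where
  "rel \<equiv> tensor_rel I factors"

abbreviation space :: "('k, ('i, 'k) free_tuples set) nspace" where
  "space \<equiv> projective_tensor I factors"

lemma free_simps:
  "u \<in> elems (free_nspace I factors) \<longleftrightarrow> supported_on tups u"
  "vadd (free_nspace I factors) = (+)" "vscale (free_nspace I factors) = fscale"
  "vzero (free_nspace I factors) = 0"
  by (simp_all add: free_nspace_def supported_on_def)

lemma rel_iff: "(u, v) \<in> rel \<longleftrightarrow> supported_on tups u \<and> supported_on tups v \<and> u - v \<in> nulls"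
  by (simp add: tensor_rel_def free_simps)

text \<open>Because coordinates separate algebraic tensors, the congruence can from here on be
  handled as equality of functions.\<close>

lemma rel_iff_tensor_fun:
  "(u, v) \<in> rel \<longleftrightarrow> supported_on tups u \<and> supported_on tups v \<and> tensor_fun I u = tensor_fun I v"
proof -
  have "u - v \<in> nulls \<longleftrightarrow> tensor_fun I u = tensor_fun I v" if "supported_on tups u" "supported_on tups v"
  proof
    assume "u - v \<in> nulls"
    from tensor_fun_nulls[OF this] show "tensor_fun I u = tensor_fun I v" by (simp add: tensor_fun_diff fun_eq_iff)
  next
    assume "tensor_fun I u = tensor_fun I v"
    moreover have "supported_on tups (u + fscale (-1) v)"
      using that by (intro supported_on_add supported_on_fscale)
    moreover have "u + fscale (-1) v = u - v"
      by (rule poly_mapping_eqI) (simp add: lookup_add lookup_fscale lookup_minus)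
    ultimately show "u - v \<in> nulls" by (intro nulls_of_tensor_fun_zero) (simp_all add: tensor_fun_diff)
  qed
  then show ?thesis by (auto simp: rel_iff)
qed

sublocale quot: quotient_data "free_nspace I factors" rel
proof
  show "equiv (elems (free_nspace I factors)) rel"
    by (rule equivI) (auto simp: rel_iff_tensor_fun free_simps refl_on_def sym_def trans_def)
qed (auto simp: free_simps rel_iff_tensor_fun tensor_fun_add tensor_fun_fscale supported_on_add supported_on_fscale supported_on_zero
    free_space.scale_right_distrib free_space.scale_left_distrib algebra_simps
    intro!: poly_mapping_eqI simp: lookup_fscale)

lemma tensor_fun_tset: "supported_on tups u \<Longrightarrow> tensor_fun I u \<in> tset p I"
  unfolding tensor_fun_def
  by (intro tset_sum tset_tens) (auto simp: supported_on_def tuples_iff)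

text \<open>The scalar of each term is moved into one chosen factor and the tuples are made
  extensional, as the definition of the projective norm requires.\<close>

lemma trep_tuples:
  assumes "trep p I (u :: _ \<Rightarrow> 'k) s"
  shows "\<exists>(m::nat) x. (\<forall>j<m. x j \<in> tups) \<and> u = (\<lambda>k. \<Sum>j<m. tens I (x j) k) \<and>
      (\<Sum>j<m. \<Prod>i\<in>I. lnorm (p i) (x j i)) \<le> s"
  using assms
proof (induction rule: trep.induct)
  case (zero s)
  then show ?case by (intro exI[of _ 0]) auto
next
  case (step u s x c s')
  then obtain m :: nat and y where y: "\<forall>j<m. y j \<in> tups" "u = (\<lambda>k. \<Sum>j<m. tens I (y j) k)"
    "(\<Sum>j<m. \<Prod>i\<in>I. lnorm (p i) (y j i)) \<le> s" by blast
  obtain i0 where i0: "i0 \<in> I" using I_nonempty by blast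
  define z where "z = (\<lambda>i\<in>I. if i = i0 then (\<lambda>n. c * x i n) else x i)"
  have zt: "z \<in> tups" using step.hyps(2) by (auto simp: tuples_iff z_def lspace_scale)
  have "tens I z k = (\<Prod>i\<in>I. (if i = i0 then c else 1) * x i (k i))" for k
    unfolding tens_def by (intro prod.cong) (auto simp: z_def)
  then have tz: "tens I z k = c * tens I x k" for k
    using finite_A i0 by (simp add: prod.distrib tens_def)
  have "(\<Prod>i\<in>I. lnorm (p i) (z i)) = (\<Prod>i\<in>I. (if i = i0 then norm c else 1) * lnorm (p i) (x i))"
    using step.hyps(2) p_pos by (intro prod.cong) (auto simp: z_def lnorm_scale)
  then have nz: "(\<Prod>i\<in>I. lnorm (p i) (z i)) = norm c * (\<Prod>i\<in>I. lnorm (p i) (x i))"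
    using finite_A i0 by (simp add: prod.distrib)
  define y' where "y' = y(m := z)"
  have "(\<Sum>j<Suc m. tens I (y' j) k) = u k + c * tens I x k" for k
    using y(2) tz by (simp add: y'_def)
  moreover have "(\<Sum>j<Suc m. \<Prod>i\<in>I. lnorm (p i) (y' j i)) \<le> s'"
    using y(3) nz step.hyps(3) by (simp add: y'_def)
  moreover have "\<forall>j<Suc m. y' j \<in> tups" using y(1) zt by (simp add: y'_def less_Suc_eq)
  ultimately show ?case by (intro exI[of _ "Suc m"] exI[of _ y']) auto
qed

text \<open>The two sets of costs may differ, since \<open>trep\<close> also admits every larger
  cost; but each such cost dominates a member of the defining set, so the infima agree.\<close>

lemma projective_norm_eq:
  assumes u: "supported_on tups u"
  shows "projective_norm I factors (rel `` {u}) = ptn p I (tensor_fun I u)"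
proof -
  define S where "S = {\<Sum>j<m. \<Prod>i\<in>I. vnorm (factors i) (x j i) | (m::nat) x.
      (\<forall>j<m. x j \<in> tups) \<and> rel `` {u} = rel `` {\<Sum>j<m. gen (x j)}}"
  define T where "T = {s. trep p I (tensor_fun I u) s}"
  have cls: "rel `` {u} = rel `` {\<Sum>j<m. gen (x j)} \<longleftrightarrow> tensor_fun I u = (\<lambda>k. \<Sum>j<m. tens I (x j) k)"
    if "\<forall>j<m. x j \<in> tups" for m :: nat and x
  proof -
    have "supported_on tups (\<Sum>j<m. gen (x j) :: ('i, 'k) free_tuples)"
      using that by (intro supported_on_sum supported_on_gen) auto
    then show ?thesis
      using u eq_equiv_class_iff[OF quot.R, of u "\<Sum>j<m. gen (x j)"]
      by (simp add: free_simps rel_iff_tensor_fun tensor_fun_sum tensor_fun_gen)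
  qed
  have sub: "S \<subseteq> T"
  proof
    fix s assume "s \<in> S"
    then obtain m :: nat and x where x: "\<forall>j<m. x j \<in> tups" "s = (\<Sum>j<m. \<Prod>i\<in>I. lnorm (p i) (x j i))"
      "tensor_fun I u = (\<lambda>k. \<Sum>j<m. tens I (x j) k)"
      unfolding S_def using cls by blast
    have "trep p I (\<lambda>k. 1 * tens I (x j) k) (\<Prod>i\<in>I. lnorm (p i) (x j i))" if "j < m" for j
      using x(1) that by (intro trep_tens) (auto simp: tuples_iff)
    then have "trep p I (\<lambda>k. \<Sum>j\<in>{..<m}. tens I (x j) k) (\<Sum>j\<in>{..<m}. \<Prod>i\<in>I. lnorm (p i) (x j i))"
      by (intro trep_sum) auto
    then show "s \<in> T" using x by (simp add: T_def)
  qed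
  have dom: "\<exists>s'\<in>S. s' \<le> s" if "s \<in> T" for s
  proof -
    have "trep p I (tensor_fun I u) s" using that by (simp add: T_def)
    from trep_tuples[OF this] obtain m :: nat and x where x: "\<forall>j<m. x j \<in> tups"
      "tensor_fun I u = (\<lambda>k. \<Sum>j<m. tens I (x j) k)" "(\<Sum>j<m. \<Prod>i\<in>I. lnorm (p i) (x j i)) \<le> s" by blast
    then have "(\<Sum>j<m. \<Prod>i\<in>I. lnorm (p i) (x j i)) \<in> S"
      unfolding S_def using cls by blast
    then show ?thesis using x(3) by blast
  qed
  have "T \<noteq> {}" using tensor_fun_tset[OF u] by (auto simp: T_def tset_def)
  then have "S \<noteq> {}" using dom by blast
  have "bdd_below T" by (rule bdd_belowI[of _ 0]) (auto simp: T_def dest: trep_nonneg)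
  then have "bdd_below S" using sub by (rule bdd_below_mono)
  have "Inf S = Inf T"
  proof (rule antisym)
    show "Inf S \<le> Inf T" by (rule cInf_mono[OF \<open>T \<noteq> {}\<close> \<open>bdd_below S\<close> dom])
    show "Inf T \<le> Inf S" by (rule cInf_superset_mono[OF \<open>S \<noteq> {}\<close> \<open>bdd_below T\<close> sub])
  qed
  then show ?thesis by (simp add: projective_norm_def S_def T_def ptn_def)
qed

definition emb :: "('i, 'k) free_tuples \<Rightarrow> ('i, 'k) free_tuples set" where
  "emb u = rel `` {u}"

lemma emb_simps:
  shows emb_closed: "supported_on tups u \<Longrightarrow> emb u \<in> elems space"
    and emb_add: "supported_on tups u \<Longrightarrow> supported_on tups v \<Longrightarrow> vadd space (emb u) (emb v) = emb (u + v)"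
    and emb_scale: "supported_on tups u \<Longrightarrow> vscale space c (emb u) = emb (fscale c u)"
    and emb_norm: "supported_on tups u \<Longrightarrow> vnorm space (emb u) = ptn p I (tensor_fun I u)"
    and emb_cases: "X \<in> elems space \<Longrightarrow> \<exists>u. supported_on tups u \<and> X = emb u"
proof -
  show "supported_on tups u \<Longrightarrow> emb u \<in> elems space"
    by (simp add: projective_tensor_def emb_def quotientI free_simps)
  show "supported_on tups u \<Longrightarrow> supported_on tups v \<Longrightarrow> vadd space (emb u) (emb v) = emb (u + v)"
    by (simp add: projective_tensor_def emb_def quot.quotient_add free_simps)
  show "supported_on tups u \<Longrightarrow> vscale space c (emb u) = emb (fscale c u)"
    by (simp add: projective_tensor_def emb_def quot.quotient_scale free_simps)
  show "supported_on tups u \<Longrightarrow> vnorm space (emb u) = ptn p I (tensor_fun I u)"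
    by (simp add: projective_tensor_def emb_def projective_norm_eq)
  show "X \<in> elems space \<Longrightarrow> \<exists>u. supported_on tups u \<and> X = emb u"
    by (auto simp: projective_tensor_def emb_def free_simps elim!: quotientE)
qed

sublocale space: seminormed_nspace space
proof (rule seminormed_nspace.intro)
  show "vector_nspace space" unfolding projective_tensor_def by (rule quot.quotient_vector_nspace)
  show "seminormed_nspace_axioms space"
  proof
    fix X Y and c :: 'k assume "X \<in> elems space"
    then obtain u where u: "supported_on tups u" "X = emb u" using emb_cases by blast
    show "0 \<le> vnorm space X" using u by (simp add: emb_norm ptn_nonneg tensor_fun_tset)
    show "vnorm space (vscale space c X) = norm c * vnorm space X"
      using u by (simp add: emb_scale emb_norm supported_on_fscale tensor_fun_fscale ptn_scale tensor_fun_tset)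
    assume "Y \<in> elems space"
    then obtain v where v: "supported_on tups v" "Y = emb v" using emb_cases by blast
    show "vnorm space (vadd space X Y) \<le> vnorm space X + vnorm space Y"
      using u v by (simp add: emb_add emb_norm supported_on_add tensor_fun_add ptn_triangle tensor_fun_tset)
  qed
qed

lemma emb_diff:
  assumes "supported_on tups u" "supported_on tups v"
  shows "vdiff space (emb u) (emb v) = emb (u - v)"
proof -
  have eq: "u + fscale (-1) v = u - v"
    by (rule poly_mapping_eqI) (simp add: lookup_add lookup_fscale lookup_minus)
  show ?thesis
    unfolding vdiff_def emb_scale[OF assms(2)] emb_add[OF assms(1) supported_on_fscale[OF assms(2)]] eq ..
qed

end

section \<open>The embedding theorem\<close>

lemma ell_ops:
  "vadd (ell q) x y = (\<lambda>n. x n + y n)" "vscale (ell q) c x = (\<lambda>n. c * x n)" "vzero (ell q) = (\<lambda>n. 0)"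
  by (simp_all add: ell_def)

lemma ell_complete:
  fixes s :: "nat \<Rightarrow> nat \<Rightarrow> 'k::{real_normed_field, complete_space}"
  assumes q: "1 \<le> q" and s: "cauchy_in (ell q) s"
  shows "\<exists>x\<in>lspace q. (\<lambda>n. vnorm (ell q) (vdiff (ell q) (s n) x)) \<longlonglongrightarrow> 0"
proof -
  have diff: "vdiff (ell q) x y = (\<lambda>k. x k - y k)" for x y :: "nat \<Rightarrow> 'k"
    by (simp add: vdiff_def ell_ops)
  show ?thesis
    unfolding diff using s by (intro lspace_complete q) (auto simp: cauchy_in_def diff)
qed

context lspace_tensor
begin

definition iota :: "('i, 'k) free_tuples \<Rightarrow> (nat \<Rightarrow> ('i, 'k) free_tuples set) set" where
  "iota w = space.cls (\<lambda>n. emb w)"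

lemma iota_closed: "supported_on tups w \<Longrightarrow> iota w \<in> elems (completion space)"
  by (simp add: iota_def space.cls_closed space.cauchy_in_const emb_closed)

lemma iota_add:
  "supported_on tups u \<Longrightarrow> supported_on tups v \<Longrightarrow> vadd (completion space) (iota u) (iota v) = iota (u + v)"
  by (simp add: iota_def space.cls_add space.cauchy_in_const emb_closed emb_add)

lemma iota_scale: "supported_on tups u \<Longrightarrow> vscale (completion space) c (iota u) = iota (fscale c u)"
  by (simp add: iota_def space.cls_scale space.cauchy_in_const emb_closed emb_scale)

lemma iota_norm:
  assumes "supported_on tups u"
  shows "vnorm (completion space) (iota u) = ptn p I (tensor_fun I u)"
proof -
  have "(\<lambda>n::nat. vnorm space (emb u)) \<longlonglongrightarrow> vnorm (completion space) (iota u)"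
    unfolding iota_def by (intro space.cls_norm space.cauchy_in_const emb_closed assms)
  then show ?thesis using assms by (simp add: LIMSEQ_const_iff emb_norm)
qed

lemma iota_dense:
  assumes "X \<in> elems (completion space)" "0 < e"
  shows "\<exists>u. supported_on tups u \<and> vnorm (completion space) (vdiff (completion space) X (iota u)) < e"
proof -
  obtain x where x: "x \<in> elems space" "vnorm (completion space) (vdiff (completion space) X (space.cls (\<lambda>n. x))) < e"
    by (rule space.completion_dense[OF assms])
  then show ?thesis using emb_cases[OF x(1)] by (auto simp: iota_def)
qed

text \<open>Small perturbation: the images of the unit vectors are replaced by algebraic tensors so
  closely that two-sided bounds survive on finitely supported sequences.\<close>

lemma exponent_of_embedding:
  assumes q: "1 \<le> q"
    and emb: "embeds_into (ell q :: ('k, nat \<Rightarrow> 'k) nspace) (completed_projective_tensor I factors)"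
  shows "\<exists>A. A \<noteq> {} \<and> A \<subseteq> I \<and> q = r_exponent p A"
proof -
  let ?C = "completion space"
  have q0: "0 < q" using q by simp
  interpret L: normed_nspace "ell q :: ('k, nat \<Rightarrow> 'k) nspace" by (rule ell_normed[OF q])
  interpret C: normed_nspace ?C by (rule space.completion_normed)
  obtain T c C where T: "linear_map_on (ell q :: ('k, nat \<Rightarrow> 'k) nspace) ?C T" and c: "0 < c"
    and lower: "\<And>x. x \<in> lspace q \<Longrightarrow> c * lnorm q x \<le> vnorm ?C (T x)"
    and upper: "\<And>x. x \<in> lspace q \<Longrightarrow> vnorm ?C (T x) \<le> C * lnorm q x"
    using embeds_into_bounds[OF L.normed_nspace_axioms C.normed_nspace_axioms emb[unfolded completed_projective_tensor_def]]
    by blast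
  note Tin = linear_map_onD(1)[OF T] and Tadd = linear_map_onD(2)[OF T, unfolded ell_ops]
    and Tscale = linear_map_onD(3)[OF T, unfolded ell_ops]
  \<comment> \<open>These errors sum to \<open>c / 4\<close> and the coefficients of a are at most
    its norm, so the lower constant stays above \<open>c / 2\<close>.\<close>
  define \<epsilon> where "\<epsilon> n = c / 8 * (1 / 2) ^ n" for n :: nat
  have \<epsilon>: "0 < \<epsilon> n" for n using c by (simp add: \<epsilon>_def)
  have unit: "unit_seq n \<in> lspace q" for n by (rule c00_lspace[OF unit_c00 q0])
  have "\<forall>n. \<exists>u. supported_on tups u \<and> vnorm ?C (vdiff ?C (T (unit_seq n)) (iota u)) < \<epsilon> n"
    using iota_dense[OF Tin[OF unit] \<epsilon>] by blast
  from choice[OF this] obtain u where u: "\<And>n. supported_on tups (u n)"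
    and close: "\<And>n. vnorm ?C (vdiff ?C (T (unit_seq n)) (iota (u n))) < \<epsilon> n" by blast
  define U where "U a S = (\<Sum>n\<in>S. fscale (a n) (u n))" for a S
  have U: "supported_on tups (U a S)" for a S
    unfolding U_def by (intro supported_on_sum supported_on_fscale u)
  have approx: "vnorm ?C (vdiff ?C (T (\<lambda>j. \<Sum>n\<in>S. a n * unit_seq n j)) (iota (U a S))) \<le> (\<Sum>n\<in>S. norm (a n) * \<epsilon> n)"
    if "finite S" for S a
    using that
  proof (induction S rule: finite_induct)
    case empty
    have "T (\<lambda>j. 0) = vzero ?C"
      using Tscale[OF L.zero_closed, of 0] C.scale_zero[OF Tin[OF L.zero_closed]] by (simp add: ell_ops)
    moreover have "iota 0 = vzero ?C"
      using iota_scale[OF supported_on_zero, of 0] C.scale_zero[OF iota_closed[OF supported_on_zero]] by simp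
    ultimately show ?case by (simp add: U_def C.diff_self C.zero_closed C.norm_zero)
  next
    case (insert m S)
    let ?x = "\<lambda>j. \<Sum>n\<in>S. a n * unit_seq n j"
    have x: "?x \<in> lspace q"
      by (rule c00_lspace[OF c00_sum[OF c00_scale[OF unit_c00]] q0])
    have am: "(\<lambda>j. a m * unit_seq m j) \<in> lspace q" by (rule lspace_scale[OF unit])
    have um: "supported_on tups (fscale (a m) (u m))" by (rule supported_on_fscale[OF u])
    have eq1: "T (\<lambda>j. \<Sum>n\<in>insert m S. a n * unit_seq n j) = vadd ?C (vscale ?C (a m) (T (unit_seq m))) (T ?x)"
      using Tadd[OF am x] Tscale[OF unit, of "a m" m] insert.hyps by simp
    have eq2: "iota (U a (insert m S)) = vadd ?C (vscale ?C (a m) (iota (u m))) (iota (U a S))"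
      using insert.hyps by (simp add: U_def iota_scale[OF u] iota_add[OF um U[unfolded U_def]])
    have "vnorm ?C (vdiff ?C (vscale ?C (a m) (T (unit_seq m))) (vscale ?C (a m) (iota (u m)))) \<le> norm (a m) * \<epsilon> m"
      using close[of m] by (simp add: C.diff_scale C.norm_scale C.diff_closed Tin unit iota_closed u mult_left_mono)
    then have "vnorm ?C (vdiff ?C (T (\<lambda>j. \<Sum>n\<in>insert m S. a n * unit_seq n j)) (iota (U a (insert m S))))
        \<le> norm (a m) * \<epsilon> m + (\<Sum>n\<in>S. norm (a n) * \<epsilon> n)"
      unfolding eq1 eq2 using insert.IH
      by (intro order_trans[OF C.norm_diff_add_add] add_mono) (simp_all add: C.scale_closed Tin unit iota_closed u U x)
    then show ?case using insert.hyps by simp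
  qed
  define v where "v n = tensor_fun I (u n)" for n
  have near: "\<bar>vnorm ?C (T a) - ptn p I (comb v a)\<bar> \<le> c / 2 * lnorm q a" if a: "a \<in> c00" for a
  proof -
    let ?S = "{n. a n \<noteq> 0}"
    have S: "finite ?S" using a by (simp add: c00_def)
    have al: "a \<in> lspace q" by (rule c00_lspace[OF a q0])
    have "(\<lambda>j. \<Sum>n\<in>?S. a n * unit_seq n j) = a"
      using comb_unit_seq[OF a] by (simp add: comb_def)
    then have "vnorm ?C (vdiff ?C (T a) (iota (U a ?S))) \<le> (\<Sum>n\<in>?S. norm (a n) * \<epsilon> n)"
      using approx[OF S, of a] by simp
    also have "\<dots> \<le> (\<Sum>n\<in>?S. lnorm q a * \<epsilon> n)"
      by (intro sum_mono mult_right_mono norm_le_lnorm[OF q0 al] less_imp_le[OF \<epsilon>])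
    also have "\<dots> = lnorm q a * (c / 8 * (\<Sum>n\<in>?S. (1 / 2) ^ n))"
      by (simp add: \<epsilon>_def sum_distrib_left)
    also have "\<dots> \<le> lnorm q a * (c / 8 * 2)"
    proof (intro mult_left_mono)
      have "(\<Sum>n\<in>?S. (1 / 2 :: real) ^ n) \<le> suminf (\<lambda>n. (1 / 2) ^ n)"
        using S by (intro sum_le_suminf summable_geometric) auto
      also have "\<dots> = 2" by (subst suminf_geometric) auto
      finally show "(\<Sum>n\<in>?S. (1 / 2 :: real) ^ n) \<le> 2" .
    qed (use c in auto)
    also have "\<dots> \<le> c / 2 * lnorm q a" using c lnorm_nonneg[of q a] by (simp add: field_simps)
    finally have "vnorm ?C (vdiff ?C (T a) (iota (U a ?S))) \<le> c / 2 * lnorm q a" .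
    moreover have "vnorm ?C (iota (U a ?S)) = ptn p I (comb v a)"
      unfolding iota_norm[OF U] by (simp add: U_def tensor_fun_sum tensor_fun_fscale comb_def v_def)
    ultimately show ?thesis
      using C.abs_norm_diff_le[OF Tin[OF al] iota_closed[OF U], of a ?S] by simp
  qed
  show ?thesis
  proof (rule basis_equivalence_exponent[OF finite_A q p_ge_1])
    show "v n \<in> tset p I" for n unfolding v_def by (rule tensor_fun_tset[OF u])
    show "0 < c / 2" using c by simp
    show "c / 2 * lnorm q a \<le> ptn p I (comb v a)" if "a \<in> c00" for a
      using near[OF that] lower[OF c00_lspace[OF that q0]] by linarith
    show "ptn p I (comb v a) \<le> (C + c) * lnorm q a" if "a \<in> c00" for a
      unfolding distrib_right
      using near[OF that] upper[OF c00_lspace[OF that q0]] mult_nonneg_nonneg[OF less_imp_le[OF c] lnorm_nonneg[of q a]]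
      by linarith
  qed
qed

subsection \<open>Diagonal embeddings\<close>

text \<open>Factors outside A are pinned at the unit vector of index 0 and contribute norm 1, which
  realises the product over A inside the product over I.\<close>

definition diag_tuple :: "'i set \<Rightarrow> nat \<Rightarrow> 'i \<Rightarrow> nat \<Rightarrow> 'k" where
  "diag_tuple A n = (\<lambda>i\<in>I. unit_seq (if i \<in> A then n else 0))"

definition diag_sum :: "'i set \<Rightarrow> (nat \<Rightarrow> 'k) \<Rightarrow> nat set \<Rightarrow> ('i, 'k) free_tuples" where
  "diag_sum A a S = (\<Sum>n\<in>S. fscale (a n) (gen (diag_tuple A n)))"

lemma diag_sum_supported: "supported_on tups (diag_sum A a S)"
  unfolding diag_sum_def
  by (intro supported_on_sum supported_on_fscale supported_on_gen)
    (auto simp: tuples_iff diag_tuple_def c00_lspace unit_c00 p_pos)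

lemma tensor_fun_diag_sum:
  assumes A: "A \<subseteq> I"
  shows "tensor_fun I (diag_sum A a S) =
    (\<lambda>k. of_bool (\<forall>i\<in>I - A. k i = 0) * (\<Sum>n\<in>S. a n * tens A (\<lambda>_. unit_seq n) k))"
proof -
  have "tens I (diag_tuple A n) k = of_bool (\<forall>i\<in>I - A. k i = 0) * tens A (\<lambda>_. unit_seq n) k" for n k
  proof -
    have "tens I (diag_tuple A n) k = (\<Prod>i\<in>I - A. diag_tuple A n i (k i)) * (\<Prod>i\<in>A. diag_tuple A n i (k i))"
      unfolding tens_def by (rule prod.subset_diff[OF A finite_A])
    also have "(\<Prod>i\<in>I - A. diag_tuple A n i (k i)) = of_bool (\<forall>i\<in>I - A. k i = 0)"
      using finite_A by (simp add: diag_tuple_def unit_seq_def prod_of_bool)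
    also have "(\<Prod>i\<in>A. diag_tuple A n i (k i)) = tens A (\<lambda>_. unit_seq n) k"
      unfolding tens_def using A by (intro prod.cong) (auto simp: diag_tuple_def)
    finally show ?thesis .
  qed
  then show ?thesis
    by (simp add: diag_sum_def tensor_fun_sum tensor_fun_fscale tensor_fun_gen sum_distrib_left mult.left_commute)
qed

text \<open>Slicing at 0 removes the pinned factors and extension restores them, both without loss.
  Over A the blocks are single points, for which the upper and the lower block estimate
  coincide.\<close>

lemma ptn_diag_sum:
  assumes A: "A \<subseteq> I" "A \<noteq> {}" and S: "finite S"
  shows "ptn p I (tensor_fun I (diag_sum A a S)) =
    (\<Sum>n\<in>S. norm (a n) powr r_exponent p A) powr (1 / r_exponent p A)"
proof -
  define r where "r = r_exponent p A"
  have finA: "finite A" using A finite_A finite_subset by blast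
  interpret A: tensor_factors p A by unfold_locales (use finA A p_ge_1 in auto)
  have r: "1 \<le> r" unfolding r_def by (rule r_exponent_ge_1[OF finA A(2) A.p_pos])
  have disj: "disjoint_family_on (\<lambda>n. {n}) S" by (auto simp: disjoint_family_on_def)
  define h where "h = (\<lambda>k. \<Sum>n\<in>S. a n * tens A (\<lambda>_. unit_seq n) k)"
  have tens_unit: "tens A (\<lambda>_. unit_seq n) k = of_bool (\<forall>i\<in>A. k i = n)" for n and k :: "'i \<Rightarrow> nat"
    using finA by (simp add: tens_def unit_seq_def prod_of_bool)
  have fun_eq: "tensor_fun I (diag_sum A a S) = (\<lambda>k. of_bool (\<forall>i\<in>I - A. k i = 0) * h k)"
    unfolding tensor_fun_diag_sum[OF A(1)] h_def ..
  have IA: "I - (I - A) = A" using A by blast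
  let ?R = "(\<Sum>n\<in>S. norm (a n) powr r)"
  have "trep p A (\<lambda>k. a n * tens A (\<lambda>_. unit_seq n) k) (norm (a n))" for n
    using A.p_pos by (intro trep_tens) (auto simp: c00_lspace unit_c00 lnorm_unit)
  then have "trep p A h (?R powr (1 / r))"
    unfolding h_def r_def
    by (intro A.trep_block_diagonal[OF A(2) S disj]) (auto simp: tens_unit split: if_splits)
  then have up: "trep p I (tensor_fun I (diag_sum A a S)) (?R powr (1 / r))"
    unfolding fun_eq using trep_extend[of "I - A" h _ "\<lambda>_. 0"] by (simp add: IA)
  have "?R powr (1 / r) \<le> s" if s: "trep p I (tensor_fun I (diag_sum A a S)) s" for s
  proof -
    have s0: "0 \<le> s" by (rule trep_nonneg[OF s])
    have "trep p A (\<lambda>k. tensor_fun I (diag_sum A a S) (override_on k (\<lambda>_. 0) (I - A))) s"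
      using trep_slice[OF _ s, of "I - A" "\<lambda>_. 0"] by (simp add: IA)
    moreover have "tensor_fun I (diag_sum A a S) (override_on k (\<lambda>_. 0) (I - A)) = h k" for k
      using A(1) by (auto simp: fun_eq h_def tens_unit override_on_def subset_iff intro!: sum.cong)
    ultimately have h: "trep p A h s" by simp
    have "?R \<le> (\<Sum>n\<in>S. ptn p A (\<lambda>k. of_bool (\<forall>i\<in>A. k i \<in> {n}) * h k) powr r)"
    proof (intro sum_mono powr_mono2)
      fix n assume n: "n \<in> S"
      show "norm (a n) \<le> ptn p A (\<lambda>k. of_bool (\<forall>i\<in>A. k i \<in> {n}) * h k)"
      proof (rule ptn_leI)
        show "(\<lambda>k. of_bool (\<forall>i\<in>A. k i \<in> {n}) * h k) \<in> tset p A"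
          by (rule cmult_tset[OF A.cmult_box[OF subset_refl]]) (use h in \<open>auto simp: tset_def\<close>)
        fix t assume "trep p A (\<lambda>k. of_bool (\<forall>i\<in>A. k i \<in> {n}) * h k) t"
        \<comment> \<open>Evaluation at the constant multi-index n reads off the coefficient
          \<open>a n\<close> and never exceeds a cost.\<close>
        from A.norm_le_trep[OF this, of "\<lambda>_. n"] have "norm (h (\<lambda>_. n)) \<le> t" by simp
        moreover have "h (\<lambda>_. n) = (\<Sum>m\<in>S. if n = m then a m else 0)"
          unfolding h_def using A(2) by (intro sum.cong) (auto simp: tens_unit)
        ultimately show "norm (a n) \<le> t" using n S by simp
      qed
    qed (use r in auto)
    also have "\<dots> \<le> s powr r"
      unfolding r_def by (rule A.sum_ptn_box_le[OF h A(2) S disj])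
    finally have "?R powr (1 / r) \<le> (s powr r) powr (1 / r)"
      using r by (intro powr_mono2) (auto intro: sum_nonneg)
    then show ?thesis using r s0 by (simp add: powr_powr)
  qed
  then have "?R powr (1 / r) \<le> ptn p I (tensor_fun I (diag_sum A a S))"
    by (intro ptn_leI tensor_fun_tset diag_sum_supported)
  then show ?thesis using ptn_le[OF up] by (simp add: r_def)
qed

text \<open>The isometry is defined through partial sums, which are Cauchy because tails vanish in
  l_r. Completeness of the sequence space is an assumption here since the locale admits incomplete
  scalars.\<close>

lemma embedding_of_exponent:
  assumes complete: "\<And>s :: nat \<Rightarrow> nat \<Rightarrow> 'k. cauchy_in (ell (r_exponent p A)) s \<Longrightarrow>
      \<exists>x\<in>lspace (r_exponent p A). (\<lambda>n. vnorm (ell (r_exponent p A)) (vdiff (ell (r_exponent p A)) (s n) x)) \<longlonglongrightarrow> 0"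
    and A: "A \<subseteq> I" "A \<noteq> {}"
  shows "embeds_into (ell (r_exponent p A) :: ('k, nat \<Rightarrow> 'k) nspace) (completed_projective_tensor I factors)"
proof -
  define r where "r = r_exponent p A"
  have finA: "finite A" using A finite_A finite_subset by blast
  have r: "1 \<le> r" unfolding r_def using A p_pos by (intro r_exponent_ge_1[OF finA]) auto
  have r0: "0 < r" using r by simp
  define w where "w a m = emb (diag_sum A a {..<m})" for a and m :: nat
  have w: "w a m \<in> elems space" for a m unfolding w_def by (intro emb_closed diag_sum_supported)
  have norm_emb: "vnorm space (emb (diag_sum A a S)) = (\<Sum>n\<in>S. norm (a n) powr r) powr (1 / r)" if "finite S" for a S
    by (simp add: emb_norm[OF diag_sum_supported] ptn_diag_sum[OF A that] r_def)
  have diff_le: "vnorm space (vdiff space (w a m) (w a n)) \<le> lnorm r (\<lambda>k. if k < n then 0 else a k)"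
    if a: "a \<in> lspace r" and nm: "n \<le> m" for a m n
  proof -
    have "diag_sum A a {..<m} - diag_sum A a {..<n} = diag_sum A a {n..<m}"
      unfolding diag_sum_def lessThan_atLeast0 by (rule sum_diff_nat_ivl) (use nm in auto)
    then have eq: "vnorm space (vdiff space (w a m) (w a n)) = (\<Sum>k\<in>{n..<m}. norm (a k) powr r) powr (1 / r)"
      using norm_emb[of "{n..<m}" a] by (simp add: w_def emb_diff diag_sum_supported)
    have "(\<Sum>k\<in>{n..<m}. norm (a k) powr r) = (\<Sum>k\<in>{n..<m}. norm (if k < n then 0 else a k) powr r)"
      by (intro sum.cong) auto
    also have "\<dots> \<le> lnorm r (\<lambda>k. if k < n then 0 else a k) powr r"
      by (rule sum_le_lnorm_powr[OF r0 lspace_mono(1)[OF r0 a]]) auto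
    finally have "(\<Sum>k\<in>{n..<m}. norm (a k) powr r) powr (1 / r) \<le>
        (lnorm r (\<lambda>k. if k < n then 0 else a k) powr r) powr (1 / r)"
      using r0 by (intro powr_mono2) (auto intro: sum_nonneg)
    then show ?thesis using r0 by (simp add: eq powr_powr)
  qed
  have cauchy: "cauchy_in space (w a)" if a: "a \<in> lspace r" for a
    unfolding cauchy_in_def
  proof (intro conjI allI impI)
    show "range (w a) \<subseteq> elems space" using w by blast
    fix e :: real assume e: "0 < e"
    have "eventually (\<lambda>n. lnorm r (\<lambda>k. if k < n then 0 else a k) < e) sequentially"
      using lnorm_tail_tendsto_0[OF r0 a] e by (rule order_tendstoD)
    then obtain M where M: "\<And>n. n \<ge> M \<Longrightarrow> lnorm r (\<lambda>k. if k < n then 0 else a k) < e"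
      by (auto simp: eventually_sequentially)
    have le: "vnorm space (vdiff space (w a m) (w a n)) < e" if "n \<ge> M" "n \<le> m" for m n
      by (rule le_less_trans[OF diff_le[OF a that(2)] M[OF that(1)]])
    have "vnorm space (vdiff space (w a m) (w a n)) < e" if "m \<ge> M" "n \<ge> M" for m n
      using le[of n m] le[of m n] that space.norm_diff_commute[OF w w, of a m a n] by (cases "n \<le> m") auto
    then show "\<exists>M. \<forall>m\<ge>M. \<forall>n\<ge>M. vnorm space (vdiff space (w a m) (w a n)) < e" by blast
  qed
  define T where "T a = space.cls (w a)" for a
  have "embeds_into (ell r :: ('k, nat \<Rightarrow> 'k) nspace) (completion space)"
  proof (rule isometry_embeds_into[OF ell_normed[OF r] space.completion_normed])
    show "linear_map_on (ell r) (completion space) T"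
      unfolding linear_map_on_def
    proof (intro conjI ballI allI)
      show "T \<in> lspace r \<rightarrow> elems (completion space)"
        unfolding T_def by (intro funcsetI space.cls_closed cauchy)
      fix a :: "nat \<Rightarrow> 'k" assume a: "a \<in> lspace r"
      have "w (\<lambda>n. c * a n) = (\<lambda>m. vscale space c (w a m))" for c
        by (rule ext, simp add: w_def emb_scale[OF diag_sum_supported])
          (simp add: diag_sum_def free_space.scale_sum_right free_space.scale_scale)
      then show "T (vscale (ell r) c a) = vscale (completion space) c (T a)" for c
        by (simp add: T_def ell_ops space.cls_scale[OF cauchy[OF a]])
      fix b :: "nat \<Rightarrow> 'k" assume b: "b \<in> lspace r"
      have "w (\<lambda>n. a n + b n) = (\<lambda>m. vadd space (w a m) (w b m))"
        by (rule ext, simp add: w_def emb_add[OF diag_sum_supported diag_sum_supported])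
          (simp add: diag_sum_def free_space.scale_left_distrib sum.distrib)
      then show "T (vadd (ell r) a b) = vadd (completion space) (T a) (T b)"
        by (simp add: T_def ell_ops space.cls_add[OF cauchy[OF a] cauchy[OF b]])
    qed
    show "vnorm (completion space) (T a) = vnorm (ell r) a" if a: "a \<in> lspace r" for a
    proof (rule LIMSEQ_unique)
      show "(\<lambda>m. vnorm space (w a m)) \<longlonglongrightarrow> vnorm (completion space) (T a)"
        unfolding T_def by (rule space.cls_norm[OF cauchy[OF a]])
      have "(\<lambda>m. (\<Sum>n<m. norm (a n) powr r) powr (1 / r)) \<longlonglongrightarrow> vnorm (ell r) a"
        unfolding lnorm_def using a r0
        by (intro tendsto_powr2 summable_LIMSEQ tendsto_const always_eventually allI) (auto simp: lspace_def sum_nonneg)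
      then show "(\<lambda>m. vnorm space (w a m)) \<longlonglongrightarrow> vnorm (ell r) a"
        by (simp add: w_def norm_emb)
    qed
  qed (use complete in \<open>simp add: r_def\<close>)
  then show ?thesis by (simp add: completed_projective_tensor_def r_def)
qed

end

theorem theorem4p1:
  fixes N :: nat and p :: "nat \<Rightarrow> real" and q :: real
  assumes "N \<ge> 1"
    and "\<And>i. i \<in> {1..N} \<Longrightarrow> 1 < p i"
    and "1 \<le> q"
  shows "embeds_into (ell q :: ('k::{real_normed_field, euclidean_space}, nat \<Rightarrow> 'k) nspace)
           (completed_projective_tensor {1..N} (\<lambda>i. ell (p i)))
         \<longleftrightarrow> (\<exists>A. A \<noteq> {} \<and> A \<subseteq> {1..N} \<and> q = r_exponent p A)"
proof -
  interpret lspace_tensor p "{1..N}" "TYPE('k)"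
    by unfold_locales (use assms in \<open>auto intro: less_imp_le\<close>)
  \<comment> \<open>Euclidean scalars are complete, so \<open>ell_complete\<close> discharges the
    completeness assumption of the diagonal embedding.\<close>
  show ?thesis
    using exponent_of_embedding[OF assms(3)] embedding_of_exponent ell_complete assms(3) by blast
qed

end
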